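(* Let $v_n$ be the number of pairs $(D,c)$ where $D$ is a unicycle digraph on the labeled vertex set $\{1,\dots,n\}$ and $c$ is a well-coloring of $D$, and let $V(z)=\sum_{n\ge1}v_n z^n/n!$. With $T=C(2z)/2$, $T_r=-C(-C(2z)/2)$, $T_g=T-T_r$ and $T^{unr.}=T-T^2$ (where $C(z)=z\exp(C(z))$ is the Cayley tree function), \begin{eqnarray*} V(z)&=&T^{unr.}+\frac12\ln\left(\frac{1}{1-2T_g}\right)-T_g-\frac{T_g^2}{2}-\frac{T_rT_g}{2}-\frac{T_rT}{2}\\ &&+\frac12\ln\left(\frac{1}{1-\left(2T_rT+\frac{T_rT_g+T_rT+2T_rTT_g+2T_rT^2}{1-2T_g}\right)}\right)\\ &=&T^{unr.}-T+T_r-\frac{T^2}{2}-\ln(1+T_r)-\frac12\ln(1-2T)\\ &=&z+4\frac{z^2}{2!}+36\frac{z^3}{3!}+692\frac{z^4}{4!}+15920\frac{z^5}{5!}+458622\frac{z^6}{6!}+15559264\frac{z^7}{7!}+O(z^8). \end{eqnarray*}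
   Context: All digraphs are finite, without loops and without multiple arcs (two opposite arcs $(u,v)$ and $(v,u)$ may both be present, forming a cycle of length 2). A child of $u$ is a vertex $v$ with $(u,v)$ an arc. A well-coloring colors each vertex red or green so that every green vertex has at least one red child and no red vertex has a red child (the red vertices then form a kernel). A unicycle digraph is a connected digraph whose underlying undirected multigraph (a pair of opposite arcs counting as a cycle of length 2) has at most one cycle (the cycle need not be directed). $C(z)=\sum_{n\ge1}n^{n-1}z^n/n!$. Exponential generating functions use $z$ to mark vertices.
   Formalization: The printed coefficients 692, 15920, 458622, 15559264 of z^4/4!,...,z^7/7! contradict the closed forms (the z^4 one gives 512+126=638) and are replaced by the correct values 638, 14480, 414312, 14088424. *)

theory Defs
  imports
    "HOL-Computational_Algebra.Formal_Power_Series"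
    "HOL-Library.FuncSet"
    "Graph_Theory.Graph_Theory"
begin

text \<open>
  The underlying undirected multigraph has the arcs of the digraph as its edges, the arc
  \<open>(u, v)\<close> being an edge with ends \<open>u\<close> and \<open>v\<close>. A cycle of it is a closed walk through pairwise
  distinct vertices \<open>vs\<close> along pairwise distinct edges \<open>es\<close>, each traversed in either direction.
  It is identified with its edge set, so that neither starting point nor sense of rotation
  matters. Opposite arcs are distinct edges and form a cycle of length 2.
\<close>

definition undirected_cycles :: "'a pair_pre_digraph \<Rightarrow> ('a \<times> 'a) set set" where
  "undirected_cycles D = {set es | es vs.
     length vs = length es \<and> 2 \<le> length es \<and> distinct vs \<and> distinct es \<and>
     set vs \<subseteq> pverts D \<and> set es \<subseteq> parcs D \<and>
     (\<forall>i < length es. {fst (es ! i), snd (es ! i)} = {vs ! i, vs ! (Suc i mod length vs)})}"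

text \<open>
  The locale \<open>pair_digraph\<close> contains the finite digraphs without loops and multiple arcs
  (arcs are pairs of vertices). Connectedness is that of the underlying undirected graph.
\<close>

definition unicycle_digraph :: "'a pair_pre_digraph \<Rightarrow> bool" where
  "unicycle_digraph D \<longleftrightarrow>
     pair_digraph D \<and> Digraph_Component.connected (with_proj D) \<and>
     (\<forall>F \<in> undirected_cycles D. \<forall>F' \<in> undirected_cycles D. F = F')"

datatype color = Red | Green

definition children :: "'a pair_pre_digraph \<Rightarrow> 'a \<Rightarrow> 'a set" where
  "children D u = {v. (u, v) \<in> parcs D}"

text \<open>Colorings are extensional, so that distinct ones differ at some vertex of the digraph.\<close>

definition well_coloring :: "'a pair_pre_digraph \<Rightarrow> ('a \<Rightarrow> color) \<Rightarrow> bool" where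
  "well_coloring D c \<longleftrightarrow>
     c \<in> pverts D \<rightarrow>\<^sub>E UNIV \<and>
     (\<forall>u \<in> pverts D. c u = Green \<longrightarrow> (\<exists>v \<in> children D u. c v = Red)) \<and>
     (\<forall>u \<in> pverts D. c u = Red \<longrightarrow> \<not> (\<exists>v \<in> children D u. c v = Red))"

definition well_colored_unicycles :: "nat \<Rightarrow> (nat pair_pre_digraph \<times> (nat \<Rightarrow> color)) set" where
  "well_colored_unicycles n =
     {(D, c). unicycle_digraph D \<and> pverts D = {1..n} \<and> well_coloring D c}"

definition well_colored_unicycle_egf :: "real fps" where
  "well_colored_unicycle_egf =
     Abs_fps (\<lambda>n. if n = 0 then 0 else real (card (well_colored_unicycles n)) / fact n)"

definition cayley_tree_fps :: "real fps" where
  "cayley_tree_fps = Abs_fps (\<lambda>n. if n = 0 then 0 else real n ^ (n - 1) / fact n)"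

text \<open>The formal logarithm of a series with constant term 1; \<open>fps_ln 1\<close> is the series of
  \<open>ln (1 + z)\<close>.\<close>

definition fps_log1 :: "real fps \<Rightarrow> real fps" where
  "fps_log1 F = fps_ln 1 oo (F - 1)"

end

(* The underlying multigraph of a connected digraph has at most one cycle iff it carries a map h
   sending each vertex v along an arc owned by v alone, all vertices being led by h into a single
   h-cycle K: a fixed point (a dummy loop at a chosen root) for a tree, the cycle itself otherwise.
   Such an h is a cyclic permutation of K together with a rooted forest; a tree with chosen root has
   exactly one representation, a digraph with a cycle exactly two (the two senses of rotation).
   Rooted forests on n vertices with k given roots number k n^(n-k-1), which are also the
   coefficients of the powers of C.

   A digraph whose cycle is not directed has exactly one well-coloring. Along a directed cycle the
   trees hanging from K leave every cycle vertex either forced green or subject to the rule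
   "red iff its successor is green". So the number of well-colorings minus one is (-1)^|K| if no
   vertex of K is forced, and 0 otherwise. By inclusion-exclusion this is the sum of (-1)^|X| over
   the h-closed sets X containing K whose arcs off K all point away from K. For fixed X this is a
   product of forest numbers, and summing over X substitutes -T into the series of functional
   graphs, which is where T_r = -C(-T) comes from. *)
theory Submission
  imports
    Defs
    "HOL-Combinatorics.Multiset_Permutations"
begin

text \<open>Each group of terms of the closed form is one of the counts. \<open>T\<close> is the
  series of rooted oriented trees; \<open>T - T^2\<close> counts unrooted ones, since a tree has one
  vertex more than it has arcs and \<open>T^2\<close> marks an arc. The series
  \<open>- 1/2 * fps_log1 (1 - 2 * T)\<close> is the sum of \<open>(2 T)^k / (2 k)\<close>: a
  k-cycle of trees, two directions for each cycle arc, halved for the two senses of rotation. The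
  terms \<open>- T - T^2 / 2\<close> delete k = 1 and halve k = 2, where the two arcs have to be
  opposite. Finally \<open>T_r - fps_log1 (1 + T_r)\<close> is the sum over k \<ge> 2 of
  \<open>C(-T)^k / k\<close>: here \<open>C^k / k\<close> describes h on the closed set X, and every
  vertex of X carries a sign and an oriented tree. Both sides are compared coefficient by
  coefficient, as the same finite sums of \<open>rooted_forests\<close>.

  The harder half of the structure theory is that a representation spanning all vertices leaves no
  arc of the digraph over. A leftover arc is exchanged for owned arcs ever closer to K, until a
  second cycle closes.\<close>

unbundle fps_syntax

section \<open>Powers of the tree function\<close>

text \<open>The value \<open>k * n ^ (n - k - 1)\<close>, in a form that is also right for \<open>k = n\<close>.\<close>

definition rooted_forests :: "nat \<Rightarrow> nat \<Rightarrow> real" where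
  "rooted_forests n k = (if n = 0 then 1 else real k * real n ^ (n - k) / real n)"

text \<open>Absorption, \<open>y * (N choose y) = N * (N - 1 choose y - 1)\<close>, reduces the sum
  to the binomial theorem in degree \<open>N - 1\<close>.\<close>

lemma sum_choose_weighted_power:
  fixes a b :: real
  shows "(\<Sum>y\<le>N. real (N choose y) * real y * a ^ y * b ^ (N - y)) = real N * a * (a + b) ^ (N - 1)"
proof (cases N)
  case (Suc M)
  have "(\<Sum>y\<le>Suc M. real (Suc M choose y) * real y * a ^ y * b ^ (Suc M - y))
      = (\<Sum>y\<le>M. real (Suc M choose Suc y) * real (Suc y) * a ^ Suc y * b ^ (M - y))"
    by (simp add: sum.atMost_Suc_shift del: sum.atMost_Suc binomial_Suc_Suc)
  also have "\<dots> = (\<Sum>y\<le>M. real (Suc M) * a * (real (M choose y) * a ^ y * b ^ (M - y)))"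
  proof (rule sum.cong[OF refl])
    fix y
    have "real (Suc M choose Suc y) * real (Suc y) = real (Suc M) * real (M choose y)"
      by (metis Suc_times_binomial mult.commute of_nat_mult)
    then show "real (Suc M choose Suc y) * real (Suc y) * a ^ Suc y * b ^ (M - y) =
        real (Suc M) * a * (real (M choose y) * a ^ y * b ^ (M - y))"
      by simp
  qed
  also have "\<dots> = real (Suc M) * a * (a + b) ^ M"
    by (simp only: binomial_ring sum_distrib_left)
  finally show ?thesis using Suc by simp
qed simp

text \<open>Recursion on the level next to the roots: \<open>y\<close> of the \<open>N\<close>
  nonroots are attached directly to one of the \<open>m\<close> roots, and they are in turn the
  roots of a forest on the \<open>N\<close> nonroots. Sets of maps and coefficients of powers of
  \<open>C\<close> both obey it, which is how the two are matched.\<close>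

lemma rooted_forests_recursion:
  assumes "m > 0"
  shows "rooted_forests (m + N) m = (\<Sum>y\<le>N. real (N choose y) * real m ^ y * rooted_forests N y)"
proof (cases "N = 0")
  case True
  then show ?thesis using assms by (simp add: rooted_forests_def)
next
  case False
  have "(\<Sum>y\<le>N. real (N choose y) * real m ^ y * rooted_forests N y)
     = (\<Sum>y\<le>N. real (N choose y) * real y * real m ^ y * real N ^ (N - y)) / real N"
    using False by (simp add: rooted_forests_def sum_divide_distrib mult_ac)
  also have "\<dots> = real m * (real m + real N) ^ (N - 1)"
    using False by (simp add: sum_choose_weighted_power)
  also have "\<dots> = rooted_forests (m + N) m"
    using False assms by (cases N) (simp_all add: rooted_forests_def add_ac)
  finally show ?thesis by simp
qed

lemma fps_exp_compose_nth:
  assumes "F $ 0 = 0"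
  shows "(fps_exp c oo F) $ n = (\<Sum>y\<le>n. c ^ y / fact y * (F ^ y) $ n)"
  by (simp add: fps_compose_nth atLeast0AtMost)

text \<open>Since \<open>F^m = X^m exp(m F)\<close>, coefficient \<open>n\<close> of
  \<open>F^m\<close> is a combination of the coefficients \<open>n - m\<close> of all powers of
  \<open>F\<close>. Strong induction on \<open>n\<close> through
  \<open>rooted_forests_recursion\<close> then takes the place of Lagrange inversion.\<close>

lemma tree_functional_equation_power_nth:
  fixes F :: "real fps"
  assumes F0: "F $ 0 = 0" and F: "F = fps_X * (fps_exp 1 oo F)"
  shows "(F ^ m) $ n = (if n < m then 0 else rooted_forests n m / fact (n - m))"
proof (induction n arbitrary: m rule: less_induct)
  case (less n)
  show ?case
  proof (cases "n < m \<or> m = 0")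
    case True
    then show ?thesis
    proof
      assume "n < m"
      then show ?thesis using F0 by (simp add: startsby_zero_power_prefix)
    next
      assume "m = 0"
      then show ?thesis by (simp add: rooted_forests_def)
    qed
  next
    case False
    then obtain N where n: "n = m + N" and m: "m > 0"
      by (metis le_Suc_ex not_less zero_less_iff_neq_zero)
    have "F ^ m = fps_X ^ m * (fps_exp 1 oo F) ^ m"
      by (subst F) (simp add: power_mult_distrib)
    also have "(fps_exp 1 oo F) ^ m = fps_exp (real m) oo F"
      by (simp add: fps_compose_power[OF F0] fps_exp_power_mult)
    finally have "(F ^ m) $ n = (fps_exp (real m) oo F) $ N"
      by (simp add: n fps_X_power_mult_nth)
    also have "\<dots> = (\<Sum>y\<le>N. real m ^ y / fact y * (F ^ y) $ N)"
      by (rule fps_exp_compose_nth[OF F0])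
    also have "\<dots> = (\<Sum>y\<le>N. real m ^ y / fact y * (rooted_forests N y / fact (N - y)))"
      using less[of N] m by (intro sum.cong) (auto simp: n)
    also have "\<dots> = (\<Sum>y\<le>N. real (N choose y) * real m ^ y * rooted_forests N y) / fact N"
      by (simp add: sum_divide_distrib binomial_fact mult_ac)
    also have "\<dots> = rooted_forests n m / fact (n - m)"
      by (simp add: rooted_forests_recursion[OF m] n)
    finally show ?thesis using n by simp
  qed
qed

lemma cayley_tree_fps_0 [simp]: "cayley_tree_fps $ 0 = 0"
  by (simp add: cayley_tree_fps_def)

text \<open>The compositional inverse of \<open>X exp(-X)\<close> solves the functional equation,
  and the case \<open>m = 1\<close> of the preceding lemma identifies it with the explicitly given
  series.\<close>

lemma cayley_tree_fps_power_nth: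
  "(cayley_tree_fps ^ m) $ n = (if n < m then 0 else rooted_forests n m / fact (n - m))"
proof -
  define a :: "real fps" where "a = fps_X * fps_exp (-1)"
  define F where "F = fps_inv a"
  have a0: "a $ 0 = 0" and a1: "a $ 1 \<noteq> 0"
    by (simp_all add: a_def)
  have F0: "F $ 0 = 0"
    by (simp add: F_def fps_inv_def)
  have "fps_X = a oo F"
    by (simp add: F_def fps_inv_right[OF a0 a1])
  also have "\<dots> = F * (fps_exp (-1) oo F)"
    by (simp add: a_def fps_compose_mult_distrib[OF F0] F0)
  finally have X: "fps_X = F * (fps_exp (-1) oo F)" .
  have "fps_X * (fps_exp 1 oo F) = F * ((fps_exp (-1) * fps_exp 1) oo F)"
    by (simp add: X[symmetric] fps_compose_mult_distrib[OF F0] mult.assoc[symmetric])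
  also have "\<dots> = F"
    by (simp add: fps_exp_add_mult[symmetric])
  finally have F: "F = fps_X * (fps_exp 1 oo F)" by simp
  have "F = cayley_tree_fps"
  proof (rule fps_ext)
    fix n
    show "F $ n = cayley_tree_fps $ n"
      using tree_functional_equation_power_nth[OF F0 F, of 1 n]
      by (cases n) (auto simp: cayley_tree_fps_def rooted_forests_def)
  qed
  then show ?thesis
    using tree_functional_equation_power_nth[OF F0 F] by simp
qed

section \<open>Formal logarithms and the equality of the two closed forms\<close>

lemma fps_log1_nth:
  assumes "G $ 0 = 0"
  shows "fps_log1 (1 + G) $ n = (\<Sum>k=1..n. (-1) ^ (k - 1) / real k * (G ^ k) $ n)"
proof -
  have "fps_log1 (1 + G) $ n = (\<Sum>k=0..n. fps_ln 1 $ k * (G ^ k) $ n)"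
    by (simp add: fps_log1_def fps_compose_nth)
  also have "\<dots> = (\<Sum>k=1..n. fps_ln 1 $ k * (G ^ k) $ n)"
    by (rule sum.mono_neutral_right) (auto simp: fps_ln_nth)
  also have "\<dots> = (\<Sum>k=1..n. (-1) ^ (k - 1) / real k * (G ^ k) $ n)"
    by (rule sum.cong) (auto simp: fps_ln_nth)
  finally show ?thesis .
qed

lemma fps_deriv_log1:
  assumes "F $ 0 = 1"
  shows "fps_deriv (fps_log1 F) = fps_deriv F * inverse F"
proof -
  have F0: "(F - 1) $ 0 = 0" using assms by simp
  have "(inverse (1 + fps_X) oo (F - 1)) = inverse ((1 + fps_X) oo (F - 1))"
    by (rule fps_inverse_compose) (use F0 in auto)
  also have "(1 + fps_X) oo (F - 1) = F"
    using F0 by (simp only: fps_compose_add_distrib fps_X_fps_compose_startby0) simp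
  finally show ?thesis
    unfolding fps_log1_def by (simp add: fps_compose_deriv[OF F0] fps_ln_deriv)
qed

text \<open>Both sides have the same derivative and constant term 0.\<close>

lemma fps_log1_mult:
  assumes "F $ 0 = 1" "G $ 0 = 1"
  shows "fps_log1 (F * G) = fps_log1 F + fps_log1 G"
proof -
  have [simp]: "F * inverse F = 1" "G * inverse G = 1"
    using assms by (simp_all add: inverse_mult_eq_1')
  have "fps_deriv (fps_log1 (F * G)) = (F * fps_deriv G + fps_deriv F * G) * (inverse F * inverse G)"
    using assms by (subst fps_deriv_log1) (simp_all add: fps_inverse_mult algebra_simps)
  also have "\<dots> = fps_deriv G * inverse G * (F * inverse F) + fps_deriv F * inverse F * (G * inverse G)"
    by (simp only: algebra_simps)
  also have "\<dots> = fps_deriv (fps_log1 F + fps_log1 G)"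
    using assms by (simp add: fps_deriv_log1)
  finally show ?thesis
    using assms by (subst (asm) fps_deriv_eq_iff) (simp add: fps_log1_def fps_compose_nth_0)
qed

lemma fps_log1_1 [simp]: "fps_log1 1 = 0"
  by (simp add: fps_log1_def fps_eq_iff fps_compose_nth)

lemma fps_log1_inverse:
  assumes "F $ 0 = 1"
  shows "fps_log1 (1 / F) = - fps_log1 F"
proof -
  have inv: "1 / F = inverse F" using assms by (simp add: fps_divide_unit)
  have "fps_log1 (inverse F) + fps_log1 F = fps_log1 (inverse F * F)"
    using assms by (intro fps_log1_mult[symmetric]) auto
  also have "inverse F * F = 1" using assms by (simp add: inverse_mult_eq_1)
  finally show ?thesis unfolding inv by (simp add: eq_neg_iff_add_eq_0)
qed

text \<open>Let \<open>A\<close> and \<open>B\<close> be the denominators inside the two logarithms.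
  Then \<open>A * B = (1 + T_r)^2 * (1 - 2 * T)\<close>, so half the sum of the logarithms splits as
  required. The polynomial terms agree because \<open>T_g^2 + T_r * T_g + T_r * T = T^2\<close> when
  \<open>T_g = T - T_r\<close>.\<close>

lemma log_series_identity:
  fixes T T_r T_g T_unr :: "real fps"
  assumes T0: "T $ 0 = 0" "T_r $ 0 = 0" and g: "T_g = T - T_r"
  shows "T_unr + 1/2 * fps_log1 (1 / (1 - 2 * T_g)) - T_g - T_g^2 / 2 - T_r * T_g / 2 - T_r * T / 2
           + 1/2 * fps_log1 (1 / (1 - (2 * T_r * T
               + (T_r * T_g + T_r * T + 2 * T_r * T * T_g + 2 * T_r * T^2) / (1 - 2 * T_g))))
    = T_unr - T + T_r - T^2 / 2 - fps_log1 (1 + T_r) - 1/2 * fps_log1 (1 - 2 * T)"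
proof -
  define P where "P = T_r * T_g + T_r * T + 2 * T_r * T * T_g + 2 * T_r * T^2"
  define A where "A = 1 - 2 * T_g"
  define B where "B = 1 - (2 * T_r * T + P / A)"
  have g0: "T_g $ 0 = 0" and P0: "P $ 0 = 0" using T0 g by (simp_all add: P_def)
  have A0: "A $ 0 = 1" using g0 by (simp add: A_def)
  have PA: "P / A = P * inverse A" using A0 by (simp add: fps_divide_unit)
  have B0: "B $ 0 = 1" using T0 P0 by (simp add: B_def PA)
  have "A * B = A - A * (2 * T_r * T) - P * (A * inverse A)"
    by (simp add: B_def PA algebra_simps)
  also have "A * inverse A = 1" using A0 by (simp add: inverse_mult_eq_1')
  also have "A - A * (2 * T_r * T) - P * 1 = (1 + T_r) * (1 + T_r) * (1 - 2 * T)"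
    by (simp add: A_def P_def g algebra_simps power2_eq_square)
  finally have "fps_log1 (A * B) = fps_log1 ((1 + T_r) * (1 + T_r) * (1 - 2 * T))" by simp
  then have log: "fps_log1 A + fps_log1 B = 2 * fps_log1 (1 + T_r) + fps_log1 (1 - 2 * T)"
    using A0 B0 T0 by (simp add: fps_log1_mult)
  \<comment> \<open>Here \<open>1/2\<close> and \<open>/ 2\<close> are divisions of power series;
    multiplication by the constant \<open>h\<close> replaces them, so that what remains is ring
    arithmetic.\<close>
  define h :: "real fps" where "h = fps_const (1/2)"
  have h2: "h * (2 * F) = F" for F
    by (simp add: h_def numeral_fps_const mult.assoc[symmetric])
  have half: "F / 2 = h * F" for F
    by (simp add: h_def numeral_fps_const fps_divide_unit fps_const_inverse mult.commute)
  have half1: "1/2 = h"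
    using half[of 1] by simp
  have "h * (fps_log1 A + fps_log1 B) = h * (2 * fps_log1 (1 + T_r) + fps_log1 (1 - 2 * T))"
    unfolding log ..
  then have "h * fps_log1 A + h * fps_log1 B = fps_log1 (1 + T_r) + h * fps_log1 (1 - 2 * T)"
    by (simp only: distrib_left h2)
  then have "- (h * fps_log1 A) + - (h * fps_log1 B) = - fps_log1 (1 + T_r) - h * fps_log1 (1 - 2 * T)"
    by (simp only: minus_add_distrib[symmetric] diff_conv_add_uminus)
  then have 1: "1/2 * fps_log1 (1 / A) + 1/2 * fps_log1 (1 / B) =
     - fps_log1 (1 + T_r) - 1/2 * fps_log1 (1 - 2 * T)"
    unfolding half1 using A0 B0 by (simp add: fps_log1_inverse)
  have "2 * T_g + (T_g^2 + (T_r * T_g + T_r * T)) = 2 * T + (T^2 - 2 * T_r)"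
    by (simp add: g algebra_simps power2_eq_square)
  then have "h * (2 * T_g + (T_g^2 + (T_r * T_g + T_r * T))) = h * (2 * T + (T^2 - 2 * T_r))"
    by simp
  then have 2: "T_g + (T_g^2 / 2 + (T_r * T_g / 2 + T_r * T / 2)) = T + (T^2 / 2 - T_r)"
    unfolding half by (simp only: distrib_left right_diff_distrib h2)
  show ?thesis
    unfolding P_def[symmetric] A_def[symmetric] B_def[symmetric]
    using 1 2 by (simp add: algebra_simps)
qed


section \<open>Coefficients of the closed form\<close>

lemma half_fps: "F / 2 = fps_const (1/2 :: real) * F"
  by (simp add: numeral_fps_const fps_divide_unit fps_const_inverse mult.commute)

lemma fps_compose_double_nth: "(F oo (2 * fps_X)) $ n = 2 ^ n * F $ n" for F :: "real fps"
proof -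
  have "(2 * fps_X :: real fps) ^ i = fps_const (2 ^ i) * fps_X ^ i" for i
    by (simp add: power_mult_distrib numeral_fps_const fps_const_power)
  then have "(F oo (2 * fps_X)) $ n = (\<Sum>i=0..n. F $ i * (2 ^ i * (if n = i then 1 else 0)))"
    by (simp add: fps_compose_nth)
  also have "\<dots> = (\<Sum>i=0..n. if n = i then 2 ^ n * F $ n else 0)"
    by (rule sum.cong) auto
  finally show ?thesis by simp
qed

text \<open>The factor \<open>2 ^ (n - m)\<close> is one choice of direction for the arc between
  each of the \<open>n - m\<close> nonroots and its parent.\<close>

lemma oriented_tree_power_nth:
  assumes "T = (cayley_tree_fps oo (2 * fps_X)) / 2"
  shows "(T ^ m) $ n = (if n < m then 0 else 2 ^ (n - m) * rooted_forests n m / fact (n - m))"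
proof -
  have "T ^ m = fps_const (1 / 2 ^ m) * (cayley_tree_fps ^ m oo (2 * fps_X))"
    unfolding assms half_fps
    by (simp add: power_mult_distrib fps_const_power fps_compose_power power_one_over)
  then have "(T ^ m) $ n = 2 ^ n / 2 ^ m * (cayley_tree_fps ^ m) $ n"
    by (simp add: fps_compose_double_nth)
  then show ?thesis
    by (simp add: cayley_tree_fps_power_nth power_diff)
qed

lemma red_tree_power_nth:
  assumes "T $ 0 = 0" and "T_r = - (cayley_tree_fps oo (- T))"
  shows "(T_r ^ k) $ n = (-1) ^ k * (\<Sum>m=0..n. (cayley_tree_fps ^ k) $ m * ((-1) ^ m * (T ^ m) $ n))"
proof -
  have neg: "(- F) ^ j = fps_const ((-1) ^ j) * F ^ j" for F :: "real fps" and j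
    by (subst power_minus) (simp add: fps_const_power[symmetric] fps_const_neg[symmetric] del: fps_const_neg)
  have "T_r ^ k = fps_const ((-1) ^ k) * (cayley_tree_fps ^ k oo (- T))"
    unfolding assms(2) neg using assms(1) by (simp add: fps_compose_power)
  then show ?thesis
    by (simp add: fps_compose_nth neg)
qed

text \<open>The right-hand side has the shape in which the counting delivers it: trees, digraphs
  with a cycle of length \<open>k\<close>, and signed pairs of a closed set of size \<open>m\<close>
  with a cycle of length \<open>k\<close> inside it.\<close>

lemma closed_form_nth:
  fixes T T_r T_unr :: "real fps"
  assumes T: "T = (cayley_tree_fps oo (2 * fps_X)) / 2"
    and T_r: "T_r = - (cayley_tree_fps oo (- T))"
    and n: "n > 0"
  shows "((T - T^2) - T + T_r - T^2 / 2 - fps_log1 (1 + T_r) - 1/2 * fps_log1 (1 - 2 * T)) $ n =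
    2 ^ (n - 1) * rooted_forests n 1 / fact n
    + (\<Sum>k=2..n. (if k = 2 then 1/2 else 1) * 2 ^ n * rooted_forests n k / (real k * fact (n - k))) / 2
    + (\<Sum>m=2..n. \<Sum>k=2..m. (-1) ^ m * 2 ^ (n - m) * rooted_forests n m / fact (n - m)
         * (rooted_forests m k / (real k * fact (m - k))))"
proof -
  have T0: "T $ 0 = 0"
    using oriented_tree_power_nth[OF T, of 1 0] by simp
  have Tr0: "T_r $ 0 = 0"
    by (simp add: T_r fps_compose_nth)
  have neg: "(- F) ^ j = fps_const ((-1) ^ j) * F ^ j" for F :: "real fps" and j
    by (subst power_minus) (simp add: fps_const_power[symmetric] fps_const_neg[symmetric] del: fps_const_neg)
  have dbl: "(2 * F) ^ j = fps_const (2 ^ j) * F ^ j" for F :: "real fps" and j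
    by (simp add: power_mult_distrib numeral_fps_const fps_const_power)
  have split2: "sum f {1..n} = f 1 + sum f {2..n}" for f :: "nat \<Rightarrow> real"
    using n by (simp add: sum.atLeast_Suc_atMost numeral_2_eq_2)

  have "fps_log1 (1 - 2 * T) $ n = (\<Sum>k=1..n. (-1) ^ (k - 1) / real k * ((- (2 * T)) ^ k) $ n)"
    using fps_log1_nth[of "- (2 * T)" n] T0 by simp
  also have "\<dots> = (\<Sum>k=1..n. - (2 ^ k / real k * (T ^ k) $ n))"
  proof (rule sum.cong[OF refl])
    fix k assume "k \<in> {1..n}"
    then obtain j where "k = Suc j" by (cases k) auto
    then show "(-1) ^ (k - 1) / real k * ((- (2 * T)) ^ k) $ n = - (2 ^ k / real k * (T ^ k) $ n)"
      by (simp only: neg dbl fps_mult_left_const_nth) (simp add: power_mult_distrib[symmetric])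
  qed
  \<comment> \<open>The term \<open>k = 1\<close> is split off, here and for \<open>1 + T_r\<close>
    below, because it cancels against \<open>- T\<close> and \<open>T_r\<close> in the closed
    form.\<close>
  also have "\<dots> = - (2 * T $ n) - (\<Sum>k=2..n. 2 ^ k / real k * (T ^ k) $ n)"
    by (subst split2) (simp add: sum_negf)
  finally have log1: "fps_log1 (1 - 2 * T) $ n = \<dots>" .

  have "fps_log1 (1 + T_r) $ n = (\<Sum>k=1..n. (-1) ^ (k - 1) / real k * (T_r ^ k) $ n)"
    using Tr0 by (rule fps_log1_nth)
  also have "\<dots> = T_r $ n + (\<Sum>k=2..n. (-1) ^ (k - 1) / real k * (T_r ^ k) $ n)"
    by (subst split2) simp
  also have "(\<Sum>k=2..n. (-1) ^ (k - 1) / real k * (T_r ^ k) $ n) =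
     - (\<Sum>k=2..n. \<Sum>m=0..n. (-1) ^ m * (T ^ m) $ n * ((cayley_tree_fps ^ k) $ m / real k))"
    unfolding sum_negf[symmetric]
  proof (rule sum.cong[OF refl])
    fix k assume "k \<in> {2..n}"
    then obtain j where k: "k = Suc j" by (cases k) auto
    have "(-1) ^ j * (-1) ^ k = (-1 :: real)"
      by (simp add: k power_mult_distrib[symmetric])
    then have "(-1) ^ (k - 1) * ((-1) ^ k * x) / real k = - (x / real k)" for x
      by (simp add: k mult.assoc[symmetric])
    then have "(-1) ^ (k - 1) / real k * (T_r ^ k) $ n =
       - ((\<Sum>m=0..n. (cayley_tree_fps ^ k) $ m * ((-1) ^ m * (T ^ m) $ n)) / real k)"
      by (simp only: red_tree_power_nth[OF T0 T_r] times_divide_eq_left)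
    then show "(-1) ^ (k - 1) / real k * (T_r ^ k) $ n =
      (\<Sum>m=0..n. - ((-1) ^ m * (T ^ m) $ n * ((cayley_tree_fps ^ k) $ m / real k)))"
      by (simp add: sum_divide_distrib sum_negf mult_ac)
  qed
  also have "(\<Sum>k=2..n. \<Sum>m=0..n. (-1) ^ m * (T ^ m) $ n * ((cayley_tree_fps ^ k) $ m / real k))
     = (\<Sum>m=0..n. \<Sum>k=2..n. (-1) ^ m * (T ^ m) $ n * ((cayley_tree_fps ^ k) $ m / real k))"
    by (rule sum.swap)
  also have "\<dots> = (\<Sum>m=2..n. \<Sum>k=2..n. (-1) ^ m * (T ^ m) $ n * ((cayley_tree_fps ^ k) $ m / real k))"
    by (rule sum.mono_neutral_right) (auto simp: cayley_tree_fps_power_nth intro!: sum.neutral)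
  also have "\<dots> = (\<Sum>m=2..n. \<Sum>k=2..m. (-1) ^ m * 2 ^ (n - m) * rooted_forests n m / fact (n - m)
         * (rooted_forests m k / (real k * fact (m - k))))"
  proof (rule sum.cong[OF refl])
    fix m assume m: "m \<in> {2..n}"
    have "(\<Sum>k=2..n. (-1) ^ m * (T ^ m) $ n * ((cayley_tree_fps ^ k) $ m / real k)) =
      (\<Sum>k=2..m. (-1) ^ m * (T ^ m) $ n * ((cayley_tree_fps ^ k) $ m / real k))"
      using m by (intro sum.mono_neutral_right) (auto simp: cayley_tree_fps_power_nth)
    also have "\<dots> = (\<Sum>k=2..m. (-1) ^ m * 2 ^ (n - m) * rooted_forests n m / fact (n - m)
         * (rooted_forests m k / (real k * fact (m - k))))"
      using m by (intro sum.cong) (auto simp: cayley_tree_fps_power_nth oriented_tree_power_nth[OF T] mult_ac)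
    finally show "(\<Sum>k=2..n. (-1) ^ m * (T ^ m) $ n * ((cayley_tree_fps ^ k) $ m / real k)) = \<dots>" .
  qed
  finally have log2: "fps_log1 (1 + T_r) $ n = T_r $ n - \<dots>" by simp

  \<comment> \<open>Subtracting \<open>T^2 / 2\<close> halves the contribution of
    \<open>k = 2\<close>, whence the factor \<open>1/2\<close> there.\<close>
  have cyc: "(\<Sum>k=2..n. 2 ^ k / real k * (T ^ k) $ n) / 2 - (T^2) $ n / 2 =
    (\<Sum>k=2..n. (if k = 2 then 1/2 else 1) * 2 ^ n * rooted_forests n k / (real k * fact (n - k))) / 2"
  proof -
    have *: "2 ^ k * (T ^ k) $ n = 2 ^ n * rooted_forests n k / fact (n - k)" if "k \<le> n" for k
    proof -
      have "(2::real) ^ n = 2 ^ k * 2 ^ (n - k)" using that by (simp flip: power_add)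
      then show ?thesis using that by (simp add: oriented_tree_power_nth[OF T])
    qed
    show ?thesis
    proof (cases "n \<ge> 2")
      case True
      have s: "sum f {2..n} = f 2 + sum f {3..n}" for f :: "nat \<Rightarrow> real"
        using True by (simp add: sum.atLeast_Suc_atMost numeral_3_eq_3 numeral_2_eq_2)
      have "(\<Sum>k=3..n. 2 ^ k / real k * (T ^ k) $ n) =
         (\<Sum>k=3..n. (if k = 2 then 1/2 else 1) * 2 ^ n * rooted_forests n k / (real k * fact (n - k)))"
        by (rule sum.cong) (auto simp: * mult.commute[of "real _"] simp flip: divide_divide_eq_left)
      then show ?thesis
        unfolding s using *[of 2] True by (simp add: field_simps)
    next
      case False
      then show ?thesis using n oriented_tree_power_nth[OF T, of 2 n] by simp
    qed
  qed
  \<comment> \<open>For \<open>n \<ge> 2\<close> this is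
    \<open>q / (n - 1) - q / n = q / (n * (n - 1))\<close> with a common factor \<open>q\<close>;
    the denominator \<open>n - 1\<close> sets \<open>n = 1\<close> apart.\<close>
  have tree: "T $ n - (T^2) $ n = 2 ^ (n - 1) * rooted_forests n 1 / fact n"
  proof (cases "n = 1")
    case True
    then show ?thesis using oriented_tree_power_nth[OF T, of 2 n] oriented_tree_power_nth[OF T, of 1 n]
      by (simp add: rooted_forests_def)
  next
    case False
    then obtain j where j: "n = Suc (Suc j)"
      using n by (metis One_nat_def not0_implies_Suc gr_implies_not0)
    define x where "x = real j + 1"
    define q where "q = 2 ^ Suc j * (x + 1) ^ j / fact j"
    have n': "real n = x + 1" and x: "x > 0" by (simp_all add: x_def j)
    have "T $ n = q / x"
      using oriented_tree_power_nth[OF T, of 1 n] x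
      by (simp add: j q_def rooted_forests_def) (simp add: x_def add_ac)
    moreover have "(T^2) $ n = q / (x + 1)"
      using oriented_tree_power_nth[OF T, of 2 n] n' x
      by (simp add: j q_def rooted_forests_def) (simp add: x_def add_ac mult_ac)
    moreover have "2 ^ (n - 1) * rooted_forests n 1 / fact n = q / ((x + 1) * x)"
      using n' x by (simp add: j q_def rooted_forests_def) (simp add: x_def add_ac)
    moreover have "q / x - q / (x + 1) = q / ((x + 1) * x)"
      using x by (simp add: divide_simps) (simp add: algebra_simps)
    ultimately show ?thesis by simp
  qed
  have half_nth: "(F / 2) $ n = F $ n / 2" "(1/2 * F) $ n = F $ n / 2" for F :: "real fps"
    by (simp_all only: half_fps mult_1_right fps_mult_left_const_nth)
  have combine: "t - t2 - t + r - t2 / 2 - l2 - l1 / 2 = t - t2 + (S / 2 - t2 / 2) + M"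
    if "l1 = - (2 * t) - S" "l2 = r - M" for l1 l2 t t2 r S M :: real
    using that by (simp add: field_simps)
  show ?thesis
    unfolding tree[symmetric] cyc[symmetric]
    by (simp only: fps_sub_nth fps_add_nth half_nth) (rule combine[OF log1 log2])
qed

text \<open>These are the coefficients that the closed form has. From \<open>n = 4\<close> on they
  differ from the numbers 692, 15920, 458622 and 15559264 in the expansion of the English statement.
  For instance \<open>n = 4\<close> gives 128 for the trees, 432 for the digraphs with a cycle and a
  signed excess of 192 - 192 + 78, in all 638.\<close>

lemma closed_form_values:
  defines "a \<equiv> \<lambda>n. 2 ^ (n - 1) * rooted_forests n 1 / fact n
    + (\<Sum>k=2..n. (if k = 2 then 1/2 else 1) * 2 ^ n * rooted_forests n k / (real k * fact (n - k))) / 2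
    + (\<Sum>m=2..n. \<Sum>k=2..m. (-1) ^ m * 2 ^ (n - m) * rooted_forests n m / fact (n - m)
         * (rooted_forests m k / (real k * fact (m - k))))"
  shows "a 1 = 1" "a 2 = 4 / fact 2" "a 3 = 36 / fact 3" "a 4 = 638 / fact 4"
    "a 5 = 14480 / fact 5" "a 6 = 414312 / fact 6" "a 7 = 14088424 / fact 7"
proof -
  have "{2..3} = {2,3::nat}" "{2..4} = {2,3,4::nat}" "{2..5} = {2,3,4,5::nat}"
    "{2..6} = {2,3,4,5,6::nat}" "{2..7} = {2,3,4,5,6,7::nat}"
    by auto
  note simps = this a_def rooted_forests_def fact_numeral
  show "a 1 = 1" "a 2 = 4 / fact 2" "a 3 = 36 / fact 3" "a 4 = 638 / fact 4"
    "a 5 = 14480 / fact 5" "a 6 = 414312 / fact 6" "a 7 = 14088424 / fact 7"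
    by (simp_all add: simps)
qed

section \<open>Maps with a single cycle\<close>

text \<open>The orbit of a vertex enters \<open>K\<close>. The inductive form supports induction
  along an orbit towards \<open>K\<close>; \<open>leads_iff_funpow\<close> gives the form with
  iterates.\<close>

inductive leads :: "('a \<Rightarrow> 'a) \<Rightarrow> 'a set \<Rightarrow> 'a \<Rightarrow> bool" for h K where
  here: "v \<in> K \<Longrightarrow> leads h K v"
| step: "leads h K (h v) \<Longrightarrow> leads h K v"

text \<open>Follow the orbit under \<open>f\<close>: as long as neither \<open>K\<close> nor
  \<open>K'\<close> is reached, \<open>g\<close> takes the same step, and from a point of
  \<open>K\<close> on, \<open>g\<close> is known to reach \<open>K'\<close>. Used whenever maps are
  restricted or glued.\<close>

lemma leads_transfer:
  assumes "leads f K v" "v \<in> V"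
    and "\<And>x. x \<in> V \<Longrightarrow> x \<notin> K \<Longrightarrow> x \<notin> K' \<Longrightarrow> g x = f x \<and> f x \<in> V"
    and "\<And>x. x \<in> V \<Longrightarrow> x \<in> K \<Longrightarrow> leads g K' x"
  shows "leads g K' v"
  using assms(1,2)
proof (induction rule: leads.induct)
  case (here v)
  then show ?case using assms(4) by blast
next
  case (step v)
  then show ?case using assms(3,4) by (metis leads.intros)
qed

text \<open>\<open>K\<close> is the set of roots and \<open>f\<close> the parent map. Extensionality
  on \<open>V - K\<close> makes equal forests equal as functions.\<close>

definition forests :: "'a set \<Rightarrow> 'a set \<Rightarrow> ('a \<Rightarrow> 'a) set" where
  "forests V K = {f \<in> (V - K) \<rightarrow>\<^sub>E V. \<forall>v\<in>V. leads f K v}"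

definition cyclic_maps :: "'a set \<Rightarrow> 'a set \<Rightarrow> ('a \<Rightarrow> 'a) set" where
  "cyclic_maps V K = {h \<in> V \<rightarrow>\<^sub>E V. h ` K \<subseteq> K \<and> (\<forall>x\<in>K. \<forall>y\<in>K. \<exists>i. (h ^^ i) x = y) \<and> (\<forall>v\<in>V. leads h K v)}"

lemma finite_forests [intro]: "finite V \<Longrightarrow> finite (forests V K)"
  unfolding forests_def by (rule finite_subset[of _ "(V - K) \<rightarrow>\<^sub>E V"]) (auto intro: finite_PiE)

lemma finite_cyclic_maps [intro]: "finite V \<Longrightarrow> finite (cyclic_maps V K)"
  unfolding cyclic_maps_def by (rule finite_subset[of _ "V \<rightarrow>\<^sub>E V"]) (auto intro: finite_PiE)

lemma cyclic_mapsD: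
  assumes "h \<in> cyclic_maps V K"
  shows "h \<in> V \<rightarrow>\<^sub>E V" "h ` V \<subseteq> V" "h ` K \<subseteq> K" "\<And>v. v \<in> V \<Longrightarrow> leads h K v"
    "\<And>x y. x \<in> K \<Longrightarrow> y \<in> K \<Longrightarrow> \<exists>i. (h ^^ i) x = y"
  using assms unfolding cyclic_maps_def by (blast dest: PiE_mem)+

lemma sum_Pow_card:
  assumes "finite A"
  shows "(\<Sum>Y\<in>Pow A. g (card Y)) = (\<Sum>y\<le>card A. real (card A choose y) * g y)"
proof -
  have "(\<Sum>Y\<in>Pow A. g (card Y)) = (\<Sum>y\<le>card A. \<Sum>Y\<in>{Y \<in> Pow A. card Y = y}. g (card Y))"
    using assms by (intro sum.group[symmetric]) (auto intro: card_mono)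
  also have "\<dots> = (\<Sum>y\<le>card A. real (card A choose y) * g y)"
    using assms by (intro sum.cong) (auto simp: n_subsets)
  finally show ?thesis .
qed

text \<open>The bijection behind \<open>rooted_forests_recursion\<close>: \<open>Y\<close> collects
  the vertices whose parent is a root, and deleting the roots leaves a forest on
  \<open>V - K\<close> with root set \<open>Y\<close>.\<close>

lemma forests_level_bij:
  fixes V K :: "'a set"
  defines "\<Phi> \<equiv> \<lambda>f. let Y = {v \<in> V - K. f v \<in> K} in (Y, restrict f Y, restrict f (V - K - Y))"
  assumes "K \<subseteq> V"
  shows "bij_betw \<Phi> (forests V K) (SIGMA Y:Pow (V - K). (Y \<rightarrow>\<^sub>E K) \<times> forests (V - K) Y)"
proof -
  define \<Psi> :: "'a set \<times> ('a \<Rightarrow> 'a) \<times> ('a \<Rightarrow> 'a) \<Rightarrow> 'a \<Rightarrow> 'a"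
    where "\<Psi> = (\<lambda>(Y, a, b) v. if v \<in> Y then a v else b v)"
  let ?S = "SIGMA Y:Pow (V - K). (Y \<rightarrow>\<^sub>E K) \<times> forests (V - K) Y"
  have 1: "\<Psi> (\<Phi> f) = f \<and> \<Phi> f \<in> ?S" if f: "f \<in> forests V K" for f
  proof
    define Y where "Y = {v \<in> V - K. f v \<in> K}"
    have \<Phi>: "\<Phi> f = (Y, restrict f Y, restrict f (V - K - Y))"
      by (simp add: \<Phi>_def Y_def Let_def)
    have fPi: "f \<in> (V - K) \<rightarrow>\<^sub>E V" using f by (simp add: forests_def)
    show "\<Psi> (\<Phi> f) = f"
    proof
      fix v
      show "\<Psi> (\<Phi> f) v = f v"
        using PiE_arb[OF fPi, of v] by (cases "v \<in> V - K") (simp_all add: \<Phi> \<Psi>_def Y_def)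
    qed
    have "leads (restrict f (V - K - Y)) Y v" if "v \<in> V - K" for v
    proof -
      have "leads f K v" using f that by (auto simp: forests_def)
      then show ?thesis using that
      proof (induction rule: leads.induct)
        case (step v)
        have "f v \<in> V" using fPi step.prems by auto
        show ?case
        proof (cases "v \<in> Y")
          case False
          then have "f v \<in> V - K" using \<open>f v \<in> V\<close> step.prems by (auto simp: Y_def)
          then have "leads (restrict f (V - K - Y)) Y (f v)"
            by (rule step.IH)
          moreover have "restrict f (V - K - Y) v = f v" using step.prems False by simp
          ultimately show ?thesis by (metis leads.step)
        qed (rule leads.here)
      qed auto
    qed
    moreover have "restrict f (V - K - Y) \<in> (V - K - Y) \<rightarrow>\<^sub>E (V - K)"
      using fPi by (auto simp: Y_def)
    ultimately have "restrict f (V - K - Y) \<in> forests (V - K) Y"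
      by (simp add: forests_def)
    moreover have "restrict f Y \<in> Y \<rightarrow>\<^sub>E K" "Y \<subseteq> V - K"
      by (auto simp: Y_def)
    ultimately show "\<Phi> f \<in> ?S"
      unfolding \<Phi> by (intro SigmaI PowI)
  qed
  have 2: "\<Phi> (\<Psi> p) = p \<and> \<Psi> p \<in> forests V K" if pS: "p \<in> ?S" for p
  proof
    obtain Y a b where p: "p = (Y, a, b)" "Y \<subseteq> V - K" "a \<in> Y \<rightarrow>\<^sub>E K" "b \<in> (V - K - Y) \<rightarrow>\<^sub>E (V - K)"
      and l: "\<And>v. v \<in> V - K \<Longrightarrow> leads b Y v"
      using pS unfolding forests_def by blast
    define f where "f = \<Psi> p"
    have f_Y: "f v = a v" if "v \<in> Y" for v using that by (simp add: f_def \<Psi>_def p(1))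
    have f_nY: "f v = b v" if "v \<notin> Y" for v using that by (simp add: f_def \<Psi>_def p(1))
    have Y: "{v \<in> V - K. f v \<in> K} = Y"
    proof (intro set_eqI iffI)
      fix v assume "v \<in> {v \<in> V - K. f v \<in> K}"
      then show "v \<in> Y" using PiE_mem[OF p(4), of v] f_nY[of v] by (cases "v \<in> Y") auto
    next
      fix v assume "v \<in> Y"
      then show "v \<in> {v \<in> V - K. f v \<in> K}" using PiE_mem[OF p(3), of v] f_Y[of v] p(2) by auto
    qed
    have "restrict f Y v = a v" for v
      using PiE_arb[OF p(3), of v] f_Y[of v] by (cases "v \<in> Y") simp_all
    then have "restrict f Y = a" ..
    moreover have "restrict f (V - K - Y) v = b v" for v
      using PiE_arb[OF p(4), of v] f_nY[of v] by (cases "v \<in> V - K - Y") simp_all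
    then have "restrict f (V - K - Y) = b" ..
    ultimately show "\<Phi> (\<Psi> p) = p"
      unfolding f_def[symmetric] by (simp only: \<Phi>_def Let_def Y p(1))
    have lK: "leads f K v" if "v \<in> V - K" for v
    proof (rule leads_transfer[OF l[OF that] that])
      fix x assume "x \<in> V - K" "x \<in> Y"
      then have "f x \<in> K" using p(3) f_Y by auto
      then show "leads f K x" by (rule leads.step[OF leads.here])
    next
      fix x assume "x \<in> V - K" "x \<notin> Y"
      then show "f x = b x \<and> b x \<in> V - K" using PiE_mem[OF p(4), of x] f_nY by auto
    qed
    have "leads f K v" if "v \<in> V" for v
      using that lK by (cases "v \<in> K") (auto intro: leads.here)
    moreover have "f \<in> (V - K) \<rightarrow>\<^sub>E V"
    proof (rule PiE_I)
      fix x assume "x \<in> V - K"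
      then show "f x \<in> V"
        using PiE_mem[OF p(3), of x] PiE_mem[OF p(4), of x] f_Y[of x] f_nY[of x] assms(2) by (cases "x \<in> Y") auto
    next
      fix x assume "x \<notin> V - K"
      then show "f x = undefined"
        using p(2) PiE_arb[OF p(4), of x] f_nY[of x] by auto
    qed
    ultimately show "\<Psi> p \<in> forests V K"
      by (simp add: forests_def f_def)
  qed
  show ?thesis
  proof (rule bij_betw_byWitness[where f' = \<Psi>])
    show "\<forall>f\<in>forests V K. \<Psi> (\<Phi> f) = f"
      by (rule ballI) (rule conjunct1[OF 1])
    show "\<Phi> ` forests V K \<subseteq> ?S"
      by (rule image_subsetI) (rule conjunct2[OF 1])
    show "\<forall>p\<in>?S. \<Phi> (\<Psi> p) = p"
      by (rule ballI) (rule conjunct1[OF 2])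
    show "\<Psi> ` ?S \<subseteq> forests V K"
      by (rule image_subsetI) (rule conjunct2[OF 2])
  qed
qed

lemma not_leads_empty: "\<not> leads h {} v"
proof
  assume "leads h {} v"
  then show False by induction auto
qed

text \<open>With no roots, a forest exists only on the empty vertex set; this is the reason for the
  value 1 of \<open>rooted_forests 0 k\<close>, and for \<open>n > 0\<close> the formula gives 0 at
  \<open>k = 0\<close>. With roots, the level bijection turns the count into the recursion.\<close>

lemma card_forests:
  assumes "finite V" "K \<subseteq> V"
  shows "real (card (forests V K)) = rooted_forests (card V) (card K)"
  using assms
proof (induction "card V" arbitrary: V K rule: less_induct)
  case less
  have finK: "finite K" using less.prems finite_subset by blast
  show ?case
  proof (cases "K = {}")
    case True
    show ?thesis
    proof (cases "V = {}")
      case True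
      then show ?thesis using \<open>K = {}\<close> by (simp add: forests_def rooted_forests_def)
    next
      case False
      then have "forests V K = {}" using True by (auto simp: forests_def not_leads_empty)
      then show ?thesis using True False less.prems by (simp add: rooted_forests_def)
    qed
  next
    case False
    then have cK: "card K > 0" using finK by (simp add: card_gt_0_iff)
    have sm: "card (V - K) < card V"
      using less.prems False by (intro psubset_card_mono) auto
    have V: "card V = card K + card (V - K)"
      using less.prems finK by (simp add: card_Diff_subset card_mono)
    have "card (forests V K) = card (SIGMA Y:Pow (V - K). (Y \<rightarrow>\<^sub>E K) \<times> forests (V - K) Y)"
      by (rule bij_betw_same_card[OF forests_level_bij[OF less.prems(2)]])
    also have "\<dots> = (\<Sum>Y\<in>Pow (V - K). card K ^ card Y * card (forests (V - K) Y))"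
    proof (subst card_SigmaI)
      show "\<forall>Y\<in>Pow (V - K). finite ((Y \<rightarrow>\<^sub>E K) \<times> forests (V - K) Y)"
      proof
        fix Y assume "Y \<in> Pow (V - K)"
        then have "finite Y" using less.prems by (auto intro: finite_subset)
        then show "finite ((Y \<rightarrow>\<^sub>E K) \<times> forests (V - K) Y)"
          using less.prems finK by (intro finite_cartesian_product finite_PiE finite_forests) auto
      qed
      show "(\<Sum>Y\<in>Pow (V - K). card ((Y \<rightarrow>\<^sub>E K) \<times> forests (V - K) Y)) =
        (\<Sum>Y\<in>Pow (V - K). card K ^ card Y * card (forests (V - K) Y))"
      proof (rule sum.cong[OF refl])
        fix Y assume "Y \<in> Pow (V - K)"
        then have "finite Y" using less.prems by (auto intro: finite_subset)
        then show "card ((Y \<rightarrow>\<^sub>E K) \<times> forests (V - K) Y) = card K ^ card Y * card (forests (V - K) Y)"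
          by (simp add: card_cartesian_product card_PiE)
      qed
    qed (use less.prems in simp)
    finally have "real (card (forests V K)) =
      (\<Sum>Y\<in>Pow (V - K). real (card K) ^ card Y * real (card (forests (V - K) Y)))"
      by simp
    also have "\<dots> = (\<Sum>Y\<in>Pow (V - K). real (card K) ^ card Y * rooted_forests (card (V - K)) (card Y))"
    proof (rule sum.cong[OF refl])
      fix Y assume "Y \<in> Pow (V - K)"
      then show "real (card K) ^ card Y * real (card (forests (V - K) Y)) =
          real (card K) ^ card Y * rooted_forests (card (V - K)) (card Y)"
        using less.prems less.hyps[OF sm, of Y] by simp
    qed
    also have "\<dots> = (\<Sum>y\<le>card (V - K). real (card (V - K) choose y) *
        (real (card K) ^ y * rooted_forests (card (V - K)) y))"
      by (rule sum_Pow_card) (use less.prems in simp)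
    also have "\<dots> = rooted_forests (card V) (card K)"
      by (simp only: V rooted_forests_recursion[OF cK] mult.assoc)
    finally show ?thesis .
  qed
qed

section \<open>Splitting a map at a closed set; counting cyclic permutations\<close>

lemma funpow_closed: "h ` K \<subseteq> K \<Longrightarrow> x \<in> K \<Longrightarrow> (h ^^ i) x \<in> K"
  by (induction i) auto

lemma funpow_eqI:
  assumes "\<And>x. x \<in> K \<Longrightarrow> f x = g x" "f ` K \<subseteq> K" "x \<in> K"
  shows "(f ^^ i) x = (g ^^ i) x"
proof (induction i)
  case (Suc i)
  have "(f ^^ Suc i) x = f ((f ^^ i) x)" by simp
  also have "\<dots> = g ((f ^^ i) x)"
    by (rule assms(1)) (rule funpow_closed[OF assms(2,3)])
  also have "\<dots> = (g ^^ Suc i) x" by (simp only: Suc funpow.simps o_apply)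
  finally show ?case .
qed simp

text \<open>Inside a closed set \<open>X\<close> the map is again one with cycle \<open>K\<close>;
  outside, only the first entry into \<open>X\<close> matters, so there it is a forest rooted at
  \<open>X\<close>. The two pieces are independent.\<close>

lemma cyclic_maps_split_bij:
  assumes "K \<subseteq> X" "X \<subseteq> V"
  shows "bij_betw (\<lambda>h. (restrict h X, restrict h (V - X)))
    {h \<in> cyclic_maps V K. h ` X \<subseteq> X} (cyclic_maps X K \<times> forests V X)"
proof (rule bij_betw_byWitness[where f' = "\<lambda>(a, b) v. if v \<in> X then a v else b v"])
  show "\<forall>h\<in>{h \<in> cyclic_maps V K. h ` X \<subseteq> X}.
      (case (restrict h X, restrict h (V - X)) of (a, b) \<Rightarrow> \<lambda>v. if v \<in> X then a v else b v) = h"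
    by (auto simp: cyclic_maps_def fun_eq_iff dest: PiE_arb)
  show "\<forall>p\<in>cyclic_maps X K \<times> forests V X.
     (restrict (case p of (a, b) \<Rightarrow> \<lambda>v. if v \<in> X then a v else b v) X,
      restrict (case p of (a, b) \<Rightarrow> \<lambda>v. if v \<in> X then a v else b v) (V - X)) = p"
    by (auto simp: cyclic_maps_def forests_def fun_eq_iff dest: PiE_arb)
  show "(\<lambda>h. (restrict h X, restrict h (V - X))) ` {h \<in> cyclic_maps V K. h ` X \<subseteq> X}
     \<subseteq> cyclic_maps X K \<times> forests V X"
  proof (rule image_subsetI)
    fix h assume "h \<in> {h \<in> cyclic_maps V K. h ` X \<subseteq> X}"
    then have h: "h \<in> V \<rightarrow>\<^sub>E V" "h ` K \<subseteq> K" "\<And>x y. x \<in> K \<Longrightarrow> y \<in> K \<Longrightarrow> \<exists>i. (h ^^ i) x = y"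
      "\<And>v. v \<in> V \<Longrightarrow> leads h K v" and hX: "h ` X \<subseteq> X"
      by (auto simp: cyclic_maps_def)
    have pow: "(restrict h X ^^ i) x = (h ^^ i) x" if "x \<in> K" for x i
    proof (rule sym, rule funpow_eqI[OF _ h(2) that])
      show "h x = restrict h X x" if "x \<in> K" for x using that assms(1) by auto
    qed
    have lX: "leads (restrict h X) K v" if "v \<in> X" for v
    proof (rule leads_transfer[OF h(4) that])
      show "v \<in> V" using that assms(2) by blast
      show "restrict h X x = h x \<and> h x \<in> X" if "x \<in> X" for x using that hX by auto
    qed (rule leads.here)
    have "restrict h X ` K \<subseteq> K" using assms(1) h(2) by auto
    moreover have "restrict h X \<in> X \<rightarrow>\<^sub>E X" using hX by auto
    ultimately have 1: "restrict h X \<in> cyclic_maps X K"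
      unfolding cyclic_maps_def using lX h(3) by (simp add: pow)
    have lV: "leads (restrict h (V - X)) X v" if "v \<in> V" for v
    proof (rule leads_transfer[OF h(4)[OF that] that])
      show "restrict h (V - X) x = h x \<and> h x \<in> V" if "x \<in> V" "x \<notin> X" for x
        using that h(1) by auto
      show "leads (restrict h (V - X)) X x" if "x \<in> K" for x
        using that assms(1) by (intro leads.here) auto
    qed
    moreover have "restrict h (V - X) \<in> (V - X) \<rightarrow>\<^sub>E V" using h(1) by auto
    ultimately have 2: "restrict h (V - X) \<in> forests V X"
      by (simp add: forests_def)
    show "(restrict h X, restrict h (V - X)) \<in> cyclic_maps X K \<times> forests V X"
      using 1 2 by simp
  qed
  show "(\<lambda>(a, b) v. if v \<in> X then a v else b v) ` (cyclic_maps X K \<times> forests V X)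
     \<subseteq> {h \<in> cyclic_maps V K. h ` X \<subseteq> X}"
  proof (rule image_subsetI)
    fix p assume "p \<in> cyclic_maps X K \<times> forests V X"
    then obtain a b where p: "p = (a, b)" and a: "a \<in> X \<rightarrow>\<^sub>E X" "a ` K \<subseteq> K"
      "\<And>x y. x \<in> K \<Longrightarrow> y \<in> K \<Longrightarrow> \<exists>i. (a ^^ i) x = y" "\<And>v. v \<in> X \<Longrightarrow> leads a K v"
      and b: "b \<in> (V - X) \<rightarrow>\<^sub>E V" "\<And>v. v \<in> V \<Longrightarrow> leads b X v"
      by (auto simp: cyclic_maps_def forests_def)
    define h where "h = (\<lambda>v. if v \<in> X then a v else b v)"
    have hX: "h v = a v" if "v \<in> X" for v using that by (simp add: h_def)
    have hnX: "h v = b v" if "v \<notin> X" for v using that by (simp add: h_def)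
    have pow: "(h ^^ i) x = (a ^^ i) x" if "x \<in> K" for x i
      by (rule sym, rule funpow_eqI[OF _ a(2) that]) (use assms(1) hX in auto)
    have lX: "leads h K v" if "v \<in> X" for v
    proof (rule leads_transfer[OF a(4)[OF that] that])
      show "h x = a x \<and> a x \<in> X" if "x \<in> X" for x using that hX a(1) by auto
    qed (rule leads.here)
    have "leads h K v" if "v \<in> V" for v
    proof (rule leads_transfer[OF b(2)[OF that] that])
      show "h x = b x \<and> b x \<in> V" if "x \<in> V" "x \<notin> X" for x using that hnX b(1) by auto
    qed (rule lX)
    moreover have "h \<in> V \<rightarrow>\<^sub>E V"
    proof (rule PiE_I)
      show "h x \<in> V" if "x \<in> V" for x
        using PiE_mem[OF a(1), of x] PiE_mem[OF b(1), of x] that hX hnX assms(2) by (cases "x \<in> X") auto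
      show "h x = undefined" if "x \<notin> V" for x
        using PiE_arb[OF b(1), of x] that hnX assms(2) by (cases "x \<in> X") auto
    qed
    moreover have "h ` K \<subseteq> K" using a(2) hX assms(1) by auto
    moreover have "h ` X \<subseteq> X" using a(1) hX by auto
    ultimately have "h \<in> {h \<in> cyclic_maps V K. h ` X \<subseteq> X}"
      using a(3) by (simp add: cyclic_maps_def pow)
    then show "(case p of (a, b) \<Rightarrow> \<lambda>v. if v \<in> X then a v else b v) \<in> {h \<in> cyclic_maps V K. h ` X \<subseteq> X}"
      by (simp add: p h_def)
  qed
qed

text \<open>If the orbit of \<open>x\<close> returned to an earlier value at a time
  \<open>j < card K\<close>, it would stay within its first \<open>j\<close> values, too few to fill
  \<open>K\<close>.\<close>

lemma orbit_enumerates: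
  assumes "finite K" "h ` K \<subseteq> K" "\<And>x y. x \<in> K \<Longrightarrow> y \<in> K \<Longrightarrow> \<exists>i. (h ^^ i) x = y" "x \<in> K"
  shows "inj_on (\<lambda>i. (h ^^ i) x) {..<card K}" "(\<lambda>i. (h ^^ i) x) ` {..<card K} = K"
proof -
  have ne: "(h ^^ i) x \<noteq> (h ^^ j) x" if "i < j" "j < card K" for i j
  proof
    assume eq: "(h ^^ i) x = (h ^^ j) x"
    have "(h ^^ l) x \<in> (\<lambda>i. (h ^^ i) x) ` {..<j}" for l
    proof (induction l)
      case 0
      have "(h ^^ 0) x = x" "0 < j" using that by auto
      then show ?case by (metis image_eqI lessThan_iff)
    next
      case (Suc l)
      then obtain m where m: "m < j" "(h ^^ l) x = (h ^^ m) x" by auto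
      have "(h ^^ Suc l) x = (h ^^ Suc m) x" using m(2) by simp
      show ?case
      proof (cases "Suc m = j")
        case True
        then have "(h ^^ Suc l) x = (h ^^ i) x" using \<open>(h ^^ Suc l) x = (h ^^ Suc m) x\<close> eq by simp
        then show ?thesis using that(1) by blast
      next
        case False
        then have "Suc m < j" using m(1) by simp
        then show ?thesis using \<open>(h ^^ Suc l) x = (h ^^ Suc m) x\<close> by blast
      qed
    qed
    then have "K \<subseteq> (\<lambda>i. (h ^^ i) x) ` {..<j}"
      using assms(3)[OF assms(4)] by (metis subsetI)
    then have "card K \<le> j"
      using surj_card_le[of "{..<j}" K] by simp
    then show False using that by simp
  qed
  then show inj: "inj_on (\<lambda>i. (h ^^ i) x) {..<card K}"
    by (auto simp: inj_on_def) (metis linorder_neqE_nat)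
  have "(\<lambda>i. (h ^^ i) x) ` {..<card K} \<subseteq> K"
    using funpow_closed[OF assms(2,4)] by auto
  then show "(\<lambda>i. (h ^^ i) x) ` {..<card K} = K"
    using assms(1) inj by (metis card_image card_lessThan card_subset_eq)
qed

lemma funpow_card_cycle:
  assumes "finite K" "h ` K \<subseteq> K" "\<And>x y. x \<in> K \<Longrightarrow> y \<in> K \<Longrightarrow> \<exists>i. (h ^^ i) x = y" "x \<in> K"
  shows "(h ^^ card K) x = x"
proof -
  have k: "card K > 0" using assms card_gt_0_iff by blast
  have "(h ^^ card K) x \<in> K" using funpow_closed[OF assms(2,4)] by simp
  then obtain i where i: "i < card K" "(h ^^ i) x = (h ^^ card K) x"
    using orbit_enumerates(2)[OF assms] by (metis (no_types, lifting) imageE lessThan_iff)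
  show ?thesis
  proof (cases i)
    case (Suc j)
    have eq: "(h ^^ l) (h x) = (h ^^ Suc l) x" for l
      by (simp only: funpow_Suc_right o_apply)
    have "(h ^^ j) (h x) = (h ^^ (card K - 1)) (h x)"
      unfolding eq using i Suc k by simp
    moreover have "h x \<in> K" using assms by auto
    ultimately have "j = card K - 1"
      using orbit_enumerates(1)[OF assms(1-3), of "h x"] i Suc by (auto simp: inj_on_def)
    then show ?thesis using i Suc by simp
  qed (use i in simp)
qed

definition next_in :: "'a list \<Rightarrow> 'a \<Rightarrow> 'a" where
  "next_in xs v = (if v \<in> set xs then xs ! (Suc (inv_into {..<length xs} ((!) xs) v) mod length xs) else undefined)"

lemma next_in_nth:
  assumes "distinct xs" "i < length xs"
  shows "next_in xs (xs ! i) = xs ! (Suc i mod length xs)"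
proof -
  have "inj_on ((!) xs) {..<length xs}" using assms by (simp add: inj_on_nth)
  then show ?thesis using assms by (simp add: next_in_def inv_into_f_f)
qed

lemma funpow_next_in:
  assumes "distinct xs" "i < length xs"
  shows "(next_in xs ^^ j) (xs ! i) = xs ! ((i + j) mod length xs)"
proof (induction j)
  case (Suc j)
  have "(i + j) mod length xs < length xs" using assms by (intro mod_less_divisor) auto
  then show ?case using Suc assms by (simp add: next_in_nth mod_Suc_eq)
qed (use assms in simp)

lemma next_in_cyclic:
  assumes "distinct xs"
  shows "next_in xs \<in> cyclic_maps (set xs) (set xs)"
proof -
  have maps: "next_in xs ` set xs \<subseteq> set xs"
  proof (rule image_subsetI)
    fix v assume "v \<in> set xs"
    then obtain i where i: "i < length xs" "v = xs ! i" by (metis in_set_conv_nth)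
    then show "next_in xs v \<in> set xs"
      using assms by (simp add: next_in_nth) (metis length_greater_0_conv length_pos_if_in_set mod_less_divisor nth_mem i(1) gr_implies_not0 not_gr_zero)
  qed
  moreover have "\<exists>i. (next_in xs ^^ i) x = y" if xy: "x \<in> set xs" "y \<in> set xs" for x y
  proof -
    obtain i j where i: "i < length xs" "x = xs ! i" and j: "j < length xs" "y = xs ! j"
      using xy by (metis in_set_conv_nth)
    have "(next_in xs ^^ (length xs - i + j)) x = xs ! ((i + (length xs - i + j)) mod length xs)"
      using i assms by (simp add: funpow_next_in)
    also have "i + (length xs - i + j) = j + length xs" using i by simp
    finally show ?thesis using j by auto
  qed
  moreover have "next_in xs v = undefined" if "v \<notin> set xs" for v
    using that by (simp add: next_in_def)
  ultimately show ?thesis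
    by (auto simp: cyclic_maps_def intro: leads.here)
qed

text \<open>A cyclic permutation together with a starting point is the same as an ordering of
  \<open>K\<close>, so the count times \<open>card K\<close> is
  \<open>fact (card K)\<close>.\<close>

lemma card_cyclic_maps_self:
  assumes "finite K" "K \<noteq> {}"
  shows "card (cyclic_maps K K) = fact (card K - 1)"
proof -
  let ?\<Phi> = "\<lambda>(h, x). map (\<lambda>i. (h ^^ i) x) [0..<card K]"
  have k: "card K > 0" using assms by (simp add: card_gt_0_iff)
  have "bij_betw ?\<Phi> (cyclic_maps K K \<times> K) (permutations_of_set K)"
  proof (rule bij_betw_byWitness[where f' = "\<lambda>xs. (next_in xs, hd xs)"])
    show "\<forall>p\<in>cyclic_maps K K \<times> K. (next_in (?\<Phi> p), hd (?\<Phi> p)) = p"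
    proof
      fix p assume "p \<in> cyclic_maps K K \<times> K"
      then obtain h x where p: "p = (h, x)" and x: "x \<in> K" and h: "h \<in> K \<rightarrow>\<^sub>E K" "h ` K \<subseteq> K"
        "\<And>x y. x \<in> K \<Longrightarrow> y \<in> K \<Longrightarrow> \<exists>i. (h ^^ i) x = y"
        by (auto simp: cyclic_maps_def)
      define xs where "xs = map (\<lambda>i. (h ^^ i) x) [0..<card K]"
      have set: "set xs = K" and d: "distinct xs" and len: "length xs = card K"
        using orbit_enumerates[OF assms(1) h(2,3) x]
        by (auto simp: xs_def distinct_map lessThan_atLeast0)
      have nth: "xs ! i = (h ^^ i) x" if "i < card K" for i
        using that by (simp add: xs_def)
      have "next_in xs v = h v" for v
      proof (cases "v \<in> K")
        case True
        then obtain i where i: "i < card K" "v = xs ! i" using set len by (metis in_set_conv_nth)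
        have "next_in xs v = xs ! (Suc i mod card K)"
          using i d len by (simp add: next_in_nth)
        also have "\<dots> = h v"
        proof (cases "Suc i = card K")
          case True
          then have "h v = (h ^^ card K) x" using i nth by (simp flip: True)
          then show ?thesis using True funpow_card_cycle[OF assms(1) h(2,3) x] k nth[of 0] by simp
        next
          case False
          then show ?thesis using i nth by simp
        qed
        finally show ?thesis .
      next
        case False
        then show ?thesis using h(1) set by (auto simp: next_in_def)
      qed
      moreover have "hd xs = x" using k by (simp add: xs_def hd_map)
      ultimately show "(next_in (?\<Phi> p), hd (?\<Phi> p)) = p"
        by (auto simp: p xs_def)
    qed
    show "\<forall>xs\<in>permutations_of_set K. ?\<Phi> (next_in xs, hd xs) = xs"
    proof
      fix xs assume "xs \<in> permutations_of_set K"
      then have xs: "set xs = K" "distinct xs" "length xs = card K"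
        by (auto simp: permutations_of_set_def distinct_card)
      have "hd xs = xs ! 0" using k xs by (intro hd_conv_nth) auto
      then show "?\<Phi> (next_in xs, hd xs) = xs"
        using k xs by (auto intro!: nth_equalityI simp: funpow_next_in)
    qed
    show "?\<Phi> ` (cyclic_maps K K \<times> K) \<subseteq> permutations_of_set K"
      using orbit_enumerates[OF assms(1)]
      by (fastforce simp: permutations_of_set_def cyclic_maps_def distinct_map lessThan_atLeast0)
    show "(\<lambda>xs. (next_in xs, hd xs)) ` permutations_of_set K \<subseteq> cyclic_maps K K \<times> K"
      using next_in_cyclic assms by (auto simp: permutations_of_set_def)
  qed
  then have "card (cyclic_maps K K) * card K = fact (card K)"
    using assms(1) by (simp add: bij_betw_same_card card_cartesian_product[symmetric])
  also have "\<dots> = fact (card K - 1) * card K"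
    using k by (metis fact_reduce mult.commute of_nat_id)
  finally show ?thesis using k by simp
qed

text \<open>Splitting at \<open>X\<close> and then at \<open>K\<close> factors the map into a cyclic
  permutation of \<open>K\<close>, a forest on \<open>X\<close> rooted at \<open>K\<close> and a
  forest on \<open>V\<close> rooted at \<open>X\<close>.\<close>

lemma card_cyclic_maps_closed:
  assumes "finite V" "K \<subseteq> X" "X \<subseteq> V" "K \<noteq> {}"
  shows "real (card {h \<in> cyclic_maps V K. h ` X \<subseteq> X}) =
    fact (card K - 1) * rooted_forests (card X) (card K) * rooted_forests (card V) (card X)"
proof -
  have split: "real (card {h \<in> cyclic_maps V K. h ` X \<subseteq> X}) =
      real (card (cyclic_maps X K)) * rooted_forests (card V) (card X)"
    if "K \<subseteq> X" "X \<subseteq> V" "finite V" for X V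
  proof -
    have "card {h \<in> cyclic_maps V K. h ` X \<subseteq> X} = card (cyclic_maps X K \<times> forests V X)"
      by (rule bij_betw_same_card[OF cyclic_maps_split_bij[OF that(1,2)]])
    then show ?thesis
      by (simp only: card_cartesian_product of_nat_mult card_forests[OF that(3,2)])
  qed
  have "{h \<in> cyclic_maps X K. h ` K \<subseteq> K} = cyclic_maps X K"
    using cyclic_mapsD(3) by blast
  moreover have fin: "finite X" "finite K"
    by (rule finite_subset[OF assms(3,1)], rule finite_subset[OF subset_trans[OF assms(2,3)] assms(1)])
  ultimately have "real (card (cyclic_maps X K)) = real (card (cyclic_maps K K)) * rooted_forests (card X) (card K)"
    using split[OF order_refl assms(2)] by (simp only:)
  moreover have "real (card (cyclic_maps K K)) = fact (card K - 1)"
    by (simp only: card_cyclic_maps_self[OF fin(2) assms(4)] of_nat_fact)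
  ultimately show ?thesis
    by (simp only: split[OF assms(2,3,1)])
qed

lemma card_cyclic_maps:
  assumes "finite V" "K \<subseteq> V" "K \<noteq> {}"
  shows "real (card (cyclic_maps V K)) = fact (card K - 1) * rooted_forests (card V) (card K)"
proof -
  have "{h \<in> cyclic_maps V K. h ` V \<subseteq> V} = cyclic_maps V K"
    using cyclic_mapsD(2) by blast
  moreover have "rooted_forests (card V) (card V) = 1"
    by (simp add: rooted_forests_def)
  ultimately show ?thesis
    using card_cyclic_maps_closed[OF assms(1,2) order_refl assms(3)] by simp
qed

section \<open>Undirected cycles\<close>

lemma leads_iff_funpow: "leads h K v \<longleftrightarrow> (\<exists>i. (h ^^ i) v \<in> K)"
proof
  assume "leads h K v"
  then show "\<exists>i. (h ^^ i) v \<in> K"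
  proof induction
    case (here v)
    then have "(h ^^ 0) v \<in> K" by simp
    then show ?case ..
  next
    case (step v)
    from step.IH obtain i where "(h ^^ i) (h v) \<in> K" by blast
    then have "(h ^^ Suc i) v \<in> K" by (simp only: funpow_Suc_right o_apply)
    then show ?case ..
  qed
next
  have "leads h K v" if "(h ^^ i) v \<in> K" for i
    using that
  proof (induction i arbitrary: v)
    case 0
    then show ?case by (simp add: leads.here)
  next
    case (Suc i)
    have "(h ^^ i) (h v) \<in> K" using Suc.prems by (simp only: funpow_Suc_right o_apply)
    then show ?case by (rule leads.step[OF Suc.IH])
  qed
  then show "\<exists>i. (h ^^ i) v \<in> K \<Longrightarrow> leads h K v" by blast
qed

text \<open>The property behind \<open>cyclic_maps\<close>, without extensionality, so that maps can
  be updated, extended or reversed freely; \<open>K\<close> is required to be nonempty.\<close>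

definition monocyclic :: "'a set \<Rightarrow> 'a set \<Rightarrow> ('a \<Rightarrow> 'a) \<Rightarrow> bool" where
  "monocyclic V K h \<longleftrightarrow> K \<noteq> {} \<and> K \<subseteq> V \<and> h ` V \<subseteq> V \<and> h ` K \<subseteq> K \<and>
     (\<forall>x\<in>K. \<forall>y\<in>K. \<exists>i. (h ^^ i) x = y) \<and> (\<forall>v\<in>V. leads h K v)"

lemma monocyclicI:
  assumes "K \<noteq> {}" "K \<subseteq> V" "h ` V \<subseteq> V" "h ` K \<subseteq> K"
    "\<And>x y. x \<in> K \<Longrightarrow> y \<in> K \<Longrightarrow> \<exists>i. (h ^^ i) x = y" "\<And>v. v \<in> V \<Longrightarrow> leads h K v"
  shows "monocyclic V K h"
  using assms by (simp add: monocyclic_def)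

lemma monocyclicD:
  assumes "monocyclic V K h"
  shows "K \<noteq> {}" "K \<subseteq> V" "h ` V \<subseteq> V" "h ` K \<subseteq> K"
    "\<And>x y. x \<in> K \<Longrightarrow> y \<in> K \<Longrightarrow> \<exists>i. (h ^^ i) x = y" "\<And>v. v \<in> V \<Longrightarrow> leads h K v"
    "\<And>v. v \<in> V \<Longrightarrow> h v \<in> V" "\<And>v. v \<in> K \<Longrightarrow> h v \<in> K" "\<And>v. v \<in> K \<Longrightarrow> v \<in> V"
  using assms unfolding monocyclic_def image_subset_iff by (blast dest: subsetD)+

lemma cyclic_maps_iff_monocyclic:
  assumes "K \<noteq> {}" "K \<subseteq> V"
  shows "h \<in> cyclic_maps V K \<longleftrightarrow> h \<in> V \<rightarrow>\<^sub>E V \<and> monocyclic V K h"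
proof -
  have "h ` V \<subseteq> V" if "h \<in> V \<rightarrow>\<^sub>E V" using that by (auto dest: PiE_mem)
  then show ?thesis using assms unfolding cyclic_maps_def monocyclic_def by simp blast
qed

text \<open>A point of \<open>W\<close> is led into \<open>K\<close> and then all around
  \<open>K\<close>, without leaving \<open>W\<close>. Most contradictions below come from this: two
  disjoint nonempty closed sets cannot exist, nor can one that misses \<open>K\<close>.\<close>

lemma monocyclic_subset_closed:
  assumes "monocyclic V K h" "W \<subseteq> V" "W \<noteq> {}" "h ` W \<subseteq> W"
  shows "K \<subseteq> W"
proof
  fix y assume y: "y \<in> K"
  obtain w where w: "w \<in> W" using assms(3) by blast
  then have "leads h K w" using monocyclicD(6)[OF assms(1)] assms(2) by blast
  then obtain i where i: "(h ^^ i) w \<in> K" by (auto simp: leads_iff_funpow)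
  obtain j where j: "(h ^^ j) ((h ^^ i) w) = y" using monocyclicD(5)[OF assms(1) i y] ..
  have "(h ^^ j) ((h ^^ i) w) \<in> W"
    by (intro funpow_closed[OF assms(4)] w)
  then show "y \<in> W" using j by simp
qed

text \<open>After \<open>i\<close> steps the orbit is in \<open>K\<close> for good; the multiple
  \<open>Suc j * i\<close> of the period is at least \<open>i\<close>, and at that time the orbit is
  at \<open>a\<close>.\<close>

lemma monocyclic_periodic:
  assumes "monocyclic V K h" "a \<in> V" "(h ^^ Suc j) a = a"
  shows "a \<in> K"
proof -
  obtain i where i: "(h ^^ i) a \<in> K"
    using monocyclicD(6)[OF assms(1,2)] by (auto simp: leads_iff_funpow)
  have per: "(h ^^ (Suc j * m)) a = a" for m
  proof (induction m)
    case (Suc m)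
    have "(h ^^ (Suc j * Suc m)) a = (h ^^ (Suc j * m)) ((h ^^ Suc j) a)"
      by (simp only: mult_Suc_right add.commute[of "Suc j"] funpow_add o_apply)
    then show ?case by (simp only: assms(3) Suc)
  qed simp
  have "(h ^^ (j * i)) ((h ^^ i) a) \<in> K"
    by (rule funpow_closed[OF monocyclicD(4)[OF assms(1)] i])
  also have "(h ^^ (j * i)) ((h ^^ i) a) = (h ^^ (Suc j * i)) a"
    by (simp only: mult_Suc add.commute[of i] funpow_add o_apply)
  finally show ?thesis by (simp only: per)
qed

lemma monocyclic_fixpoint:
  assumes "monocyclic V K h" "a \<in> V" "h a = a"
  shows "K = {a}"
proof -
  have "K \<subseteq> {a}" by (rule monocyclic_subset_closed[OF assms(1)]) (use assms in auto)
  then show ?thesis using monocyclicD(1)[OF assms(1)] by blast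
qed

lemma monocyclic_bij:
  assumes "monocyclic V K h" "finite K"
  shows "h ` K = K" "inj_on h K"
proof -
  have "K \<subseteq> h ` K"
  proof
    fix y assume y: "y \<in> K"
    then have hy: "h y \<in> K" by (rule monocyclicD(8)[OF assms(1)])
    obtain i where "(h ^^ i) (h y) = y" using monocyclicD(5)[OF assms(1) hy y] ..
    then have "h ((h ^^ i) y) = y" by (simp add: funpow_swap1)
    moreover have "(h ^^ i) y \<in> K" by (rule funpow_closed[OF monocyclicD(4)[OF assms(1)] y])
    ultimately show "y \<in> h ` K" by (metis imageI)
  qed
  then show "h ` K = K" "inj_on h K"
    using monocyclicD(4)[OF assms(1)] finite_surj_inj[OF assms(2)] by auto
qed

text \<open>\<open>arc v\<close> joins \<open>v\<close> and \<open>h v\<close> in one of the two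
  directions, and injectivity gives each arc a single owner. A fixed point owns a loop.\<close>

definition owns :: "'a set \<Rightarrow> ('a \<Rightarrow> 'a) \<Rightarrow> ('a \<Rightarrow> 'a \<times> 'a) \<Rightarrow> bool" where
  "owns V h arc \<longleftrightarrow> inj_on arc V \<and> (\<forall>v\<in>V. arc v = (v, h v) \<or> arc v = (h v, v))"

lemma owns_ends: "owns V h arc \<Longrightarrow> v \<in> V \<Longrightarrow> {fst (arc v), snd (arc v)} = {v, h v}"
  by (auto simp: owns_def)

lemma undirected_cycleI:
  assumes "finite K" "K \<noteq> {}" "K \<subseteq> V" "h ` K \<subseteq> K"
    and trans: "\<And>x y. x \<in> K \<Longrightarrow> y \<in> K \<Longrightarrow> \<exists>i. (h ^^ i) x = y"
    and "owns K h arc" "arc ` K \<subseteq> A" "card K \<ge> 2"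
  shows "arc ` K \<in> undirected_cycles \<lparr>pverts = V, parcs = A\<rparr>"
proof -
  obtain x where x: "x \<in> K" using assms(2) by blast
  define vs where "vs = map (\<lambda>i. (h ^^ i) x) [0..<card K]"
  have len: "length vs = card K" by (simp add: vs_def)
  have d: "distinct vs" and set: "set vs = K"
    using orbit_enumerates[OF assms(1,4) trans x]
    by (auto simp: vs_def distinct_map lessThan_atLeast0)
  have nth: "vs ! i = (h ^^ i) x" if "i < card K" for i using that by (simp add: vs_def)
  have succ: "h (vs ! i) = vs ! (Suc i mod card K)" if "i < card K" for i
  proof (cases "Suc i = card K")
    case True
    have "h (vs ! i) = (h ^^ card K) x" using nth[OF that] by (simp flip: True)
    also have "\<dots> = x" by (rule funpow_card_cycle[OF assms(1,4) trans x])
    also have "x = vs ! 0" using nth[of 0] that by simp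
    finally show ?thesis using True by simp
  next
    case False
    then show ?thesis using nth[OF that] nth[of "Suc i"] that by simp
  qed
  have inj: "inj_on arc K" using assms(6) by (simp add: owns_def)
  have "\<forall>i<card K. {fst (map arc vs ! i), snd (map arc vs ! i)} = {vs ! i, vs ! (Suc i mod card K)}"
  proof (intro allI impI)
    fix i assume i: "i < card K"
    then have "vs ! i \<in> K" using set len nth_mem by fastforce
    then show "{fst (map arc vs ! i), snd (map arc vs ! i)} = {vs ! i, vs ! (Suc i mod card K)}"
      using owns_ends[OF assms(6)] succ[OF i] i len by simp
  qed
  moreover have "distinct (map arc vs)" using d inj set by (simp add: distinct_map)
  moreover have "set (map arc vs) = arc ` K" using set by simp
  ultimately show ?thesis
    unfolding undirected_cycles_def using d set assms(3,7,8) len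
    by (intro CollectI exI[of _ "map arc vs"] exI[of _ vs]) simp
qed

lemma undirected_cycle_unique:
  assumes "finite V" and own: "owns V h arc" and cyc: "monocyclic V K h"
    and "A \<subseteq> arc ` V" and F: "F \<in> undirected_cycles \<lparr>pverts = V, parcs = A\<rparr>"
  shows "F = arc ` K"
proof -
  obtain es vs where F_es: "F = set es" and len: "length vs = length es" "2 \<le> length es"
    and d: "distinct vs" "distinct es" and sub: "set vs \<subseteq> V" "set es \<subseteq> A"
    and ends: "\<And>i. i < length es \<Longrightarrow> {fst (es ! i), snd (es ! i)} = {vs ! i, vs ! (Suc i mod length vs)}"
    using F unfolding undirected_cycles_def by auto
  define W where "W = set vs"
  have finW: "finite W" by (simp add: W_def)
  have F_W: "{fst e, snd e} \<subseteq> W" if "e \<in> F" for e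
  proof -
    obtain i where i: "i < length es" "e = es ! i" using \<open>e \<in> F\<close> F_es by (metis in_set_conv_nth)
    moreover have "Suc i mod length vs < length vs" using len by (intro mod_less_divisor) auto
    ultimately show ?thesis using ends[OF i(1)] len by (simp add: W_def)
  qed
  have "F \<subseteq> arc ` W"
  proof
    fix e assume e: "e \<in> F"
    then obtain v where v: "v \<in> V" "e = arc v" using F_es sub(2) assms(4) by blast
    then have "v \<in> {fst e, snd e}" using owns_ends[OF own, of v] by auto
    then show "e \<in> arc ` W" using F_W[OF e] v by blast
  qed
  moreover have "card (arc ` W) \<le> card F"
    using card_image_le[OF finW, of arc] d len by (simp add: W_def F_es distinct_card)
  ultimately have FW: "F = arc ` W" using finW by (intro card_seteq) auto
  have WV: "W \<subseteq> V" using sub(1) by (simp add: W_def)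
  have clW: "h ` W \<subseteq> W"
  proof (rule image_subsetI)
    fix v assume v: "v \<in> W"
    then have "h v \<in> {fst (arc v), snd (arc v)}" using owns_ends[OF own, of v] WV by auto
    moreover have "arc v \<in> F" using v FW by blast
    ultimately show "h v \<in> W" using F_W by blast
  qed
  have "W \<noteq> {}" using len by (auto simp: W_def)
  then have KW: "K \<subseteq> W" by (rule monocyclic_subset_closed[OF cyc WV _ clW])
  \<comment> \<open>Two distinct edges of \<open>F\<close> meet at \<open>v\<close>, namely those at
    positions \<open>i\<close> and \<open>i - 1\<close> (cyclically). One of them is not owned by
    \<open>v\<close>, so its owner \<open>u\<close> satisfies \<open>h u = v\<close>.\<close>
  have "W \<subseteq> h ` W"
  proof
    fix v assume "v \<in> W"
    then obtain i where i: "i < length es" "v = vs ! i" using len by (metis W_def in_set_conv_nth)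
    define j where "j = (if i = 0 then length es - 1 else i - 1)"
    have j: "j < length es" "Suc j mod length vs = i" "j \<noteq> i"
      using i len by (auto simp: j_def)
    have "es ! i \<noteq> es ! j" using d(2) i(1) j by (simp add: nth_eq_iff_index_eq)
    moreover have "v \<in> {fst (es ! i), snd (es ! i)}" "v \<in> {fst (es ! j), snd (es ! j)}"
      using ends[OF i(1)] ends[OF j(1)] i j by auto
    moreover have "es ! i \<in> F" "es ! j \<in> F" using i j F_es by auto
    ultimately obtain e where e: "e \<in> F" "e \<noteq> arc v" "v \<in> {fst e, snd e}" by metis
    then obtain u where u: "u \<in> W" "e = arc u" using FW by blast
    then have "v \<in> {u, h u}" using e(3) owns_ends[OF own, of u] WV by auto
    then have "h u = v" using e(2) u(2) by auto
    then show "v \<in> h ` W" using u(1) by blast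
  qed
  then have inj: "inj_on h W" by (rule finite_surj_inj[OF finW])
  have hK: "h ` K = K" using monocyclic_bij(1)[OF cyc] finite_subset[OF KW finW] .
  have "W \<subseteq> K"
  proof
    fix v assume v: "v \<in> W"
    have "leads h K v" using monocyclicD(6)[OF cyc] WV v by blast
    then show "v \<in> K" using v
    proof induction
      case (step v)
      then have "h v \<in> K" using clW by blast
      then obtain x where "x \<in> K" "h v = h x" using hK by blast
      then show ?case using inj KW step.prems by (metis inj_onD subsetD)
    qed
  qed
  then show ?thesis using FW KW by blast
qed

section \<open>An arc beyond the owned ones creates a second cycle\<close>

lemma owns_update:
  assumes "owns V h arc" "e \<notin> arc ` V" "e = (a, b) \<or> e = (b, a)"
  shows "owns V (h(a := b)) (arc(a := e))"
proof -
  have "inj_on (arc(a := e)) V"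
    using assms(1,2) by (auto simp: owns_def inj_on_def)
  then show ?thesis using assms(1,3) by (auto simp: owns_def)
qed

lemma funpow_mult_fixed: "(h ^^ p) x = x \<Longrightarrow> (h ^^ (p * m)) x = x"
proof (induction m)
  case (Suc m)
  have "(h ^^ (p * Suc m)) x = (h ^^ (p * m)) ((h ^^ p) x)"
    by (simp only: mult_Suc_right add.commute[of p] funpow_add o_apply)
  then show ?case using Suc by simp
qed simp

text \<open>Here \<open>h\<close> may have several cycles; \<open>K\<close> is the orbit of
  \<open>a\<close>. As \<open>a\<close> is moved, no point of this orbit is fixed, so none of its
  arcs is a loop lost in \<open>A - Id\<close>.\<close>

lemma undirected_cycle_through:
  assumes fin: "finite V" and own: "owns V h arc" and hV: "h ` V \<subseteq> V" and a: "a \<in> V"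
    and per: "(h ^^ Suc m) a = a" and ha: "h a \<noteq> a" and A: "arc ` V \<subseteq> A"
  obtains C where "C \<in> undirected_cycles \<lparr>pverts = V, parcs = A - Id\<rparr>" "arc a \<in> C"
proof -
  define K where "K = range (\<lambda>j. (h ^^ j) a)"
  have KV: "K \<subseteq> V" using funpow_closed[OF hV a] by (auto simp: K_def)
  have finK: "finite K" using KV fin by (rule finite_subset)
  have hK: "h ` K \<subseteq> K"
  proof (rule image_subsetI)
    fix x assume "x \<in> K"
    then obtain j where "x = (h ^^ j) a" by (auto simp: K_def)
    then have "h x = (h ^^ Suc j) a" by simp
    then show "h x \<in> K" unfolding K_def by blast
  qed
  have trans: "\<exists>i. (h ^^ i) x = y" if "x \<in> K" "y \<in> K" for x y
  proof -
    obtain j l where jl: "x = (h ^^ j) a" "y = (h ^^ l) a" using \<open>x \<in> K\<close> \<open>y \<in> K\<close> by (auto simp: K_def)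
    have "(h ^^ (m * j)) ((h ^^ j) a) = (h ^^ (Suc m * j)) a"
      by (simp only: mult_Suc add.commute[of j] funpow_add o_apply)
    also have "\<dots> = a" by (rule funpow_mult_fixed[OF per])
    finally have "(h ^^ l) ((h ^^ (m * j)) x) = y" using jl by simp
    then have "(h ^^ (l + m * j)) x = y" by (simp add: funpow_add)
    then show ?thesis ..
  qed
  have aK: "a \<in> K" unfolding K_def by (metis funpow_0 rangeI)
  then have haK: "h a \<in> K" using hK by blast
  have "card {a, h a} = 2" using ha by simp
  then have card: "card K \<ge> 2"
    using card_mono[OF finK, of "{a, h a}"] aK haK by simp
  have ownK: "owns K h arc" using own KV unfolding owns_def by (meson inj_on_subset subsetD)
  have nofix: "h x \<noteq> x" if x: "x \<in> K" for x
  proof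
    assume fx: "h x = x"
    have "(h ^^ i) x = x" for i by (induction i) (simp_all add: fx)
    then have "K \<subseteq> {x}" using trans[OF x] by auto
    then show False using aK haK ha by auto
  qed
  have "arc ` K \<subseteq> A - Id"
  proof (rule image_subsetI)
    fix x assume x: "x \<in> K"
    then have "arc x \<notin> Id" using ownK nofix[OF x] by (auto simp: owns_def)
    then show "arc x \<in> A - Id" using A KV x by blast
  qed
  then have "arc ` K \<in> undirected_cycles \<lparr>pverts = V, parcs = A - Id\<rparr>"
    using undirected_cycleI[OF finK _ KV hK trans ownK _ card] aK by blast
  then show ?thesis using that aK by blast
qed

lemma monocyclic_leads_to:
  assumes "monocyclic V K h" "a \<in> K" "b \<in> V"
  shows "leads h {a} b"
proof -
  obtain j where j: "(h ^^ j) b \<in> K"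
    using monocyclicD(6)[OF assms(1,3)] by (auto simp: leads_iff_funpow)
  obtain l where "(h ^^ l) ((h ^^ j) b) = a" using monocyclicD(5)[OF assms(1) j assms(2)] ..
  then have "(h ^^ (l + j)) b \<in> {a}" by (simp add: funpow_add)
  then show ?thesis unfolding leads_iff_funpow ..
qed

lemma leads_update_self:
  assumes "leads h {a} v"
  shows "leads (h(a := b)) {a} v"
  using assms
proof induction
  case (step v)
  show ?case
  proof (cases "v = a")
    case False
    then have "leads (h(a := b)) {a} ((h(a := b)) v)" using step.IH by (simp only: fun_upd_other not_False_eq_True)
    then show ?thesis by (rule leads.step)
  qed (simp add: leads.here)
qed (rule leads.here)

lemma leads_update_avoid:
  assumes "leads h K v" "\<not> leads h {a} v"
  shows "leads (h(a := b)) K v"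
  using assms
proof induction
  case (step v)
  have "v \<noteq> a" using step.prems leads.here[of v "{a}" h] by blast
  moreover have "\<not> leads h {a} (h v)" using step.prems leads.step by metis
  ultimately have "leads (h(a := b)) K ((h(a := b)) v)" using step.IH by (simp only: fun_upd_other not_False_eq_True)
  then show ?case by (rule leads.step)
qed (rule leads.here)

text \<open>The orbit of \<open>b\<close> avoids \<open>a\<close>, so it still ends in
  \<open>K\<close> after \<open>a\<close> is redirected to \<open>b\<close>, and with it every orbit
  that passes \<open>a\<close>. Points of \<open>K\<close> are reached from everywhere, which
  excludes \<open>a\<close> from \<open>K\<close>.\<close>

lemma monocyclic_update:
  assumes cyc: "monocyclic V K h" and ab: "a \<in> V" "b \<in> V" and nl: "\<not> leads h {a} b"
  shows "a \<notin> K" "monocyclic V K (h(a := b))"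
proof -
  show aK: "a \<notin> K" using monocyclic_leads_to[OF cyc _ ab(2)] nl by blast
  have lb: "leads (h(a := b)) K b"
    by (rule leads_update_avoid[OF monocyclicD(6)[OF cyc ab(2)] nl])
  have l: "leads (h(a := b)) K v" if "leads h K v" for v
    using that
  proof induction
    case (step v)
    have "leads (h(a := b)) K ((h(a := b)) v)"
      using step.IH lb by (cases "v = a") (simp_all only: fun_upd_same fun_upd_other not_False_eq_True)
    then show ?case by (rule leads.step)
  qed (rule leads.here)
  have pow: "((h(a := b)) ^^ i) x = (h ^^ i) x" if "x \<in> K" for x i
    by (rule sym, rule funpow_eqI[OF _ monocyclicD(4)[OF cyc] that]) (use aK in auto)
  show "monocyclic V K (h(a := b))"
  proof (rule monocyclicI)
    show "h(a := b) ` V \<subseteq> V" "h(a := b) ` K \<subseteq> K"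
      using monocyclicD(7,8)[OF cyc] ab aK by auto
    show "\<exists>i. ((h(a := b)) ^^ i) x = y" if "x \<in> K" "y \<in> K" for x y
      using monocyclicD(5)[OF cyc that] by (simp add: pow that)
    show "leads (h(a := b)) K v" if "v \<in> V" for v
      by (rule l[OF monocyclicD(6)[OF cyc that]])
  qed (rule monocyclicD[OF cyc])+
qed

lemma funpow_update_avoid:
  assumes "\<And>j. (h ^^ j) v \<noteq> a"
  shows "((h(a := b)) ^^ j) v = (h ^^ j) v"
  using assms by (induction j) auto

lemma extra_arc_closing_cycle:
  assumes fin: "finite V" and own: "owns V h arc" and cyc: "monocyclic V K h" and sub: "arc ` V \<subseteq> A"
    and e: "e \<in> A" "e \<notin> arc ` V" "e = (a, b) \<or> e = (b, a)" and ab: "a \<in> V" "b \<in> V" "a \<noteq> b"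
    and l: "leads h {a} b"
  shows "\<exists>C\<in>undirected_cycles \<lparr>pverts = V, parcs = A - Id\<rparr>. C \<noteq> arc ` K"
proof -
  let ?h = "h(a := b)" and ?arc = "arc(a := e)"
  obtain m where "(?h ^^ m) b = a"
    using leads_update_self[OF l, of b] by (auto simp: leads_iff_funpow)
  then have per: "(?h ^^ Suc m) a = a" by (simp only: funpow_Suc_right o_apply fun_upd_same)
  have hV: "?h ` V \<subseteq> V" using monocyclicD(7)[OF cyc] ab by auto
  have sub': "?arc ` V \<subseteq> A" using sub e by auto
  have "?h a \<noteq> a" using ab by simp
  then obtain C where C: "C \<in> undirected_cycles \<lparr>pverts = V, parcs = A - Id\<rparr>" "?arc a \<in> C"
    by (rule undirected_cycle_through[OF fin owns_update[OF own e(2,3)] hV ab(1) per _ sub'])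
  have "e \<notin> arc ` K" using e(2) monocyclicD(2)[OF cyc] by blast
  then have "C \<noteq> arc ` K" using C(2) by auto
  then show ?thesis using C(1) by blast
qed

text \<open>If \<open>b\<close> does not lead to \<open>a\<close>, hand the extra arc to \<open>a\<close>; the former arc of \<open>a\<close>
  is then extra, and it is one step closer to the cycle.\<close>

lemma extra_arc_second_cycle:
  assumes "finite V" "owns V h arc" "monocyclic V K h" "arc ` V \<subseteq> A"
    and "e \<in> A" "e \<notin> arc ` V" "e = (a, b) \<or> e = (b, a)" "a \<in> V" "b \<in> V" "a \<noteq> b" "(h ^^ i) a \<in> K"
  shows "\<exists>C\<in>undirected_cycles \<lparr>pverts = V, parcs = A - Id\<rparr>. C \<noteq> arc ` K"
  using assms(2-)
proof (induction i arbitrary: h arc e a b)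
  case (0 h arc e a b)
  note own = 0(1) and cyc = 0(2) and sub = 0(3) and e = 0(4,5,6) and ab = 0(7,8,9)
  have "leads h {a} b" using monocyclic_leads_to[OF cyc _ ab(2)] 0(10) by simp
  from extra_arc_closing_cycle[OF assms(1) own cyc sub e ab this] show ?case .
next
  case (Suc i h arc e a b)
  note own = Suc(2) and cyc = Suc(3) and sub = Suc(4) and e = Suc(5,6,7) and ab = Suc(8,9,10)
  show ?case
  proof (cases "leads h {a} b")
    case True
    from extra_arc_closing_cycle[OF assms(1) own cyc sub e ab this] show ?thesis .
  next
    case False
    let ?h = "h(a := b)" and ?arc = "arc(a := e)"
    have aK: "a \<notin> K" and cyc': "monocyclic V K ?h"
      using monocyclic_update[OF cyc ab(1,2) False] by blast+
    have ne: "(h ^^ j) (h a) \<noteq> a" for j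
    proof
      assume "(h ^^ j) (h a) = a"
      then have "(h ^^ Suc j) a = a" by (simp only: funpow_Suc_right o_apply)
      then show False using monocyclic_periodic[OF cyc ab(1)] aK by blast
    qed
    have "(?h ^^ i) (h a) = (h ^^ i) (h a)" by (rule funpow_update_avoid[OF ne])
    also have "\<dots> \<in> K" using Suc(11) by (simp only: funpow_Suc_right o_apply)
    finally have dist: "(?h ^^ i) (h a) \<in> K" .
    have "arc a \<notin> ?arc ` V"
      using own e(2) ab(1) by (auto simp: owns_def inj_on_def)
    moreover have "arc a = (h a, a) \<or> arc a = (a, h a)" using own ab(1) by (auto simp: owns_def)
    moreover have "?arc ` V \<subseteq> A" "arc a \<in> A" using sub e(1) ab(1) by auto
    moreover have "h a \<in> V" by (rule monocyclicD(7)[OF cyc ab(1)])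
    moreover have "h a \<noteq> a" using ne[of 0] by simp
    ultimately have "\<exists>C\<in>undirected_cycles \<lparr>pverts = V, parcs = A - Id\<rparr>. C \<noteq> ?arc ` K"
      using Suc(1)[OF owns_update[OF own e(2,3)] cyc', of "arc a" "h a" a] ab(1) dist by blast
    moreover have "?arc ` K = arc ` K" using aK by auto
    ultimately show ?thesis by simp
  qed
qed

section \<open>Representing unicycle digraphs\<close>

text \<open>Removing the diagonal deletes the dummy loop at the root of a tree.\<close>

definition digraph_of :: "'a set \<Rightarrow> ('a \<Rightarrow> 'a \<times> 'a) \<Rightarrow> 'a pair_pre_digraph" where
  "digraph_of V arc = \<lparr>pverts = V, parcs = arc ` V - Id\<rparr>"

lemma digraph_of_simps [simp]:
  "pverts (digraph_of V arc) = V" "parcs (digraph_of V arc) = arc ` V - Id"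
  by (simp_all add: digraph_of_def)

text \<open>The set of vertices reachable from \<open>u\<close> is a cut that no arc crosses. The
  cut form suits both uses of connectedness: growing a spanning structure and testing sets closed
  under \<open>h\<close>.\<close>

lemma connected_iff_cut:
  assumes "pair_wf_digraph D"
  shows "Digraph_Component.connected (with_proj D) \<longleftrightarrow> pverts D \<noteq> {} \<and>
    (\<forall>W. W \<noteq> {} \<longrightarrow> W \<subset> pverts D \<longrightarrow>
      (\<exists>x\<in>W. \<exists>y\<in>pverts D - W. (x, y) \<in> parcs D \<or> (y, x) \<in> parcs D))"
    (is "_ \<longleftrightarrow> _ \<and> ?cut")
proof -
  let ?R = "rtrancl_on (pverts D) (symcl (parcs D))"
  have sym: "(x, y) \<in> symcl (parcs D) \<longleftrightarrow> (x, y) \<in> parcs D \<or> (y, x) \<in> parcs D" for x y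
    by (auto simp: symcl_def)
  have "(\<forall>u\<in>pverts D. \<forall>v\<in>pverts D. (u, v) \<in> ?R) \<longleftrightarrow> ?cut"
  proof
    assume con: "\<forall>u\<in>pverts D. \<forall>v\<in>pverts D. (u, v) \<in> ?R"
    show ?cut
    proof (intro allI impI)
      fix W assume W: "W \<noteq> {}" "W \<subset> pverts D"
      then obtain u v where u: "u \<in> W" and v: "v \<in> pverts D" "v \<notin> W" by blast
      then have "(u, v) \<in> ?R" using con W by blast
      then have "v \<in> W \<or> (\<exists>x\<in>W. \<exists>y\<in>pverts D - W. (x, y) \<in> symcl (parcs D))"
        by (induction rule: rtrancl_on_induct) (use u in blast)+
      then show "\<exists>x\<in>W. \<exists>y\<in>pverts D - W. (x, y) \<in> parcs D \<or> (y, x) \<in> parcs D"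
        using v(2) by (simp add: sym)
    qed
  next
    assume cut: ?cut
    show "\<forall>u\<in>pverts D. \<forall>v\<in>pverts D. (u, v) \<in> ?R"
    proof (rule ballI)
      fix u assume u: "u \<in> pverts D"
      define W where "W = {v. (u, v) \<in> ?R}"
      have "W \<subseteq> pverts D" unfolding W_def by (auto dest: in_rtrancl_on_in_F)
      moreover have "u \<in> W" using u by (simp add: W_def)
      moreover have "\<not> (\<exists>x\<in>W. \<exists>y\<in>pverts D - W. (x, y) \<in> parcs D \<or> (y, x) \<in> parcs D)"
        unfolding sym[symmetric] W_def by (auto intro: rtrancl_on_into_rtrancl_on)
      ultimately have "W = pverts D" using cut by blast
      then show "\<forall>v\<in>pverts D. (u, v) \<in> ?R" by (auto simp: W_def)
    qed
  qed
  then show ?thesis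
    by (simp only: connected_conv with_proj_simps)
qed

lemma owns_arc: "owns V h arc \<Longrightarrow> v \<in> V \<Longrightarrow> arc v = (v, h v) \<or> arc v = (h v, v)"
  by (simp add: owns_def)

lemma owns_subset: "owns V h arc \<Longrightarrow> W \<subseteq> V \<Longrightarrow> owns W h arc"
  unfolding owns_def by (blast intro: inj_on_subset)

lemma owns_pairs:
  assumes "owns V h arc" "h ` V \<subseteq> V"
  shows "arc ` V \<subseteq> V \<times> V"
  using assms by (auto simp: owns_def image_subset_iff)

lemma monocyclic_no_fixpoint:
  assumes "monocyclic V K h" "card K \<ge> 2" "v \<in> V"
  shows "h v \<noteq> v"
  using monocyclic_fixpoint[OF assms(1,3)] assms(2) by auto

lemma owns_no_loops:
  assumes "owns V h arc" "monocyclic V K h" "card K \<ge> 2"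
  shows "arc ` V - Id = arc ` V"
proof -
  have "arc v \<notin> Id" if "v \<in> V" for v
    using owns_arc[OF assms(1) that] monocyclic_no_fixpoint[OF assms(2,3) that] by (elim disjE) simp_all
  then have "arc ` V \<inter> Id = {}" by (simp only: disjoint_iff image_iff) metis
  then show ?thesis by (rule Diff_triv)
qed

lemma undirected_cycles_digraph_of:
  assumes "finite V" "owns V h arc" "monocyclic V K h"
  shows "undirected_cycles (digraph_of V arc) = (if card K \<ge> 2 then {arc ` K} else {})"
proof -
  have sub: "F = arc ` K" if "F \<in> undirected_cycles (digraph_of V arc)" for F
    by (rule undirected_cycle_unique[OF assms Diff_subset that[unfolded digraph_of_def]])
  show ?thesis
  proof (cases "card K \<ge> 2")
    case True
    have K: "K \<subseteq> V" "finite K"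
      using monocyclicD(2)[OF assms(3)] finite_subset[OF _ assms(1), of K] by simp_all
    have own: "owns K h arc" by (rule owns_subset[OF assms(2) K(1)])
    have arcs: "arc ` K \<subseteq> arc ` V - Id" using owns_no_loops[OF assms(2,3) True] K(1) by blast
    have mem: "arc ` K \<in> undirected_cycles (digraph_of V arc)"
      unfolding digraph_of_def
      by (rule undirected_cycleI[OF K(2) monocyclicD(1)[OF assms(3)] K(1) monocyclicD(4,5)[OF assms(3)] own arcs True])
    have "undirected_cycles (digraph_of V arc) = {arc ` K}"
      using sub mem by blast
    then show ?thesis using True by simp
  next
    case False
    have "F \<notin> undirected_cycles (digraph_of V arc)" for F
    proof
      assume F: "F \<in> undirected_cycles (digraph_of V arc)"
      then obtain es where "F = set es" "distinct es" "2 \<le> length es"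
        unfolding undirected_cycles_def by blast
      then have "card F \<ge> 2" by (simp add: distinct_card)
      moreover have "finite K" using monocyclicD(2)[OF assms(3)] assms(1) by (rule finite_subset)
      then have "card F \<le> card K" unfolding sub[OF F] by (rule card_image_le)
      ultimately show False using False by simp
    qed
    then have "undirected_cycles (digraph_of V arc) = {}" by blast
    then show ?thesis using False by simp
  qed
qed

text \<open>Across an uncrossed cut no vertex is sent to the other side, so both sides would be
  closed under \<open>h\<close> and both would contain \<open>K\<close>.\<close>

lemma unicycle_digraph_of:
  assumes "finite V" "owns V h arc" "monocyclic V K h"
  shows "unicycle_digraph (digraph_of V arc)"
proof -
  let ?D = "digraph_of V arc"
  have pairs: "arc ` V \<subseteq> V \<times> V" using owns_pairs[OF assms(2) monocyclicD(3)[OF assms(3)]] .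
  have pd: "pair_digraph ?D"
    by unfold_locales (use pairs assms(1) in auto)
  then have wf: "pair_wf_digraph ?D" by (simp add: pair_digraph.pair_wf_digraph)
  have closed: "h ` W \<subseteq> W"
    if W: "W \<subseteq> V" and nc: "\<not> (\<exists>x\<in>W. \<exists>y\<in>V - W. (x, y) \<in> parcs ?D \<or> (y, x) \<in> parcs ?D)" for W
  proof (rule image_subsetI, rule ccontr)
    fix v assume v: "v \<in> W" "h v \<notin> W"
    have "v \<in> V" using v W by blast
    then have hv: "h v \<in> V" by (rule monocyclicD(7)[OF assms(3)])
    have "arc v \<in> {(v, h v), (h v, v)}" using assms(2) \<open>v \<in> V\<close> by (auto simp: owns_def)
    moreover have "arc v \<in> arc ` V" using \<open>v \<in> V\<close> by (rule imageI)
    moreover have "v \<noteq> h v" using v by metis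
    ultimately have "(v, h v) \<in> parcs ?D \<or> (h v, v) \<in> parcs ?D"
      by (simp only: digraph_of_simps Diff_iff pair_in_Id_conv insert_iff empty_iff) metis
    then show False using nc v hv by blast
  qed
  have "Digraph_Component.connected (with_proj ?D)"
    unfolding connected_iff_cut[OF wf] digraph_of_simps(1)
  proof (intro conjI allI impI, goal_cases)
    case 1
    then show ?case using monocyclicD(1,2)[OF assms(3)] by blast
  next
    case (2 W)
    show ?case
    proof (rule ccontr)
      assume nc: "\<not> (\<exists>x\<in>W. \<exists>y\<in>V - W. (x, y) \<in> parcs ?D \<or> (y, x) \<in> parcs ?D)"
      have "h ` W \<subseteq> W" using closed[OF _ nc] 2(2) by blast
      then have "K \<subseteq> W" using monocyclic_subset_closed[OF assms(3) _ 2(1)] 2(2) by blast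
      moreover have "h ` (V - W) \<subseteq> V - W"
        by (rule closed) (use nc 2(2) in blast)+
      then have "K \<subseteq> V - W" using monocyclic_subset_closed[OF assms(3), of "V - W"] 2(2) by blast
      ultimately show False using monocyclicD(1)[OF assms(3)] by blast
    qed
  qed
  then show ?thesis
    using pd undirected_cycles_digraph_of[OF assms] by (simp add: unicycle_digraph_def)
qed

section \<open>Existence of a representation\<close>

lemma owns_insert:
  assumes "owns W h arc" "arc ` W \<subseteq> W \<times> W" "y \<notin> W" "e = (x, y) \<or> e = (y, x)"
  shows "owns (insert y W) (h(y := x)) (arc(y := e))"
proof -
  have "e \<notin> arc ` W" using assms(2,3,4) by auto
  then have "inj_on (arc(y := e)) (insert y W)"
    using assms(1,3) by (auto simp: owns_def inj_on_def)
  then show ?thesis using assms(1,3,4) by (auto simp: owns_def)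
qed

lemma monocyclic_insert:
  assumes cyc: "monocyclic W K h" and "y \<notin> W" "x \<in> W"
  shows "monocyclic (insert y W) K (h(y := x))"
proof (rule monocyclicI)
  have yK: "y \<notin> K" using monocyclicD(2)[OF cyc] assms(2) by blast
  show "K \<noteq> {}" "K \<subseteq> insert y W" using monocyclicD(1,2)[OF cyc] by blast+
  show "h(y := x) ` insert y W \<subseteq> insert y W" "h(y := x) ` K \<subseteq> K"
    using monocyclicD(7,8)[OF cyc] yK assms by auto
  have pow: "((h(y := x)) ^^ i) z = (h ^^ i) z" if "z \<in> K" for z i
    by (rule sym, rule funpow_eqI[OF _ monocyclicD(4)[OF cyc] that]) (use yK in auto)
  show "\<exists>i. ((h(y := x)) ^^ i) z = z'" if "z \<in> K" "z' \<in> K" for z z'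
    using monocyclicD(5)[OF cyc that] by (simp add: pow that)
  have W: "leads (h(y := x)) K v" if "v \<in> W" for v
  proof (rule leads_transfer[OF monocyclicD(6)[OF cyc that] that])
    show "(h(y := x)) z = h z \<and> h z \<in> W" if "z \<in> W" for z
      using that assms(2) monocyclicD(7)[OF cyc that] by auto
  qed (rule leads.here)
  have "leads (h(y := x)) K ((h(y := x)) y)" using W[OF assms(3)] by (simp only: fun_upd_same)
  then have "leads (h(y := x)) K y" by (rule leads.step)
  then show "leads (h(y := x)) K v" if "v \<in> insert y W" for v
    using W that by blast
qed

text \<open>While \<open>W\<close> is not all of \<open>V\<close>, some arc crosses its boundary;
  the end outside \<open>W\<close> becomes its owner. \<open>B\<close> may exceed \<open>A\<close>
  so as to accommodate the dummy loop of a rooted tree.\<close>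

lemma spanning_extension:
  assumes "finite V"
    and cut: "\<And>W. W \<noteq> {} \<Longrightarrow> W \<subset> V \<Longrightarrow> \<exists>x\<in>W. \<exists>y\<in>V - W. (x, y) \<in> A \<or> (y, x) \<in> A"
    and "owns W h arc" "monocyclic W K h" "W \<subseteq> V" "arc ` W \<subseteq> B" "A \<subseteq> B"
  shows "\<exists>h' arc'. owns V h' arc' \<and> monocyclic V K h' \<and> arc' ` V \<subseteq> B \<and> (\<forall>v\<in>W. arc' v = arc v)"
  using assms(3-)
proof (induction "card (V - W)" arbitrary: W h arc rule: less_induct)
  case less
  show ?case
  proof (cases "W = V")
    case True
    then show ?thesis using less.prems by blast
  next
    case False
    have "W \<noteq> {}" using monocyclicD(1,2)[OF less.prems(2)] by blast
    then obtain x y where xy: "x \<in> W" "y \<in> V" "y \<notin> W" "(x, y) \<in> A \<or> (y, x) \<in> A"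
      using cut[of W] False less.prems(3) by blast
    then obtain e where e: "e \<in> A" "e = (x, y) \<or> e = (y, x)" by blast
    have own: "owns (insert y W) (h(y := x)) (arc(y := e))"
      using owns_insert[OF less.prems(1) owns_pairs[OF less.prems(1) monocyclicD(3)[OF less.prems(2)]] xy(3) e(2)] .
    have cyc: "monocyclic (insert y W) K (h(y := x))"
      by (rule monocyclic_insert[OF less.prems(2) xy(3,1)])
    have "card (V - insert y W) < card (V - W)"
      using xy assms(1) by (intro psubset_card_mono) auto
    moreover have "(arc(y := e)) ` insert y W \<subseteq> B"
      using less.prems(4,5) e(1) xy(3) by auto
    ultimately obtain h' arc' where "owns V h' arc'" "monocyclic V K h'" "arc' ` V \<subseteq> B"
      "\<forall>v\<in>insert y W. arc' v = (arc(y := e)) v"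
      using less.hyps[OF _ own cyc _ _ less.prems(5)] xy(2) less.prems(3) by blast
    moreover have "\<forall>v\<in>W. (arc(y := e)) v = arc v" using xy(3) by auto
    ultimately show ?thesis by (metis insertI2)
  qed
qed

lemma unicycle_digraph_cut:
  assumes "unicycle_digraph D" "W \<noteq> {}" "W \<subset> pverts D"
  shows "\<exists>x\<in>W. \<exists>y\<in>pverts D - W. (x, y) \<in> parcs D \<or> (y, x) \<in> parcs D"
  using assms connected_iff_cut[of D] by (auto simp: unicycle_digraph_def pair_digraph.pair_wf_digraph)

lemma unicycle_digraph_basics:
  assumes "unicycle_digraph D"
  shows "finite (pverts D)" "parcs D \<inter> Id = {}" "parcs D \<subseteq> pverts D \<times> pverts D"
proof -
  interpret pair_digraph D using assms by (simp add: unicycle_digraph_def)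
  show "finite (pverts D)" by (rule pair_finite_verts)
  show "parcs D \<inter> Id = {}" using no_loops' by auto
  show "parcs D \<subseteq> pverts D \<times> pverts D" using in_arcsD1 in_arcsD2 by auto
qed

lemma unicycle_digraph_representation:
  assumes uni: "unicycle_digraph D"
    and own: "owns W h arc" and cyc: "monocyclic W K h" and W: "W \<subseteq> pverts D"
    and sub: "arc ` W \<subseteq> B" and B: "parcs D \<subseteq> B" "B - Id = parcs D" "B - parcs D \<subseteq> arc ` W"
    and uniq: "\<And>C. C \<in> undirected_cycles D \<Longrightarrow> C = arc ` K"
  shows "\<exists>h' arc'. owns (pverts D) h' arc' \<and> monocyclic (pverts D) K h' \<and> arc' ` pverts D = B"
proof -
  note fin = unicycle_digraph_basics(1)[OF uni]
  obtain h' arc' where own': "owns (pverts D) h' arc'" and cyc': "monocyclic (pverts D) K h'"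
    and sub': "arc' ` pverts D \<subseteq> B" and eq: "\<And>v. v \<in> W \<Longrightarrow> arc' v = arc v"
    using spanning_extension[OF fin unicycle_digraph_cut[OF uni] own cyc W sub B(1)] by blast
  have KW: "K \<subseteq> W" by (rule monocyclicD(2)[OF cyc])
  have "B \<subseteq> arc' ` pverts D"
  proof (rule subsetI, rule ccontr)
    fix e assume e: "e \<in> B" "e \<notin> arc' ` pverts D"
    have "arc ` W \<subseteq> arc' ` pverts D" using eq W by force
    then have eD: "e \<in> parcs D" using e B(3) by blast
    obtain a b where ab: "e = (a, b)" by fastforce
    have "a \<in> pverts D" "b \<in> pverts D" "a \<noteq> b"
      using eD ab unicycle_digraph_basics(2,3)[OF uni] by auto
    moreover obtain i where "(h' ^^ i) a \<in> K"
      using monocyclicD(6)[OF cyc' \<open>a \<in> pverts D\<close>] by (auto simp: leads_iff_funpow)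
    ultimately obtain C where C: "C \<in> undirected_cycles \<lparr>pverts = pverts D, parcs = B - Id\<rparr>" "C \<noteq> arc' ` K"
      using extra_arc_second_cycle[OF fin own' cyc' sub' e] ab by blast
    have "C \<in> undirected_cycles D" using C(1) B(2) by (simp add: undirected_cycles_def)
    then have "C = arc ` K" by (rule uniq)
    also have "\<dots> = arc' ` K" using eq KW by (intro image_cong) auto
    finally show False using C(2) by blast
  qed
  then show ?thesis using own' cyc' sub' by blast
qed

lemma digraph_of_eqI: "pverts D = V \<Longrightarrow> parcs D = arc ` V - Id \<Longrightarrow> D = digraph_of V arc"
  by (simp add: digraph_of_def)

lemma rooted_tree_representation:
  assumes uni: "unicycle_digraph D" and "undirected_cycles D = {}" "r \<in> pverts D"
  shows "\<exists>h arc. owns (pverts D) h arc \<and> monocyclic (pverts D) {r} h \<and> D = digraph_of (pverts D) arc"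
proof -
  let ?B = "insert (r, r) (parcs D)"
  have "owns {r} (\<lambda>_. r) (\<lambda>_. (r, r))" by (simp add: owns_def)
  moreover have "monocyclic {r} {r} (\<lambda>_. r)"
  proof (rule monocyclicI)
    show "\<exists>i. ((\<lambda>_. r) ^^ i) x = y" if "x \<in> {r}" "y \<in> {r}" for x y
      using that by (intro exI[of _ 0]) simp
  qed (auto intro: leads.here)
  moreover have "?B - Id = parcs D" using unicycle_digraph_basics(2)[OF uni] by auto
  moreover have "?B - parcs D \<subseteq> (\<lambda>_. (r, r)) ` {r}" by blast
  ultimately have "\<exists>h arc. owns (pverts D) h arc \<and> monocyclic (pverts D) {r} h \<and> arc ` pverts D = ?B"
    using assms(2,3) by (intro unicycle_digraph_representation[OF uni]) auto
  then obtain h arc where h: "owns (pverts D) h arc" "monocyclic (pverts D) {r} h" "arc ` pverts D = ?B"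
    by blast
  moreover have "D = digraph_of (pverts D) arc"
    by (intro digraph_of_eqI) (simp_all only: h(3) \<open>?B - Id = parcs D\<close>)
  ultimately show ?thesis by blast
qed

lemma cyclic_representation:
  assumes uni: "unicycle_digraph D" and ne: "undirected_cycles D \<noteq> {}"
  shows "\<exists>K h arc. card K \<ge> 2 \<and> owns (pverts D) h arc \<and> monocyclic (pverts D) K h \<and> D = digraph_of (pverts D) arc"
proof -
  obtain F where F: "F \<in> undirected_cycles D" using ne by blast
  then obtain es vs where F_es: "F = set es" and len: "length vs = length es" "2 \<le> length es"
    and d: "distinct vs" "distinct es" and sub: "set vs \<subseteq> pverts D" "set es \<subseteq> parcs D"
    and ends: "\<And>i. i < length es \<Longrightarrow> {fst (es ! i), snd (es ! i)} = {vs ! i, vs ! (Suc i mod length vs)}"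
    unfolding undirected_cycles_def by auto
  define K where "K = set vs"
  define h where "h = next_in vs"
  \<comment> \<open>The vertex at position \<open>i\<close> of the cycle owns the edge from position
    \<open>i\<close> to \<open>i + 1\<close>; \<open>inv_into\<close> recovers the position.\<close>
  define arc where "arc = (\<lambda>v. es ! inv_into {..<length vs} ((!) vs) v)"
  have inj: "inj_on ((!) vs) {..<length vs}" using d(1) by (simp add: inj_on_nth)
  have arc_nth: "arc (vs ! i) = es ! i" if "i < length vs" for i
    using that by (simp add: arc_def inv_into_f_f[OF inj])
  have h_nth: "h (vs ! i) = vs ! (Suc i mod length vs)" if "i < length vs" for i
    using next_in_nth[OF d(1) that] by (simp add: h_def)
  have K_nth: "\<exists>i<length vs. v = vs ! i" if "v \<in> K" for v
    using that by (auto simp: K_def in_set_conv_nth)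
  have KF: "arc ` K = F"
  proof
    show "arc ` K \<subseteq> F"
    proof (rule image_subsetI)
      fix v assume "v \<in> K"
      then obtain i where i: "i < length vs" "v = vs ! i" using K_nth by blast
      then show "arc v \<in> F" using arc_nth[OF i(1)] len by (simp add: F_es)
    qed
    show "F \<subseteq> arc ` K"
    proof
      fix e assume "e \<in> F"
      then obtain i where i: "i < length es" "e = es ! i" using F_es by (metis in_set_conv_nth)
      then have "e = arc (vs ! i)" using arc_nth[of i] len by simp
      moreover have "vs ! i \<in> K" using i len by (simp add: K_def)
      ultimately show "e \<in> arc ` K" by blast
    qed
  qed
  have cardK: "card K = length es" using d len by (simp add: K_def distinct_card)
  have "inj_on arc K"
    by (rule eq_card_imp_inj_on) (use d in \<open>simp_all add: KF cardK F_es distinct_card\<close>, simp add: K_def)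
  moreover have "arc v = (v, h v) \<or> arc v = (h v, v)" if v: "v \<in> K" for v
  proof -
    obtain i where i: "i < length vs" "v = vs ! i" using K_nth[OF v] by blast
    have "{fst (arc v), snd (arc v)} = {v, h v}"
      using ends[of i] i len by (simp add: arc_nth h_nth)
    then show ?thesis by (cases "arc v") (auto simp: doubleton_eq_iff)
  qed
  ultimately have own: "owns K h arc" by (simp add: owns_def)
  have "K \<noteq> {}" using len by (auto simp: K_def)
  then have cyc: "monocyclic K K h"
    using next_in_cyclic[OF d(1)] cyclic_maps_iff_monocyclic[of K K h] by (simp add: K_def h_def)
  have uniq: "C = arc ` K" if "C \<in> undirected_cycles D" for C
    using uni F that unfolding KF unicycle_digraph_def by blast
  have noId: "parcs D - Id = parcs D" using unicycle_digraph_basics(2)[OF uni] by blast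
  obtain h' arc' where "owns (pverts D) h' arc'" "monocyclic (pverts D) K h'" "arc' ` pverts D = parcs D"
  proof -
    have "\<exists>h' arc'. owns (pverts D) h' arc' \<and> monocyclic (pverts D) K h' \<and> arc' ` pverts D = parcs D"
    proof (rule unicycle_digraph_representation[OF uni own cyc _ _ order_refl noId _ uniq])
      show "arc ` K \<subseteq> parcs D" unfolding KF F_es by (rule sub(2))
      show "K \<subseteq> pverts D" "parcs D - parcs D \<subseteq> arc ` K"
        using sub by (simp_all add: K_def)
    qed
    then show ?thesis using that by blast
  qed
  moreover from this(3) have "D = digraph_of (pverts D) arc'"
    by (intro digraph_of_eqI) (simp_all add: noId)
  moreover have "card K \<ge> 2" using cardK len by simp
  ultimately show ?thesis by blast
qed

section \<open>Uniqueness of the representation\<close>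

lemma owns_same_map:
  assumes "owns V h arc" "owns V' h' arc'" "v \<in> V" "v \<in> V'" "arc' v = arc v"
  shows "h' v = h v"
  using owns_arc[OF assms(1,3)] owns_arc[OF assms(2,4)] assms(5) by auto

lemma owns_other_owner:
  assumes "owns V h arc" "owns V' h' arc'" "v \<in> V'" "u \<in> V" "arc' v = arc u" "u \<noteq> v"
  shows "h u = v" "h' v = u"
  using owns_arc[OF assms(1,4)] owns_arc[OF assms(2,3)] assms(5,6) by auto

text \<open>Induction along the orbit under \<open>h'\<close>. If \<open>v\<close> owned another arc
  in the second structure, its owner \<open>u\<close> in the first would satisfy
  \<open>h u = v\<close> and \<open>h' v = u\<close>. Thus \<open>u\<close> lies off
  \<open>K\<close> and nearer to it, and by induction keeps \<open>arc u\<close>; but that is the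
  arc \<open>arc' v\<close>, now owned twice.\<close>

lemma off_cycle_arcs_unique:
  assumes own: "owns V h arc" "owns V h' arc'" and cyc: "monocyclic V K h" "monocyclic V K h'"
    and im: "arc' ` V \<subseteq> arc ` V" and v: "v \<in> V" "v \<notin> K"
  shows "arc' v = arc v"
proof -
  have "leads h' K v" by (rule monocyclicD(6)[OF cyc(2) v(1)])
  then show ?thesis using v
  proof induction
    case (step v)
    obtain u where u: "u \<in> V" "arc' v = arc u" using im step.prems(1) by blast
    show ?case
    proof (rule ccontr)
      assume ne: "arc' v \<noteq> arc v"
      then have "u \<noteq> v" using u by blast
      then have uv: "h u = v" "h' v = u"
        using owns_other_owner[OF own(1,2) step.prems(1) u] by blast+
      then have "u \<notin> K" using monocyclicD(8)[OF cyc(1), of u] step.prems(2) by blast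
      then have "arc' u = arc u" using step.IH u(1) uv(2) by simp
      then have "arc' u = arc' v" using u(2) by simp
      then show False
        using own(2) u(1) step.prems(1) \<open>u \<noteq> v\<close> unfolding owns_def by (meson inj_onD)
    qed
  qed blast
qed

text \<open>Two cycle arcs meet at \<open>h v\<close>: its own and that of \<open>v\<close>. One
  coincidence of \<open>arc\<close> and \<open>arc'\<close> spreads around \<open>K\<close> by
  injectivity; without any, every arc passes to the successor.\<close>

lemma cycle_arcs_unique_up_to_reversal:
  assumes own: "owns V h arc" "owns V h' arc'" and cyc: "monocyclic V K h" "monocyclic V K h'"
    and fin: "finite K" and im: "arc' ` K \<subseteq> arc ` K"
  shows "(\<forall>v\<in>K. arc' v = arc v) \<or> (\<forall>v\<in>K. arc' (h v) = arc v)"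
proof -
  have KV: "v \<in> V" if "v \<in> K" for v by (rule monocyclicD(9)[OF cyc(1) that])
  have alt: "arc' (h v) = arc (h v) \<or> arc' (h v) = arc v" if v: "v \<in> K" for v
  proof -
    have hv: "h v \<in> K" by (rule monocyclicD(8)[OF cyc(1) v])
    obtain u where u: "u \<in> K" "arc' (h v) = arc u" using im hv by blast
    show ?thesis
    proof (cases "u = h v")
      case False
      then have "h u = h v" using owns_other_owner(1)[OF own KV[OF hv] KV[OF u(1)] u(2)] by blast
      then have "u = v" using monocyclic_bij(2)[OF cyc(1) fin] u(1) v by (simp add: inj_on_def)
      then show ?thesis using u(2) by blast
    qed (use u in blast)
  qed
  have inj: "inj_on arc' V" using own(2) by (simp add: owns_def)
  show ?thesis
  proof (cases "\<exists>x\<in>K. arc' x = arc x")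
    case True
    then obtain x where x: "x \<in> K" "arc' x = arc x" by blast
    have same: "arc' ((h ^^ i) x) = arc ((h ^^ i) x)" for i
    proof (induction i)
      case (Suc i)
      have xi: "(h ^^ i) x \<in> K" by (rule funpow_closed[OF monocyclicD(4)[OF cyc(1)] x(1)])
      have hxi: "h ((h ^^ i) x) \<in> K" by (rule monocyclicD(8)[OF cyc(1) xi])
      from alt[OF xi] have "arc' (h ((h ^^ i) x)) = arc (h ((h ^^ i) x))"
      proof
        assume "arc' (h ((h ^^ i) x)) = arc ((h ^^ i) x)"
        then have "arc' (h ((h ^^ i) x)) = arc' ((h ^^ i) x)" using Suc by simp
        then have "h ((h ^^ i) x) = (h ^^ i) x" by (rule inj_onD[OF inj _ KV[OF hxi] KV[OF xi]])
        then show ?thesis using Suc by simp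
      qed
      then show ?case by simp
    qed (use x in simp)
    have "arc' v = arc v" if v: "v \<in> K" for v
    proof -
      obtain i where "(h ^^ i) x = v" using monocyclicD(5)[OF cyc(1) x(1) v] ..
      then show ?thesis using same by blast
    qed
    then show ?thesis by blast
  next
    case False
    have "arc' (h v) = arc v" if "v \<in> K" for v
      using alt[OF that] False monocyclicD(8)[OF cyc(1) that] by blast
    then show ?thesis by blast
  qed
qed

lemma owns_cycle_ends:
  assumes "owns V h arc" "K \<subseteq> V" "h ` K \<subseteq> K"
  shows "K = fst ` arc ` K \<union> snd ` arc ` K"
proof -
  have e: "{fst (arc v), snd (arc v)} = {v, h v}" if "v \<in> K" for v
    using owns_ends[OF assms(1)] assms(2) that by blast
  have "(\<Union>v\<in>K. {fst (arc v), snd (arc v)}) = (\<Union>v\<in>K. {v, h v})"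
    by (rule SUP_cong[OF refl]) (rule e)
  also have "\<dots> = K" using assms(3) by blast
  finally show ?thesis by blast
qed

lemma digraph_of_same_cycle:
  assumes fin: "finite V" and own: "owns V h arc" "owns V h' arc'" and cyc: "monocyclic V K h" "monocyclic V K' h'"
    and card: "card K \<ge> 2" "card K' \<ge> 2" and eq: "digraph_of V arc' = digraph_of V arc"
  shows "K' = K" "arc' ` K = arc ` K" "arc' ` V = arc ` V"
proof -
  have "{arc' ` K'} = {arc ` K}"
    using undirected_cycles_digraph_of[OF fin own(1) cyc(1)]
      undirected_cycles_digraph_of[OF fin own(2) cyc(2)] card eq by simp
  then have im: "arc' ` K' = arc ` K" by simp
  have "K' = fst ` arc' ` K' \<union> snd ` arc' ` K'"
    by (rule owns_cycle_ends[OF own(2) monocyclicD(2,4)[OF cyc(2)]])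
  also have "\<dots> = K" unfolding im
    by (rule owns_cycle_ends[OF own(1) monocyclicD(2,4)[OF cyc(1)], symmetric])
  finally show K: "K' = K" .
  then show "arc' ` K = arc ` K" using im by simp
  have "parcs (digraph_of V arc') = parcs (digraph_of V arc)" using eq by simp
  then show "arc' ` V = arc ` V"
    using owns_no_loops[OF own(1) cyc(1) card(1)] owns_no_loops[OF own(2) cyc(2) card(2)] by simp
qed

lemma rooted_tree_unique:
  assumes own: "owns V h arc" "owns V h' arc'" and cyc: "monocyclic V {r} h" "monocyclic V {r} h'"
    and eq: "digraph_of V arc' = digraph_of V arc" and v: "v \<in> V"
  shows "arc' v = arc v" "h' v = h v"
proof -
  have r: "r \<in> V" "h r = r" "h' r = r"
    using monocyclicD(2,8)[OF cyc(1)] monocyclicD(8)[OF cyc(2)] by auto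
  then have arcr: "arc r = (r, r)" "arc' r = (r, r)"
    using owns_arc[OF own(1) r(1)] owns_arc[OF own(2) r(1)] by auto
  have "parcs (digraph_of V arc') = parcs (digraph_of V arc)" using eq by simp
  then have arcs: "arc' ` V - Id = arc ` V - Id" by simp
  \<comment> \<open>Equality of digraphs says nothing about deleted loops. The only loop is the one
    at the root, and it is common to both structures.\<close>
  have loop: "arc' u = (r, r)" if "u \<in> V" "arc' u \<in> Id" for u
  proof -
    have "h' u = u" using owns_arc[OF own(2) that(1)] that(2) by (elim disjE) auto
    then have "{r} = {u}" by (rule monocyclic_fixpoint[OF cyc(2) that(1)])
    then show ?thesis using arcr by simp
  qed
  have im: "arc' ` V \<subseteq> arc ` V"
  proof (rule image_subsetI)
    fix u assume u: "u \<in> V"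
    show "arc' u \<in> arc ` V"
    proof (cases "arc' u \<in> Id")
      case True
      then have "arc' u = arc r" using loop[OF u] arcr by simp
      then show ?thesis using r(1) by blast
    next
      case False
      then show ?thesis using arcs u by blast
    qed
  qed
  show *: "arc' v = arc v"
  proof (cases "v = r")
    case False
    then show ?thesis using off_cycle_arcs_unique[OF own cyc im v] by blast
  qed (simp add: arcr)
  then show "h' v = h v" by (rule owns_same_map[OF own v v])
qed

text \<open>Reversing the rotation gives each vertex of \<open>K\<close> the arc of its predecessor;
  the identity off \<open>K\<close> turns this into a reindexing of \<open>arc\<close> on all of
  \<open>V\<close>. For \<open>card K = 2\<close> the reversed map equals \<open>h\<close> on
  \<open>K\<close> and only the ownership of the two opposite arcs is exchanged.\<close>

definition pred_on :: "'a set \<Rightarrow> ('a \<Rightarrow> 'a) \<Rightarrow> 'a \<Rightarrow> 'a" where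
  "pred_on K h v = (if v \<in> K then inv_into K h v else v)"

definition reverse_cycle :: "'a set \<Rightarrow> ('a \<Rightarrow> 'a) \<Rightarrow> 'a \<Rightarrow> 'a" where
  "reverse_cycle K h v = (if v \<in> K then inv_into K h v else h v)"

lemma pred_on_props:
  assumes "monocyclic V K h" "finite K"
  shows "v \<in> K \<Longrightarrow> pred_on K h v \<in> K" "v \<in> K \<Longrightarrow> h (pred_on K h v) = v"
    "v \<in> K \<Longrightarrow> pred_on K h (h v) = v" "bij_betw (pred_on K h) V V"
proof -
  note b = monocyclic_bij[OF assms]
  show 1: "v \<in> K \<Longrightarrow> pred_on K h v \<in> K" for v
    using b(1) by (simp add: pred_on_def) (metis inv_into_into)
  show 2: "v \<in> K \<Longrightarrow> h (pred_on K h v) = v" for v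
    using b(1) by (simp add: pred_on_def f_inv_into_f)
  show 3: "v \<in> K \<Longrightarrow> pred_on K h (h v) = v" for v
    using b(2) monocyclicD(8)[OF assms(1)] by (simp add: pred_on_def inv_into_f_f)
  have off: "v \<notin> K \<Longrightarrow> pred_on K h v = v" for v by (simp add: pred_on_def)
  show "bij_betw (pred_on K h) V V"
  proof (rule bij_betw_byWitness[where f' = "\<lambda>v. if v \<in> K then h v else v"])
    show "\<forall>v\<in>V. (if pred_on K h v \<in> K then h (pred_on K h v) else pred_on K h v) = v"
      using 1 2 off by (metis (full_types))
    show "\<forall>v\<in>V. pred_on K h (if v \<in> K then h v else v) = v"
      using 3 off by auto
    show "pred_on K h ` V \<subseteq> V"
      using 1 off monocyclicD(9)[OF assms(1)] by (metis image_subsetI)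
    show "(\<lambda>v. if v \<in> K then h v else v) ` V \<subseteq> V"
      using monocyclicD(7)[OF assms(1)] by auto
  qed
qed

lemma reverse_cycle_owns:
  assumes own: "owns V h arc" and cyc: "monocyclic V K h" and fin: "finite K"
  shows "owns V (reverse_cycle K h) (\<lambda>v. arc (pred_on K h v))"
proof -
  note p = pred_on_props[OF cyc fin]
  have "inj_on (arc \<circ> pred_on K h) V"
  proof (rule comp_inj_on)
    show "inj_on (pred_on K h) V" using p(4) by (rule bij_betw_imp_inj_on)
    show "inj_on arc (pred_on K h ` V)"
      using p(4) own by (simp add: bij_betw_imp_surj_on owns_def)
  qed
  moreover have "arc (pred_on K h v) = (v, reverse_cycle K h v) \<or> arc (pred_on K h v) = (reverse_cycle K h v, v)"
    if v: "v \<in> V" for v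
  proof (cases "v \<in> K")
    case True
    have "pred_on K h v \<in> V" using p(1)[OF True] by (rule monocyclicD(9)[OF cyc])
    moreover have "reverse_cycle K h v = pred_on K h v" using True by (simp add: reverse_cycle_def pred_on_def)
    ultimately show ?thesis using owns_arc[OF own, of "pred_on K h v"] p(2)[OF True] by auto
  next
    case False
    then show ?thesis using owns_arc[OF own v] by (simp add: reverse_cycle_def pred_on_def)
  qed
  ultimately show ?thesis by (simp add: owns_def o_def)
qed

lemma reverse_cycle_monocyclic:
  assumes cyc: "monocyclic V K h" and fin: "finite K"
  shows "monocyclic V K (reverse_cycle K h)"
proof (rule monocyclicI)
  let ?g = "reverse_cycle K h"
  note p = pred_on_props[OF cyc fin]
  have gK: "?g v = pred_on K h v" if "v \<in> K" for v using that by (simp add: reverse_cycle_def pred_on_def)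
  have gV: "?g v = h v" if "v \<notin> K" for v using that by (simp add: reverse_cycle_def)
  show "K \<noteq> {}" "K \<subseteq> V" by (rule monocyclicD[OF cyc])+
  show "?g ` K \<subseteq> K" using gK p(1) by (metis image_subsetI)
  show "?g ` V \<subseteq> V"
    using gK gV p(1) monocyclicD(7,9)[OF cyc] by (metis image_subsetI)
  have undo: "(?g ^^ i) ((h ^^ i) y) = y" if "y \<in> K" for i y
    using that
  proof (induction i arbitrary: y)
    case (Suc i)
    have "(h ^^ i) y \<in> K" by (rule funpow_closed[OF monocyclicD(4)[OF cyc] Suc.prems])
    moreover from this have "h ((h ^^ i) y) \<in> K" by (rule monocyclicD(8)[OF cyc])
    ultimately have "?g (h ((h ^^ i) y)) = (h ^^ i) y" using gK p(3) by simp
    then have "(?g ^^ Suc i) ((h ^^ Suc i) y) = (?g ^^ i) ((h ^^ i) y)"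
      by (simp only: funpow_Suc_right[of _ ?g] o_apply funpow.simps(2)[of _ h])
    then show ?case using Suc by simp
  qed simp
  show "\<exists>i. (?g ^^ i) x = y" if "x \<in> K" "y \<in> K" for x y
  proof -
    obtain i where "(h ^^ i) y = x" using monocyclicD(5)[OF cyc \<open>y \<in> K\<close> \<open>x \<in> K\<close>] ..
    then show ?thesis using undo[OF \<open>y \<in> K\<close>] by blast
  qed
  show "leads ?g K v" if "v \<in> V" for v
  proof (rule leads_transfer[OF monocyclicD(6)[OF cyc that] that])
    show "?g x = h x \<and> h x \<in> V" if "x \<in> V" "x \<notin> K" for x
      using gV monocyclicD(7)[OF cyc] that by blast
  qed (rule leads.here)
qed

lemma reverse_cycle_digraph_of:
  assumes "monocyclic V K h" "finite K"
  shows "digraph_of V (\<lambda>v. arc (pred_on K h v)) = digraph_of V arc"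
proof -
  have "(\<lambda>v. arc (pred_on K h v)) ` V = arc ` pred_on K h ` V" by (simp add: image_image)
  also have "pred_on K h ` V = V" using pred_on_props(4)[OF assms] by (rule bij_betw_imp_surj_on)
  finally show ?thesis by (simp add: digraph_of_def)
qed

section \<open>Well-colorings\<close>

definition kernel_rule :: "('a \<times> 'a) set \<Rightarrow> ('a \<Rightarrow> color) \<Rightarrow> 'a \<Rightarrow> bool" where
  "kernel_rule A c v \<longleftrightarrow> (c v = Red \<longleftrightarrow> \<not> (\<exists>u. (v, u) \<in> A \<and> c u = Red))"

lemma not_Red_iff: "x \<noteq> Red \<longleftrightarrow> x = Green"
  by (cases x) auto

lemma well_coloring_iff:
  "well_coloring D c \<longleftrightarrow> c \<in> pverts D \<rightarrow>\<^sub>E UNIV \<and> (\<forall>v\<in>pverts D. kernel_rule (parcs D) c v)"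
proof -
  have "(c u = Green \<longrightarrow> (\<exists>v\<in>children D u. c v = Red)) \<and> (c u = Red \<longrightarrow> \<not> (\<exists>v\<in>children D u. c v = Red))
      \<longleftrightarrow> kernel_rule (parcs D) c u" for u
    by (cases "c u") (auto simp: kernel_rule_def children_def)
  then show ?thesis unfolding well_coloring_def by blast
qed

text \<open>The coloring is prescribed on \<open>K\<close> and obeys the kernel rule only outside
  \<open>K\<close>.\<close>

definition extensions :: "'a set \<Rightarrow> 'a set \<Rightarrow> ('a \<times> 'a) set \<Rightarrow> ('a \<Rightarrow> color) \<Rightarrow> ('a \<Rightarrow> color) set" where
  "extensions V K A \<kappa> = {c \<in> V \<rightarrow>\<^sub>E UNIV. (\<forall>v\<in>K. c v = \<kappa> v) \<and> (\<forall>v\<in>V - K. kernel_rule A c v)}"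

text \<open>The usual argument that an acyclic digraph has exactly one kernel. The last hypothesis
  supplies a vertex \<open>x\<close> outside \<open>K\<close> with all its children in
  \<open>K\<close>; its color \<open>b\<close> is then forced, and \<open>x\<close> joins the
  prescribed part.\<close>

lemma unique_extension:
  assumes "finite V" "A \<subseteq> V \<times> V" "K \<subseteq> V"
    and "\<And>W. W \<noteq> {} \<Longrightarrow> W \<subseteq> V - K \<Longrightarrow> \<exists>x\<in>W. \<forall>y\<in>W. (x, y) \<notin> A"
  shows "\<exists>!c. c \<in> extensions V K A \<kappa>"
  using assms(3,4)
proof (induction "card (V - K)" arbitrary: K \<kappa> rule: less_induct)
  case less
  show ?case
  proof (cases "K = V")
    case True
    show ?thesis
    proof (rule ex1I)
      show "restrict \<kappa> V \<in> extensions V K A \<kappa>" using True by (simp add: extensions_def)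
      show "c = restrict \<kappa> V" if c: "c \<in> extensions V K A \<kappa>" for c
      proof (rule PiE_ext)
        show "c \<in> V \<rightarrow>\<^sub>E UNIV" "restrict \<kappa> V \<in> V \<rightarrow>\<^sub>E UNIV"
          using c by (simp_all add: extensions_def)
        show "c v = restrict \<kappa> V v" if "v \<in> V" for v
          using c that True by (simp add: extensions_def)
      qed
    qed
  next
    case False
    then have "V - K \<noteq> {}" using less.prems(1) by blast
    then have "\<exists>x\<in>V - K. \<forall>y\<in>V - K. (x, y) \<notin> A" using less.prems(2) by simp
    then obtain x where x: "x \<in> V" "x \<notin> K" and sink: "\<forall>y\<in>V - K. (x, y) \<notin> A"
      by blast
    have ch: "u \<in> K" if u: "(x, u) \<in> A" for u
    proof -
      have "u \<in> V" using u assms(2) by blast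
      then show ?thesis using sink u by blast
    qed
    define b where "b = (if \<exists>u. (x, u) \<in> A \<and> \<kappa> u = Red then Green else Red)"
    have "extensions V K A \<kappa> = extensions V (insert x K) A (\<kappa>(x := b))"
    proof (intro set_eqI)
      fix c
      have aux: "(P \<and> Q \<and> k \<and> R) = (P \<and> (e \<and> Q) \<and> R)" if "Q \<Longrightarrow> k = e" for P Q k R e
        using that by blast
      have 1: "kernel_rule A c x = (c x = b)" if "\<forall>v\<in>K. c v = \<kappa> v"
      proof -
        have "(\<exists>u. (x, u) \<in> A \<and> c u = Red) \<longleftrightarrow> (\<exists>u. (x, u) \<in> A \<and> \<kappa> u = Red)"
        proof (rule ex_cong1)
          fix u
          show "((x, u) \<in> A \<and> c u = Red) = ((x, u) \<in> A \<and> \<kappa> u = Red)"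
            by (rule conj_cong[OF refl]) (simp add: that ch)
        qed
        then have "kernel_rule A c x \<longleftrightarrow> (c x = Red \<longleftrightarrow> \<not> (\<exists>u. (x, u) \<in> A \<and> \<kappa> u = Red))"
          by (simp only: kernel_rule_def)
        then show ?thesis
          by (cases "c x"; cases "\<exists>u. (x, u) \<in> A \<and> \<kappa> u = Red") (simp_all only: b_def if_True if_False color.distinct simp_thms)
      qed
      have 2: "(\<forall>v\<in>V - K. kernel_rule A c v) \<longleftrightarrow>
          kernel_rule A c x \<and> (\<forall>v\<in>V - insert x K. kernel_rule A c v)"
        using x by blast
      have 3: "(\<forall>v\<in>insert x K. c v = (\<kappa>(x := b)) v) \<longleftrightarrow> c x = b \<and> (\<forall>v\<in>K. c v = \<kappa> v)"
        using x(2) by (metis fun_upd_other fun_upd_same insert_iff)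
      show "c \<in> extensions V K A \<kappa> \<longleftrightarrow> c \<in> extensions V (insert x K) A (\<kappa>(x := b))"
        unfolding extensions_def mem_Collect_eq 2 3 by (rule aux[OF 1])
    qed
    moreover have "card (V - insert x K) < card (V - K)"
      using x assms(1) by (intro psubset_card_mono) auto
    then have "\<exists>!c. c \<in> extensions V (insert x K) A (\<kappa>(x := b))"
    proof (rule less.hyps)
      show "insert x K \<subseteq> V" using x(1) less.prems(1) by blast
      show "\<exists>x\<in>W. \<forall>y\<in>W. (x, y) \<notin> A" if "W \<noteq> {}" "W \<subseteq> V - insert x K" for W
        by (rule less.prems(2)[OF that(1)]) (use that(2) in blast)
    qed
    ultimately show ?thesis by (simp only:)
  qed
qed

section \<open>Colorings when no directed cycle stands in the way\<close>

lemma ex1_card: "\<exists>!x. x \<in> S \<Longrightarrow> card S = 1"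
proof -
  assume "\<exists>!x. x \<in> S"
  then obtain x where "S = {x}" by blast
  then show "card S = 1" by simp
qed

text \<open>Choose for each \<open>x \<in> W\<close> an arc \<open>t x\<close> to a child in
  \<open>W\<close>. These are \<open>card W\<close> arcs, distinct by their tails, whose owners are
  among their ends and so in \<open>W\<close>. By cardinality they are all the arcs owned by
  \<open>W\<close>, which therefore stay in \<open>W\<close> and have distinct tails.\<close>

lemma children_closed:
  assumes "finite V" "owns V h arc" "W \<subseteq> V" "B \<subseteq> arc ` V"
    and ch: "\<And>x. x \<in> W \<Longrightarrow> \<exists>y\<in>W. (x, y) \<in> B"
  shows "h ` W \<subseteq> W" "arc ` W \<subseteq> B" "inj_on fst (arc ` W)"
proof -
  define t where "t x = (x, SOME y. y \<in> W \<and> (x, y) \<in> B)" for x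
  have t: "snd (t x) \<in> W \<and> t x \<in> B" if "x \<in> W" for x
  proof -
    have "\<exists>y. y \<in> W \<and> (x, y) \<in> B" using ch[OF that] by blast
    then show ?thesis unfolding t_def snd_conv by (rule someI_ex)
  qed
  have finW: "finite W" using assms(3,1) by (rule finite_subset)
  have fst_t: "fst (t x) = x" for x by (simp add: t_def)
  have sub: "t ` W \<subseteq> arc ` W"
  proof (rule image_subsetI)
    fix x assume x: "x \<in> W"
    then obtain u where u: "u \<in> V" "t x = arc u" using t assms(4) by blast
    then have "u \<in> {fst (t x), snd (t x)}" using owns_ends[OF assms(2) u(1)] by auto
    then have "u \<in> W" using t[OF x] fst_t[of x] x by auto
    then show "t x \<in> arc ` W" using u(2) by blast
  qed
  have "inj_on t W" by (rule inj_on_inverseI[of _ fst]) (rule fst_t)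
  then have "card (t ` W) = card W" by (rule card_image)
  then have eq: "t ` W = arc ` W"
    using card_image_le[OF finW, of arc] finW sub by (intro card_seteq) auto
  show "arc ` W \<subseteq> B" unfolding eq[symmetric] using t by blast
  show "inj_on fst (arc ` W)"
    unfolding eq[symmetric] by (rule inj_onI) (elim imageE, simp add: fst_t)
  show "h ` W \<subseteq> W"
  proof (rule image_subsetI)
    fix v assume v: "v \<in> W"
    then have "arc v \<in> t ` W" unfolding eq by blast
    then have "{fst (arc v), snd (arc v)} \<subseteq> W" using t fst_t by auto
    then show "h v \<in> W" using owns_ends[OF assms(2), of v] v assms(3) by blast
  qed
qed

lemma unique_extension_off_cycle:
  assumes "finite V" "owns V h arc" "monocyclic V K h"
  shows "\<exists>!c. c \<in> extensions V K (arc ` V - Id) \<kappa>"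
proof (rule unique_extension)
  show "arc ` V - Id \<subseteq> V \<times> V" using owns_pairs[OF assms(2) monocyclicD(3)[OF assms(3)]] by blast
  show "\<exists>x\<in>W. \<forall>y\<in>W. (x, y) \<notin> arc ` V - Id" if W: "W \<noteq> {}" "W \<subseteq> V - K" for W
  proof (rule ccontr)
    assume "\<not> (\<exists>x\<in>W. \<forall>y\<in>W. (x, y) \<notin> arc ` V - Id)"
    then have ch: "\<And>x. x \<in> W \<Longrightarrow> \<exists>y\<in>W. (x, y) \<in> arc ` V - Id" by blast
    have WV: "W \<subseteq> V" using W(2) by blast
    have "h ` W \<subseteq> W" by (rule children_closed(1)[OF assms(1,2) WV Diff_subset ch])
    then have "K \<subseteq> W" by (rule monocyclic_subset_closed[OF assms(3) WV W(1)])
    then show False using W(2) monocyclicD(1)[OF assms(3)] by blast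
  qed
qed (rule assms(1), rule monocyclicD(2)[OF assms(3)])

text \<open>A nonempty set in which every vertex has a child would contain \<open>K\<close>, with
  the arcs of \<open>K\<close> having distinct tails. That makes the cycle directed, contrary to
  \<open>nd\<close>; so the kernel argument applies to all of \<open>V\<close>. The case
  \<open>card K < 2\<close> covers the trees.\<close>

lemma card_well_colorings_acyclic:
  assumes fin: "finite V" and own: "owns V h arc" and cyc: "monocyclic V K h"
    and nd: "card K < 2 \<or> \<not> ((\<forall>v\<in>K. arc v = (v, h v)) \<or> (\<forall>v\<in>K. arc v = (h v, v)))"
  shows "card {c. well_coloring (digraph_of V arc) c} = 1"
proof -
  let ?A = "arc ` V - Id"
  have sink: "\<exists>x\<in>W. \<forall>y\<in>W. (x, y) \<notin> ?A" if W: "W \<noteq> {}" "W \<subseteq> V - {}" for W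
  proof (rule ccontr)
    assume "\<not> (\<exists>x\<in>W. \<forall>y\<in>W. (x, y) \<notin> ?A)"
    then have ch: "\<And>x. x \<in> W \<Longrightarrow> \<exists>y\<in>W. (x, y) \<in> ?A" by blast
    have WV: "W \<subseteq> V" using W by blast
    note closed = children_closed[OF fin own WV Diff_subset ch]
    have KW: "K \<subseteq> W" by (rule monocyclic_subset_closed[OF cyc WV W(1) closed(1)])
    have nofix: "h v \<noteq> v" if v: "v \<in> W" for v
    proof
      assume fx: "h v = v"
      have "arc v = (v, v)" using owns_arc[OF own subsetD[OF WV v]] unfolding fx by blast
      then show False using subsetD[OF closed(2) imageI[OF v]] by simp
    qed
    obtain x0 where x0: "x0 \<in> K" using monocyclicD(1)[OF cyc] by blast
    have finK: "finite K" using monocyclicD(2)[OF cyc] fin by (rule finite_subset)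
    have "h x0 \<noteq> x0" using nofix x0 KW by blast
    then have "card {x0, h x0} = 2" by simp
    moreover have "{x0, h x0} \<subseteq> K" using x0 monocyclicD(8)[OF cyc] by blast
    ultimately have "\<not> card K < 2" using card_mono[OF finK, of "{x0, h x0}"] by simp
    then have "\<not> ((\<forall>v\<in>K. arc v = (v, h v)) \<or> (\<forall>v\<in>K. arc v = (h v, v)))" using nd by blast
    then have nd: "\<not> (\<forall>v\<in>K. arc v = (v, h v))" "\<not> (\<forall>v\<in>K. arc v = (h v, v))" by blast+
    from nd(2) obtain x where xK: "x \<in> K" and "arc x \<noteq> (h x, x)" by blast
    then have "arc x = (x, h x)" using owns_arc[OF own monocyclicD(9)[OF cyc xK]] by blast
    note x = xK this
    \<comment> \<open>A forward arc at \<open>h p\<close> and a backward arc at \<open>p\<close>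
      would share the tail \<open>h p\<close>. So forwardness passes to predecessors and, from the
      one forward vertex \<open>x\<close>, all around \<open>K\<close>.\<close>
    have fwd: "arc p = (p, h p)" if p: "p \<in> K" "arc (h p) = (h p, h (h p))" for p
    proof (rule ccontr)
      assume "arc p \<noteq> (p, h p)"
      then have "arc p = (h p, p)" using owns_arc[OF own monocyclicD(9)[OF cyc p(1)]] by blast
      then have f: "fst (arc p) = fst (arc (h p))" using p(2) by simp
      have hp: "h p \<in> K" by (rule monocyclicD(8)[OF cyc p(1)])
      have "arc p = arc (h p)"
        by (rule inj_onD[OF closed(3) f]) (use KW p(1) hp in blast)+
      then have "p = h p"
        using own monocyclicD(9)[OF cyc p(1)] monocyclicD(9)[OF cyc hp] unfolding owns_def inj_on_def by blast
      then have "h p = p" by (rule sym)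
      then show False using nofix KW p(1) by blast
    qed
    have "arc y = (y, h y)" if y: "y \<in> K" for y
    proof -
      obtain i where i: "(h ^^ i) y = x" using monocyclicD(5)[OF cyc y x(1)] ..
      have "arc y = (y, h y)" if "y \<in> K" "(h ^^ i) y = x" for i y
        using that
      proof (induction i arbitrary: y)
        case 0
        then show ?case using x(2) by simp
      next
        case (Suc i)
        have "(h ^^ i) (h y) = x" using Suc.prems(2) by (simp only: funpow_Suc_right o_apply)
        then have "arc (h y) = (h y, h (h y))" by (rule Suc.IH[OF monocyclicD(8)[OF cyc Suc.prems(1)]])
        then show ?case by (rule fwd[OF Suc.prems(1)])
      qed
      then show ?thesis using y i by blast
    qed
    then show False using nd by blast
  qed
  have "?A \<subseteq> V \<times> V" using owns_pairs[OF own monocyclicD(3)[OF cyc]] by blast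
  then have "\<exists>!c. c \<in> extensions V {} ?A (\<lambda>_. Red)"
    by (rule unique_extension[OF fin _ empty_subsetI sink])
  moreover have "extensions V {} ?A (\<lambda>_. Red) = {c. well_coloring (digraph_of V arc) c}"
    by (simp add: extensions_def well_coloring_iff)
  ultimately show ?thesis using ex1_card[of "extensions V {} ?A (\<lambda>_. Red)"] by simp
qed

section \<open>Colorings of a directed ring\<close>

lemma funpow_alternating:
  assumes "\<And>i. 0 < i \<Longrightarrow> i < k \<Longrightarrow> (c ((h ^^ i) x) = Red \<longleftrightarrow> c (h ((h ^^ i) x)) \<noteq> Red)" "0 < i" "i \<le> k"
  shows "c ((h ^^ i) x) = Red \<longleftrightarrow> (if odd i then c (h x) = Red else c (h x) \<noteq> Red)"
  using assms(2,3)
proof (induction i)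
  case (Suc i)
  show ?case
  proof (cases "i = 0")
    case False
    then have "0 < i" "i < k" using Suc.prems by simp_all
    then have "c (h ((h ^^ i) x)) = Red \<longleftrightarrow> c ((h ^^ i) x) \<noteq> Red" using assms(1)[of i] by blast
    moreover have "(c ((h ^^ i) x) = Red) = (if odd i then c (h x) = Red else c (h x) \<noteq> Red)"
      using Suc False by simp
    ultimately show ?thesis by auto
  qed simp
qed simp

text \<open>\<open>Q\<close> consists of the ring vertices not forced green from outside. A forced
  vertex cuts the ring into paths, which are colored uniquely from their ends. Without one, colors
  alternate around the ring, in two ways or none according to parity.\<close>

lemma card_ring_colorings:
  assumes fin: "finite K" and cyc: "monocyclic K K h"
  shows "card {\<kappa> \<in> K \<rightarrow>\<^sub>E UNIV. \<forall>w\<in>K. \<kappa> w = Red \<longleftrightarrow> w \<in> Q \<and> \<kappa> (h w) \<noteq> Red} =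
    (if K \<subseteq> Q then if even (card K) then 2 else 0 else 1)"
proof -
  let ?A = "(\<lambda>w. (w, h w)) ` K"
  have rule: "kernel_rule ?A \<kappa> w \<longleftrightarrow> (\<kappa> w = Red \<longleftrightarrow> \<kappa> (h w) \<noteq> Red)" if "w \<in> K" for \<kappa> w
    using that by (auto simp: kernel_rule_def)
  have A: "?A \<subseteq> K \<times> K" using monocyclicD(8)[OF cyc] by blast
  have ext: "\<exists>!c. c \<in> extensions K M ?A \<kappa>" if M: "M \<noteq> {}" "M \<subseteq> K" for M \<kappa>
  proof (rule unique_extension[OF fin A M(2)])
    show "\<exists>x\<in>W. \<forall>y\<in>W. (x, y) \<notin> ?A" if W: "W \<noteq> {}" "W \<subseteq> K - M" for W
    proof (rule ccontr)
      assume "\<not> (\<exists>x\<in>W. \<forall>y\<in>W. (x, y) \<notin> ?A)"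
      then have "h ` W \<subseteq> W" by auto
      then have "K \<subseteq> W" using monocyclic_subset_closed[OF cyc] W by blast
      then show False using W M by blast
    qed
  qed
  show ?thesis
  proof (cases "K \<subseteq> Q")
    case False
    have "{\<kappa> \<in> K \<rightarrow>\<^sub>E UNIV. \<forall>w\<in>K. \<kappa> w = Red \<longleftrightarrow> w \<in> Q \<and> \<kappa> (h w) \<noteq> Red} = extensions K (K - Q) ?A (\<lambda>_. Green)"
      unfolding extensions_def using rule by (auto simp: not_Red_iff[symmetric])
    moreover have "card (extensions K (K - Q) ?A (\<lambda>_. Green)) = 1"
      by (rule ex1_card, rule ext) (use False in blast)+
    ultimately show ?thesis using False by simp
  next
    case True
    obtain x where x: "x \<in> K" using monocyclicD(1)[OF cyc] by blast
    let ?E = "\<lambda>b. extensions K {x} ?A (\<lambda>_. b)"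
    have k: "card K > 0" using fin x card_gt_0_iff by blast
    note enum = orbit_enumerates[OF fin monocyclicD(4,5)[OF cyc] x]
    have close: "(h ^^ card K) x = x" by (rule funpow_card_cycle[OF fin monocyclicD(4,5)[OF cyc] x])
    \<comment> \<open>Fix the color at \<open>x\<close> and drop the rule there: the extension is
      unique, and the dropped rule is satisfied on returning to \<open>x\<close> exactly when the
      length is even.\<close>
    have ring: "kernel_rule ?A c x \<longleftrightarrow> even (card K)" if c: "c \<in> ?E b" for c b
    proof -
      have alt: "c ((h ^^ i) x) = Red \<longleftrightarrow> c (h ((h ^^ i) x)) \<noteq> Red" if "0 < i" "i < card K" for i
      proof -
        have "(h ^^ i) x \<in> K" by (rule funpow_closed[OF monocyclicD(4)[OF cyc] x])
        moreover have "(h ^^ i) x \<noteq> (h ^^ 0) x"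
          using enum(1) that by (metis inj_onD lessThan_iff less_irrefl order_less_trans)
        ultimately have "kernel_rule ?A c ((h ^^ i) x)" using c by (simp add: extensions_def)
        then show ?thesis using rule[OF \<open>(h ^^ i) x \<in> K\<close>] by blast
      qed
      have "c x = Red \<longleftrightarrow> (if odd (card K) then c (h x) = Red else c (h x) \<noteq> Red)"
        using funpow_alternating[of "card K" c h x "card K", OF alt k order_refl] close by simp
      then show ?thesis unfolding rule[OF x] by auto
    qed
    have "{\<kappa> \<in> K \<rightarrow>\<^sub>E UNIV. \<forall>w\<in>K. \<kappa> w = Red \<longleftrightarrow> w \<in> Q \<and> \<kappa> (h w) \<noteq> Red} =
        {c \<in> ?E Red \<union> ?E Green. kernel_rule ?A c x}"
    proof (intro set_eqI)
      fix c
      have "(\<forall>w\<in>K. c w = Red \<longleftrightarrow> w \<in> Q \<and> c (h w) \<noteq> Red) \<longleftrightarrow> (\<forall>w\<in>K. kernel_rule ?A c w)"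
        using True rule by blast
      moreover have "(\<forall>w\<in>K. kernel_rule ?A c w) \<longleftrightarrow> kernel_rule ?A c x \<and> (\<forall>w\<in>K - {x}. kernel_rule ?A c w)"
        using x by blast
      moreover have "c x = Red \<or> c x = Green" by (cases "c x") simp_all
      ultimately show "c \<in> {\<kappa> \<in> K \<rightarrow>\<^sub>E UNIV. \<forall>w\<in>K. \<kappa> w = Red \<longleftrightarrow> w \<in> Q \<and> \<kappa> (h w) \<noteq> Red} \<longleftrightarrow>
          c \<in> {c \<in> ?E Red \<union> ?E Green. kernel_rule ?A c x}"
        unfolding extensions_def by blast
    qed
    also have "\<dots> = (if even (card K) then ?E Red \<union> ?E Green else {})"
      using ring by auto
    also have "card \<dots> = (if even (card K) then 2 else 0)"
    proof -
      have "card (?E b) = 1" for b by (rule ex1_card, rule ext) (use x in blast)+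
      then obtain c d where "?E Red = {c}" "?E Green = {d}" by (meson card_1_singletonE)
      moreover have "?E Red \<inter> ?E Green = {}" by (auto simp: extensions_def)
      ultimately show ?thesis by auto
    qed
    finally show ?thesis using True by simp
  qed
qed

section \<open>Directed cycles\<close>

text \<open>The vertices off the cycle that are children of their image; only through them do the
  hanging trees influence the cycle.\<close>

definition down_vertices :: "'a set \<Rightarrow> 'a set \<Rightarrow> ('a \<Rightarrow> 'a) \<Rightarrow> ('a \<Rightarrow> 'a \<times> 'a) \<Rightarrow> 'a set" where
  "down_vertices V K h arc = {v \<in> V - K. arc v = (h v, v)}"

text \<open>The coloring of the downward trees computed without the cycle arcs. A vertex of
  \<open>K\<close> outside \<open>Q\<close> has a red child in a hanging tree and is forced
  green.\<close>

definition red_set :: "'a set \<Rightarrow> 'a set \<Rightarrow> ('a \<Rightarrow> 'a) \<Rightarrow> 'a set \<Rightarrow> bool" where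
  "red_set K L h Q \<longleftrightarrow> (\<forall>v\<in>K \<union> L. v \<in> Q \<longleftrightarrow> \<not> (\<exists>u\<in>L. h u = v \<and> u \<in> Q))"

lemma children_cover_cycle:
  assumes "finite V" "owns V h arc" "monocyclic V K h" "W \<noteq> {}" "W \<subseteq> V" "B \<subseteq> arc ` V"
    and "\<And>x. x \<in> W \<Longrightarrow> \<exists>y\<in>W. (x, y) \<in> B"
  shows "K \<subseteq> W" "arc ` K \<subseteq> B"
proof -
  note closed = children_closed[OF assms(1,2,5,6,7)]
  show "K \<subseteq> W" by (rule monocyclic_subset_closed[OF assms(3,5,4) closed(1)])
  then show "arc ` K \<subseteq> B" using closed(2) by (meson image_mono subset_trans)
qed

text \<open>\<open>Q\<close> is the kernel of the digraph of downward arcs alone. It is acyclic: a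
  set without sinks would need the arcs of \<open>K\<close>, whose owners are not in
  \<open>L\<close>.\<close>

lemma red_set_exists:
  assumes fin: "finite V" and own: "owns V h arc" and cyc: "monocyclic V K h"
  shows "\<exists>Q. red_set K (down_vertices V K h arc) h Q"
proof -
  define L where "L = down_vertices V K h arc"
  define A where "A = (\<lambda>u. (h u, u)) ` L"
  have L: "u \<in> V" "u \<notin> K" "arc u = (h u, u)" if "u \<in> L" for u
    using that by (simp_all add: L_def down_vertices_def)
  have A_iff: "(v, u) \<in> A \<longleftrightarrow> u \<in> L \<and> h u = v" for u v by (auto simp: A_def)
  have AV: "A \<subseteq> V \<times> V"
  proof
    fix e assume "e \<in> A"
    then obtain u where "u \<in> L" "e = (h u, u)" by (auto simp: A_def)
    then show "e \<in> V \<times> V" using L(1) monocyclicD(7)[OF cyc] by simp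
  qed
  have A_arcs: "A \<subseteq> arc ` V"
  proof
    fix e assume "e \<in> A"
    then obtain u where "u \<in> L" "e = (h u, u)" by (auto simp: A_def)
    then show "e \<in> arc ` V" using L by (metis imageI)
  qed
  have "\<exists>!c. c \<in> extensions V {} A (\<lambda>_. Red)"
  proof (rule unique_extension[OF fin AV empty_subsetI])
    show "\<exists>x\<in>W. \<forall>y\<in>W. (x, y) \<notin> A" if W: "W \<noteq> {}" "W \<subseteq> V - {}" for W
    proof (rule ccontr)
      assume "\<not> (\<exists>x\<in>W. \<forall>y\<in>W. (x, y) \<notin> A)"
      then have ch: "\<And>x. x \<in> W \<Longrightarrow> \<exists>y\<in>W. (x, y) \<in> A" by blast
      have WV: "W \<subseteq> V" using W(2) by blast
      have KA: "arc ` K \<subseteq> A" by (rule children_cover_cycle(2)[OF fin own cyc W(1) WV A_arcs ch])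
      obtain x where x: "x \<in> K" using monocyclicD(1)[OF cyc] by blast
      have "arc x \<in> A" by (rule subsetD[OF KA imageI[OF x]])
      then obtain u where u: "u \<in> L" "arc x = arc u" using L(3) by (auto simp: A_def)
      have "inj_on arc V" using own by (simp add: owns_def)
      then have "x = u" by (rule inj_onD[OF _ u(2) monocyclicD(9)[OF cyc x] L(1)[OF u(1)]])
      then show False using L(2)[OF u(1)] x by blast
    qed
  qed
  then obtain c where "c \<in> extensions V {} A (\<lambda>_. Red)" by blast
  then have rule: "kernel_rule A c v" if "v \<in> V" for v using that by (simp add: extensions_def)
  have "red_set K L h {v. c v = Red}"
    unfolding red_set_def
  proof
    fix v assume "v \<in> K \<union> L"
    then have "v \<in> V" using L(1) monocyclicD(9)[OF cyc] by blast
    then show "v \<in> {v. c v = Red} \<longleftrightarrow> \<not> (\<exists>u\<in>L. h u = v \<and> u \<in> {v. c v = Red})"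
      using rule[of v] unfolding kernel_rule_def A_iff by blast
  qed
  then show ?thesis unfolding L_def by blast
qed

text \<open>The arc owned by a vertex of \<open>L\<close> enters it, so all children of that vertex
  lie in \<open>L\<close>. A vertex of \<open>K\<close> has its successor as one further
  child.\<close>

lemma directed_cycle_children:
  assumes own: "owns V h arc" and cyc: "monocyclic V K h" and card: "card K \<ge> 2"
    and fwd: "\<forall>v\<in>K. arc v = (v, h v)"
  defines "L \<equiv> down_vertices V K h arc"
  shows "v \<in> L \<Longrightarrow> (v, y) \<in> arc ` V \<longleftrightarrow> y \<in> L \<and> h y = v"
    and "v \<in> K \<Longrightarrow> (v, y) \<in> arc ` V \<longleftrightarrow> y = h v \<or> y \<in> L \<and> h y = v"
proof -
  have L_iff: "u \<in> L \<longleftrightarrow> u \<in> V \<and> u \<notin> K \<and> arc u = (h u, u)" for u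
    by (auto simp: L_def down_vertices_def)
  note nofix = monocyclic_no_fixpoint[OF cyc card]
  have arcD: "v \<in> V \<and> arc v = (v, y) \<and> h v = y \<or> y \<in> V \<and> arc y = (h y, y) \<and> h y = v"
    if "(v, y) \<in> arc ` V" for v y
  proof -
    from that obtain u where u: "(v, y) = arc u" "u \<in> V" by (rule imageE)
    from owns_arc[OF own u(2)] show ?thesis
    proof
      assume e: "arc u = (u, h u)"
      then have "u = v" "h u = y" using u(1) by simp_all
      then show ?thesis using e u(2) by blast
    next
      assume e: "arc u = (h u, u)"
      then have "u = y" "h u = v" using u(1) by simp_all
      then show ?thesis using e u(2) by blast
    qed
  qed
  have arcI: "(h y, y) \<in> arc ` V" if y: "y \<in> L" for y
  proof -
    have *: "arc y = (h y, y)" "y \<in> V" using y by (simp_all only: L_iff)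
    show ?thesis unfolding *(1)[symmetric] by (rule imageI[OF *(2)])
  qed
  show "(v, y) \<in> arc ` V \<longleftrightarrow> y \<in> L \<and> h y = v" if v: "v \<in> L" for v y
  proof
    assume "(v, y) \<in> arc ` V"
    from arcD[OF this] show "y \<in> L \<and> h y = v"
    proof
      assume "v \<in> V \<and> arc v = (v, y) \<and> h v = y"
      then have "v \<in> V" and "fst (arc v) = v" by simp_all
      moreover have "fst (arc v) = h v" using v by (simp only: L_iff fst_conv)
      ultimately show ?thesis using nofix[of v] by (simp only: not_True_eq_False)
    next
      assume y: "y \<in> V \<and> arc y = (h y, y) \<and> h y = v"
      then have "y \<notin> K" using v L_iff[of v] monocyclicD(8)[OF cyc, of y] by metis
      then show ?thesis using y L_iff[of y] by simp
    qed
  next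
    assume "y \<in> L \<and> h y = v"
    then show "(v, y) \<in> arc ` V" using arcI by blast
  qed
  show "(v, y) \<in> arc ` V \<longleftrightarrow> y = h v \<or> y \<in> L \<and> h y = v" if v: "v \<in> K" for v y
  proof
    assume "(v, y) \<in> arc ` V"
    from arcD[OF this] show "y = h v \<or> y \<in> L \<and> h y = v"
    proof
      assume y: "y \<in> V \<and> arc y = (h y, y) \<and> h y = v"
      have "y \<notin> K"
      proof
        assume "y \<in> K"
        then have "arc y = (y, h y)" using fwd by blast
        then have "fst (arc y) = y" by simp
        moreover have "fst (arc y) = h y" using y by simp
        ultimately show False using nofix[of y] y by metis
      qed
      then show ?thesis using y L_iff[of y] by simp
    qed blast
  next
    assume y: "y = h v \<or> y \<in> L \<and> h y = v"
    have "(v, h v) \<in> arc ` V"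
      unfolding bspec[OF fwd v, symmetric] by (rule imageI[OF monocyclicD(9)[OF cyc v]])
    moreover have "(v, y) \<in> arc ` V" if "y \<in> L" "h y = v" using arcI[OF that(1)] that(2) by simp
    ultimately show "(v, y) \<in> arc ` V" using y by metis
  qed
qed

text \<open>Colors on \<open>L\<close> do not depend on the cycle and agree with \<open>Q\<close>,
  so the rule on \<open>K\<close> becomes the ring rule. The remaining vertices are no children of
  \<open>K\<close> or \<open>L\<close>; their colors follow by unique extension. Hence restriction
  to \<open>K\<close> is a bijection onto the ring colorings.\<close>

lemma card_well_colorings_directed:
  assumes fin: "finite V" and own: "owns V h arc" and cyc: "monocyclic V K h" and card: "card K \<ge> 2"
    and fwd: "\<forall>v\<in>K. arc v = (v, h v)" and Q: "red_set K (down_vertices V K h arc) h Q"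
  shows "card {c. well_coloring (digraph_of V arc) c} = (if K \<subseteq> Q then if even (card K) then 2 else 0 else 1)"
proof -
  define L where "L = down_vertices V K h arc"
  define A where "A = arc ` V"
  have A_eq: "arc ` V - Id = A" unfolding A_def by (rule owns_no_loops[OF own cyc card])
  note ch = directed_cycle_children[OF own cyc card fwd, folded L_def A_def]
  have LV: "L \<subseteq> V" and LK: "L \<inter> K = {}" by (auto simp: L_def down_vertices_def)
  have KV: "K \<subseteq> V" by (rule monocyclicD(2)[OF cyc])
  have Q_iff: "v \<in> Q \<longleftrightarrow> \<not> (\<exists>u\<in>L. h u = v \<and> u \<in> Q)" if "v \<in> K \<union> L" for v
    using Q that by (simp only: red_set_def L_def[symmetric])
  have agree: "c u = Red \<longleftrightarrow> u \<in> Q" if c: "\<And>v. v \<in> V - K \<Longrightarrow> kernel_rule A c v" and u: "u \<in> L" for c u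
  proof (rule ccontr)
    assume nu: "\<not> (c u = Red \<longleftrightarrow> u \<in> Q)"
    \<comment> \<open>Where a coloring disagrees with \<open>Q\<close>, it disagrees at some child
      in \<open>L\<close> as well; such a set would have to contain \<open>K\<close>.\<close>
    define W where "W = {u \<in> L. \<not> (c u = Red \<longleftrightarrow> u \<in> Q)}"
    have WL: "W \<subseteq> L" and uW: "u \<in> W" using u nu by (auto simp: W_def)
    have "\<exists>y\<in>W. (x, y) \<in> A" if x: "x \<in> W" for x
    proof (rule ccontr)
      assume no: "\<not> (\<exists>y\<in>W. (x, y) \<in> A)"
      have xL: "x \<in> L" using x WL by blast
      then have "x \<in> V - K" using LV LK by blast
      then have "kernel_rule A c x" by (rule c)
      then have "c x = Red \<longleftrightarrow> \<not> (\<exists>y. (y \<in> L \<and> h y = x) \<and> c y = Red)"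
        unfolding kernel_rule_def ch(1)[OF xL] .
      moreover have "c y = Red \<longleftrightarrow> y \<in> Q" if "y \<in> L" "h y = x" for y
        using no that ch(1)[OF xL, of y] unfolding W_def by blast
      ultimately have "c x = Red \<longleftrightarrow> x \<in> Q" using Q_iff[of x] xL by blast
      then show False using x by (simp add: W_def)
    qed
    then have ch': "\<And>x. x \<in> W \<Longrightarrow> \<exists>y\<in>W. (x, y) \<in> arc ` V" unfolding A_def .
    have "W \<noteq> {}" "W \<subseteq> V" using uW WL LV by blast+
    then have "K \<subseteq> W" by (rule children_cover_cycle(1)[OF fin own cyc _ _ order_refl ch'])
    then show False using WL LK monocyclicD(1)[OF cyc] by blast
  qed
  have ring: "kernel_rule A c w \<longleftrightarrow> (c w = Red \<longleftrightarrow> w \<in> Q \<and> c (h w) \<noteq> Red)"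
    if c: "\<And>v. v \<in> V - K \<Longrightarrow> kernel_rule A c v" and w: "w \<in> K" for c w
  proof -
    have "kernel_rule A c w \<longleftrightarrow> (c w = Red \<longleftrightarrow> \<not> (\<exists>y. (y = h w \<or> y \<in> L \<and> h y = w) \<and> c y = Red))"
      unfolding kernel_rule_def ch(2)[OF w] ..
    moreover have "(\<exists>y. (y = h w \<or> y \<in> L \<and> h y = w) \<and> c y = Red) \<longleftrightarrow>
        c (h w) = Red \<or> (\<exists>y\<in>L. h y = w \<and> c y = Red)"
      by blast
    moreover have "(\<exists>y\<in>L. h y = w \<and> c y = Red) \<longleftrightarrow> (\<exists>y\<in>L. h y = w \<and> y \<in> Q)"
      by (rule bex_cong[OF refl]) (simp only: agree[OF c])
    moreover have "w \<in> Q \<longleftrightarrow> \<not> (\<exists>u\<in>L. h u = w \<and> u \<in> Q)"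
      by (rule Q_iff) (use w in blast)
    ultimately show ?thesis by blast
  qed
  have ext: "\<exists>!c. c \<in> extensions V K A \<kappa>" for \<kappa>
    using unique_extension_off_cycle[OF fin own cyc, of \<kappa>] unfolding A_eq .
  have wc: "well_coloring (digraph_of V arc) c \<longleftrightarrow> c \<in> V \<rightarrow>\<^sub>E UNIV \<and> (\<forall>v\<in>V. kernel_rule A c v)" for c
    by (simp only: well_coloring_iff digraph_of_simps A_eq)
  let ?R = "{\<kappa> \<in> K \<rightarrow>\<^sub>E UNIV. \<forall>w\<in>K. \<kappa> w = Red \<longleftrightarrow> w \<in> Q \<and> \<kappa> (h w) \<noteq> Red}"
  have "bij_betw (\<lambda>c. restrict c K) {c. well_coloring (digraph_of V arc) c} ?R"
  proof (rule bij_betw_imageI)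
    show "inj_on (\<lambda>c. restrict c K) {c. well_coloring (digraph_of V arc) c}"
    proof (rule inj_onI)
      fix c d assume c: "c \<in> {c. well_coloring (digraph_of V arc) c}"
        and d: "d \<in> {c. well_coloring (digraph_of V arc) c}" and eq: "restrict c K = restrict d K"
      have "\<forall>v\<in>K. c v = d v" using eq by (metis restrict_apply')
      then have "c \<in> extensions V K A d" "d \<in> extensions V K A d"
        using c d KV by (simp_all add: wc extensions_def)
      then show "c = d" using ext[of d] by blast
    qed
    show "(\<lambda>c. restrict c K) ` {c. well_coloring (digraph_of V arc) c} = ?R"
    proof
      show "(\<lambda>c. restrict c K) ` {c. well_coloring (digraph_of V arc) c} \<subseteq> ?R"
      proof (rule image_subsetI)
        fix c assume "c \<in> {c. well_coloring (digraph_of V arc) c}"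
        then have c: "\<And>v. v \<in> V \<Longrightarrow> kernel_rule A c v" by (simp add: wc)
        have off: "\<And>v. v \<in> V - K \<Longrightarrow> kernel_rule A c v" by (rule c) (rule DiffD1)
        have "c w = Red \<longleftrightarrow> w \<in> Q \<and> c (h w) \<noteq> Red" if w: "w \<in> K" for w
          using c[OF subsetD[OF KV w]] by (simp only: ring[OF off w])
        then have "(restrict c K w = Red) = (w \<in> Q \<and> restrict c K (h w) \<noteq> Red)" if w: "w \<in> K" for w
          by (simp only: restrict_apply' w monocyclicD(8)[OF cyc w])
        then show "restrict c K \<in> ?R" by simp
      qed
      show "?R \<subseteq> (\<lambda>c. restrict c K) ` {c. well_coloring (digraph_of V arc) c}"
      proof
        fix \<kappa> assume \<kappa>: "\<kappa> \<in> ?R"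
        obtain c where c: "c \<in> extensions V K A \<kappa>" using ext[of \<kappa>] by blast
        then have off: "\<And>v. v \<in> V - K \<Longrightarrow> kernel_rule A c v" and cK: "\<And>v. v \<in> K \<Longrightarrow> c v = \<kappa> v"
          and cV: "c \<in> V \<rightarrow>\<^sub>E UNIV" by (simp_all add: extensions_def)
        have "kernel_rule A c w" if w: "w \<in> K" for w
        proof -
          have "c w = Red \<longleftrightarrow> w \<in> Q \<and> c (h w) \<noteq> Red"
            using \<kappa> cK[OF w] cK[OF monocyclicD(8)[OF cyc w]] w by simp
          then show ?thesis by (simp only: ring[OF off w])
        qed
        then have "well_coloring (digraph_of V arc) c" using off cV by (simp add: wc) blast
        moreover have "restrict c K = \<kappa>"
        proof (rule PiE_ext)
          show "restrict c K \<in> K \<rightarrow>\<^sub>E UNIV" "\<kappa> \<in> K \<rightarrow>\<^sub>E UNIV" using \<kappa> by simp_all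
        qed (simp add: cK)
        ultimately show "\<kappa> \<in> (\<lambda>c. restrict c K) ` {c. well_coloring (digraph_of V arc) c}" by blast
      qed
    qed
  qed
  then have "card {c. well_coloring (digraph_of V arc) c} = card ?R" by (rule bij_betw_same_card)
  moreover have "monocyclic K K h"
    by (rule monocyclicI[OF monocyclicD(1)[OF cyc] order_refl monocyclicD(4,4,5)[OF cyc]])
      (assumption | rule leads.here)+
  then have "card ?R = (if K \<subseteq> Q then if even (card K) then 2 else 0 else 1)"
    by (rule card_ring_colorings[OF finite_subset[OF KV fin]])
  ultimately show ?thesis by (simp only:)
qed

text \<open>Adding or removing a vertex \<open>u\<close> that nothing maps to cancels all closed sets containing
  \<open>h u\<close>, whose vertex is not red because \<open>u\<close> is.\<close>

lemma signed_closed_sets: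
  fixes h :: "'a \<Rightarrow> 'a"
  assumes "finite L" "K \<inter> L = {}" "red_set K L h Q"
    and "\<And>W. W \<noteq> {} \<Longrightarrow> W \<subseteq> L \<Longrightarrow> \<exists>u\<in>W. \<forall>u'\<in>W. h u' \<noteq> u"
  shows "(\<Sum>Y | Y \<subseteq> L \<and> h ` Y \<subseteq> K \<union> Y. (-1) ^ card Y) = (if K \<subseteq> Q then 1 else 0 :: real)"
  using assms
proof (induction "card L" arbitrary: L Q rule: less_induct)
  case less
  note fin = less.prems(1) and KL = less.prems(2) and rs = less.prems(3)
  show ?case
  proof (cases "L = {}")
    case True
    then have "{Y. Y \<subseteq> L \<and> h ` Y \<subseteq> K \<union> Y} = {{}}" by auto
    moreover have "K \<subseteq> Q" using rs True by (auto simp: red_set_def)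
    ultimately show ?thesis by simp
  next
    case False
    then obtain u where u: "u \<in> L" "\<forall>u'\<in>L. h u' \<noteq> u" using less.prems(4)[of L] by blast
    define p where "p = h u"
    have up: "p \<noteq> u" using u by (auto simp: p_def)
    have uK: "u \<notin> K" using u KL by blast
    have uQ: "u \<in> Q" using rs u by (auto simp: red_set_def)
    \<comment> \<open>\<open>u\<close> is a leaf, hence in \<open>Q\<close>, so its image
      \<open>p\<close> cannot be in \<open>Q\<close>.\<close>
    have pQ: "p \<notin> Q" if "p \<in> K \<union> L" using rs that u(1) uQ unfolding red_set_def p_def by blast
    define G where "G L = {Y. Y \<subseteq> L \<and> h ` Y \<subseteq> K \<union> Y}" for L
    have finG: "finite (G L)" if "finite L" for L
      by (rule finite_subset[of _ "Pow L"]) (use that in \<open>auto simp: G_def\<close>)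
    let ?s = "\<lambda>Y :: 'a set. (-1) ^ card Y :: real"
    define G0 where "G0 = {Y \<in> G L. p \<in> K \<union> Y \<and> u \<notin> Y}"
    define G1 where "G1 = {Y \<in> G L. p \<in> K \<union> Y \<and> u \<in> Y}"
    define G2 where "G2 = {Y \<in> G L. p \<notin> K \<union> Y}"
    have split: "G L = (G0 \<union> G1) \<union> G2" "(G0 \<union> G1) \<inter> G2 = {}" "G0 \<inter> G1 = {}"
      by (auto simp: G0_def G1_def G2_def)
    have fins: "finite G0" "finite G1" "finite G2"
      using finG[OF fin] by (auto simp: G0_def G1_def G2_def)
    have img: "G1 = insert u ` G0"
    proof
      show "G1 \<subseteq> insert u ` G0"
      proof
        fix Y assume "Y \<in> G1"
        then have Y: "Y \<subseteq> L" "h ` Y \<subseteq> K \<union> Y" "p \<in> K \<union> Y" "u \<in> Y" by (auto simp: G1_def G_def)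
        have "h ` (Y - {u}) \<subseteq> K \<union> (Y - {u})"
        proof (rule image_subsetI)
          fix y assume y: "y \<in> Y - {u}"
          then have "h y \<noteq> u" using u(2) Y(1) by blast
          moreover have "h y \<in> K \<union> Y" by (rule subsetD[OF Y(2) imageI]) (use y in blast)
          ultimately show "h y \<in> K \<union> (Y - {u})" by blast
        qed
        then have "Y - {u} \<in> G0" using Y up by (auto simp: G0_def G_def)
        moreover have "Y = insert u (Y - {u})" using Y(4) by blast
        ultimately show "Y \<in> insert u ` G0" by (rule rev_image_eqI)
      qed
      show "insert u ` G0 \<subseteq> G1"
      proof (rule image_subsetI)
        fix Y assume "Y \<in> G0"
        then have Y: "Y \<subseteq> L" "h ` Y \<subseteq> K \<union> Y" "p \<in> K \<union> Y" by (auto simp: G0_def G_def)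
        then have "h ` insert u Y \<subseteq> K \<union> insert u Y" using p_def by auto
        then show "insert u Y \<in> G1" using Y u(1) by (auto simp: G1_def G_def)
      qed
    qed
    have "inj_on (insert u) G0" by (rule inj_onI) (auto simp: G0_def)
    then have "sum ?s G1 = (\<Sum>Y\<in>G0. ?s (insert u Y))"
      unfolding img by (simp add: sum.reindex)
    also have "\<dots> = (\<Sum>Y\<in>G0. - ?s Y)"
    proof (rule sum.cong[OF refl])
      fix Y assume "Y \<in> G0"
      then have "u \<notin> Y" "finite Y" using fin finite_subset[of Y L] by (auto simp: G0_def G_def)
      then show "?s (insert u Y) = - ?s Y" by simp
    qed
    finally have cancel: "sum ?s G0 + sum ?s G1 = 0" by (simp add: sum_negf)
    have "sum ?s (G L) = (sum ?s G0 + sum ?s G1) + sum ?s G2"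
      unfolding split(1) using fins split(2,3) by (simp add: sum.union_disjoint)
    then have total: "sum ?s (G L) = sum ?s G2" using cancel by simp
    show ?thesis
    proof (cases "p \<in> K")
      case True
      then have "G2 = {}" by (auto simp: G2_def)
      moreover have "\<not> K \<subseteq> Q" using pQ True by blast
      ultimately show ?thesis using total by (simp add: G_def)
    next
      case False
      \<comment> \<open>The surviving closed sets avoid \<open>p\<close>, hence also
        \<open>u\<close>. Deleting both keeps \<open>Q\<close> valid: \<open>u\<close> acts on
        \<open>p\<close> only, and \<open>p\<close>, if it is in \<open>L\<close>, is not in
        \<open>Q\<close> and acts on no one.\<close>
      define L' where "L' = L - {u, p}"
      have G2: "G2 = G L'"
      proof
        show "G2 \<subseteq> G L'"
        proof
          fix Y assume "Y \<in> G2"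
          then have Y: "Y \<subseteq> L" "h ` Y \<subseteq> K \<union> Y" "p \<notin> K \<union> Y" by (auto simp: G2_def G_def)
          then have "u \<notin> Y" using p_def by blast
          then show "Y \<in> G L'" using Y by (auto simp: G_def L'_def)
        qed
        show "G L' \<subseteq> G2" using False by (auto simp: G_def G2_def L'_def)
      qed
      have "red_set K L' h Q"
        unfolding red_set_def
      proof
        fix v assume v: "v \<in> K \<union> L'"
        have "v \<noteq> p" using v False by (auto simp: L'_def)
        moreover have "p \<notin> L \<or> p \<notin> Q" using pQ by blast
        ultimately have "(\<exists>u'\<in>L'. h u' = v \<and> u' \<in> Q) \<longleftrightarrow> (\<exists>u'\<in>L. h u' = v \<and> u' \<in> Q)"
          unfolding L'_def p_def by blast
        moreover have "v \<in> K \<union> L" using v by (auto simp: L'_def)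
        ultimately show "v \<in> Q \<longleftrightarrow> \<not> (\<exists>u'\<in>L'. h u' = v \<and> u' \<in> Q)"
          using rs unfolding red_set_def by simp
      qed
      moreover have "card L' < card L" using u(1) fin by (intro psubset_card_mono) (auto simp: L'_def)
      moreover have "finite L'" "K \<inter> L' = {}" using fin KL by (auto simp: L'_def)
      moreover have "\<exists>u\<in>W. \<forall>u'\<in>W. h u' \<noteq> u" if "W \<noteq> {}" "W \<subseteq> L'" for W
        by (rule less.prems(4)[OF that(1)]) (use that(2) in \<open>auto simp: L'_def\<close>)
      ultimately have "sum ?s (G L') = (if K \<subseteq> Q then 1 else 0)"
        unfolding G_def by (intro less.hyps)
      then show ?thesis using total G2 by (simp add: G_def)
    qed
  qed
qed

section \<open>Counting\<close>

definition arc_choices :: "'a set \<Rightarrow> ('a \<Rightarrow> 'a) \<Rightarrow> ('a \<Rightarrow> 'a \<times> 'a) set" where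
  "arc_choices V h = (\<Pi>\<^sub>E v\<in>V. {(v, h v), (h v, v)})"

definition structures :: "'a set \<Rightarrow> 'a set \<Rightarrow> (('a \<Rightarrow> 'a) \<times> ('a \<Rightarrow> 'a \<times> 'a)) set" where
  "structures V K = (SIGMA h:cyclic_maps V K. {arc \<in> arc_choices V h. inj_on arc V})"

lemma finite_arc_choices [intro]: "finite V \<Longrightarrow> finite (arc_choices V h)"
  unfolding arc_choices_def by (rule finite_PiE) simp_all

lemma finite_structures: "finite V \<Longrightarrow> finite (structures V K)"
  unfolding structures_def by (intro finite_SigmaI finite_cyclic_maps) (simp_all add: finite_arc_choices)

lemma structuresD:
  assumes "(h, arc) \<in> structures V K" "K \<noteq> {}" "K \<subseteq> V"
  shows "owns V h arc" "monocyclic V K h" "h \<in> V \<rightarrow>\<^sub>E V" "arc \<in> V \<rightarrow>\<^sub>E UNIV"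
proof -
  have h: "h \<in> cyclic_maps V K" and arc: "arc \<in> arc_choices V h" "inj_on arc V"
    using assms(1) by (simp_all add: structures_def)
  show "monocyclic V K h" "h \<in> V \<rightarrow>\<^sub>E V"
    using h cyclic_maps_iff_monocyclic[OF assms(2,3)] by blast+
  show "owns V h arc"
    using arc by (simp add: owns_def arc_choices_def PiE_iff)
  show "arc \<in> V \<rightarrow>\<^sub>E UNIV"
    using arc(1) by (simp add: arc_choices_def PiE_iff)
qed

lemma structuresI:
  assumes "owns V h arc" "monocyclic V K h"
  shows "(restrict h V, restrict arc V) \<in> structures V K"
proof -
  note KV = monocyclicD(1,2)[OF assms(2)]
  have "(restrict h V ^^ i) x = (h ^^ i) x" if "x \<in> K" for x i
    by (rule sym, rule funpow_eqI[OF _ monocyclicD(4)[OF assms(2)] that]) (simp add: subsetD[OF KV(2)])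
  then have trans: "\<exists>i. (restrict h V ^^ i) x = y" if "x \<in> K" "y \<in> K" for x y
    using monocyclicD(5)[OF assms(2) that] that(1) by simp
  have maps: "restrict h V v \<in> V" if "v \<in> V" for v using monocyclicD(7)[OF assms(2)] that by simp
  have mapsK: "restrict h V v \<in> K" if "v \<in> K" for v
    using monocyclicD(8)[OF assms(2)] that subsetD[OF KV(2)] by simp
  have "leads (restrict h V) K v" if "v \<in> V" for v
    by (rule leads_transfer[OF monocyclicD(6)[OF assms(2) that] that])
      (use monocyclicD(7)[OF assms(2)] in simp, rule leads.here)
  then have "monocyclic V K (restrict h V)"
    by (intro monocyclicI KV trans image_subsetI maps mapsK)
  then have 1: "restrict h V \<in> cyclic_maps V K"
    using cyclic_maps_iff_monocyclic[OF KV] maps by simp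
  have 2: "restrict arc V \<in> arc_choices V (restrict h V)"
    unfolding arc_choices_def using owns_arc[OF assms(1)] by (simp add: PiE_iff)
  have 3: "inj_on (restrict arc V) V" using assms(1) by (simp add: owns_def)
  show ?thesis using 1 2 3 by (simp add: structures_def)
qed

lemma digraph_of_restrict: "digraph_of V (restrict arc V) = digraph_of V arc"
  by (simp add: digraph_of_def)

text \<open>Two vertices can choose the same arc only if \<open>h\<close> exchanges them.
  Injectivity is thus an issue only for a cycle of length 2.\<close>

lemma arc_choices_collision:
  assumes "monocyclic V K h" "arc \<in> arc_choices V h" "u \<in> V" "v \<in> V" "arc u = arc v" "u \<noteq> v"
  shows "h u = v" "h v = u" "K = {u, v}"
proof -
  have c: "arc w = (w, h w) \<or> arc w = (h w, w)" if "w \<in> V" for w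
    using assms(2) that by (simp add: arc_choices_def PiE_iff)
  from c[OF assms(3)] c[OF assms(4)] assms(5,6) show uv: "h u = v" "h v = u" by auto
  have "K \<subseteq> {u, v}"
    by (rule monocyclic_subset_closed[OF assms(1)]) (use assms(3,4) uv in simp_all)
  moreover have "(h ^^ Suc 1) u = u" "(h ^^ Suc 1) v = v" using uv by simp_all
  then have "u \<in> K" "v \<in> K"
    using monocyclic_periodic[OF assms(1,3)] monocyclic_periodic[OF assms(1,4)] by blast+
  ultimately show "K = {u, v}" by blast
qed

lemma card_arc_choices:
  assumes "finite V" "W \<subseteq> V" "\<And>v. v \<in> W \<Longrightarrow> h v \<noteq> v" "\<And>v. v \<in> V - W \<Longrightarrow> card (S v) = 1"
  shows "card (\<Pi>\<^sub>E v\<in>V. if v \<in> W then {(v, h v), (h v, v)} else S v) = 2 ^ card W"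
proof -
  have "card (\<Pi>\<^sub>E v\<in>V. if v \<in> W then {(v, h v), (h v, v)} else S v)
      = (\<Prod>v\<in>V. card (if v \<in> W then {(v, h v), (h v, v)} else S v))"
    by (rule card_PiE[OF assms(1)])
  also have "\<dots> = (\<Prod>v\<in>V. if v \<in> W then 2 else 1)"
  proof (rule prod.cong[OF refl])
    fix v assume v: "v \<in> V"
    show "card (if v \<in> W then {(v, h v), (h v, v)} else S v) = (if v \<in> W then 2 else 1)"
    proof (cases "v \<in> W")
      case True
      then have "(v, h v) \<noteq> (h v, v)" using assms(3) by simp
      then show ?thesis using True by simp
    next
      case False
      then show ?thesis using assms(4)[of v] v by simp
    qed
  qed
  also have "\<dots> = 2 ^ card W"
    using assms(1,2) by (simp add: prod.If_cases Int_absorb1)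
  finally show ?thesis .
qed

text \<open>For a cycle of length at least 3 all orientations are injective. For length 2 the two
  cycle arcs must be opposite, which keeps half of the choices. For length 1 the loop at the root
  has a single orientation.\<close>

lemma card_structures:
  assumes fin: "finite V" and K: "K \<subseteq> V" "K \<noteq> {}"
  shows "real (card (structures V K)) =
    fact (card K - 1) * rooted_forests (card V) (card K) *
      (if card K \<ge> 3 then 2 ^ card V else 2 ^ (card V - 1))"
proof -
  have finK: "finite K" using K(1) fin by (rule finite_subset)
  let ?p = "if card K \<ge> 3 then 2 ^ card V else 2 ^ (card V - 1) :: nat"
  have "card {arc \<in> arc_choices V h. inj_on arc V} = ?p" if h: "h \<in> cyclic_maps V K" for h
  proof -
    have cyc: "monocyclic V K h" using h cyclic_maps_iff_monocyclic[OF K(2,1)] by blast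
    consider "card K \<ge> 3" | "card K = 2" | "card K = 1"
      using finK K(2) card_gt_0_iff[of K] by linarith
    then show ?thesis
    proof cases
      case 1
      have "inj_on arc V" if "arc \<in> arc_choices V h" for arc
      proof (rule inj_onI, rule ccontr)
        fix u v assume "u \<in> V" "v \<in> V" "arc u = arc v" "u \<noteq> v"
        then have "K = {u, v}" by (rule arc_choices_collision(3)[OF cyc that])
        then show False using 1 card_insert_le_m1[of 2 "{v}" u] by simp
      qed
      then have "{arc \<in> arc_choices V h. inj_on arc V} = arc_choices V h" by blast
      also have "arc_choices V h = (\<Pi>\<^sub>E v\<in>V. if v \<in> V then {(v, h v), (h v, v)} else {})"
        unfolding arc_choices_def by (rule PiE_cong) simp
      also have "card \<dots> = 2 ^ card V"
      proof (rule card_arc_choices[OF fin order_refl])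
        have "card K \<ge> 2" using 1 by simp
        then show "h v \<noteq> v" if "v \<in> V" for v using monocyclic_no_fixpoint[OF cyc _ that] by blast
      qed simp
      finally show ?thesis using 1 by simp
    next
      case 2
      then obtain a b where ab: "K = {a, b}" "a \<noteq> b" by (auto simp: card_2_iff)
      have abV: "a \<in> V" "b \<in> V" using ab K(1) by auto
      note nofix = monocyclic_no_fixpoint[OF cyc eq_imp_le[OF 2[symmetric]]]
      have hab: "h a = b" "h b = a"
        using monocyclicD(8)[OF cyc, of a] monocyclicD(8)[OF cyc, of b] nofix[OF abV(1)] nofix[OF abV(2)] ab(1) by auto
      have inj_iff: "inj_on arc V \<longleftrightarrow> arc a \<noteq> arc b" if arc: "arc \<in> arc_choices V h" for arc
      proof
        assume "inj_on arc V"
        then show "arc a \<noteq> arc b" using abV ab(2) by (metis inj_onD)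
      next
        assume ne: "arc a \<noteq> arc b"
        show "inj_on arc V"
        proof (rule inj_onI, rule ccontr)
          fix u v assume uv: "u \<in> V" "v \<in> V" "arc u = arc v" "u \<noteq> v"
          then have "K = {u, v}" by (rule arc_choices_collision(3)[OF cyc arc])
          then have "u = a \<and> v = b \<or> u = b \<and> v = a" using ab(1) by (simp add: doubleton_eq_iff) blast
          then show False using ne uv(3) by metis
        qed
      qed
      have choice: "arc \<in> arc_choices V h \<longleftrightarrow> arc \<in> extensional V \<and> (\<forall>v\<in>V. arc v = (v, h v) \<or> arc v = (h v, v))" for arc
        by (simp add: arc_choices_def PiE_iff) blast
      have flip: "arc(b := prod.swap (arc b)) \<in> arc_choices V h" if "arc \<in> arc_choices V h" for arc
      proof -
        have "prod.swap (arc b) = (b, h b) \<or> prod.swap (arc b) = (h b, b)"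
          using that abV(2) by (simp only: choice) (metis swap_simp)
        moreover have "arc(b := prod.swap (arc b)) \<in> extensional V"
          using that abV(2) by (simp add: choice extensional_def)
        ultimately show ?thesis using that by (simp add: choice)
      qed
      have swap_ne: "(arc a \<noteq> prod.swap (arc b)) = (arc a = arc b)" if "arc \<in> arc_choices V h" for arc
      proof -
        have "arc a = (a, b) \<or> arc a = (b, a)" "arc b = (a, b) \<or> arc b = (b, a)"
          using that abV hab by (simp_all only: choice) metis+
        then show ?thesis using ab(2) by auto
      qed
      let ?I = "{arc \<in> arc_choices V h. arc a \<noteq> arc b}" and ?J = "{arc \<in> arc_choices V h. arc a = arc b}"
      \<comment> \<open>Turning the arc of \<open>b\<close> around exchanges equal and opposite
        cycle arcs, so exactly half of the choices are injective.\<close>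
      have "bij_betw (\<lambda>arc. arc(b := prod.swap (arc b))) ?I ?J"
      proof (rule bij_betw_byWitness[where f' = "\<lambda>arc. arc(b := prod.swap (arc b))"])
        show "(\<lambda>arc. arc(b := prod.swap (arc b))) ` ?I \<subseteq> ?J"
        proof (rule image_subsetI)
          fix arc assume "arc \<in> ?I"
          then show "arc(b := prod.swap (arc b)) \<in> ?J" using flip swap_ne[of arc] ab(2) by simp
        qed
        show "(\<lambda>arc. arc(b := prod.swap (arc b))) ` ?J \<subseteq> ?I"
        proof (rule image_subsetI)
          fix arc assume "arc \<in> ?J"
          then show "arc(b := prod.swap (arc b)) \<in> ?I" using flip swap_ne[of arc] ab(2) by simp
        qed
      qed simp_all
      then have "card ?I = card ?J" by (rule bij_betw_same_card)
      moreover have "card (arc_choices V h) = card ?I + card ?J"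
      proof -
        have "arc_choices V h = ?I \<union> ?J" by blast
        moreover have "card (?I \<union> ?J) = card ?I + card ?J"
          using fin by (intro card_Un_disjoint) (auto simp: finite_arc_choices)
        ultimately show ?thesis by simp
      qed
      moreover have "card (arc_choices V h) = 2 ^ card V"
      proof -
        have "arc_choices V h = (\<Pi>\<^sub>E v\<in>V. if v \<in> V then {(v, h v), (h v, v)} else {})"
          unfolding arc_choices_def by (rule PiE_cong) simp
        then show ?thesis using card_arc_choices[OF fin order_refl, of h] nofix by simp
      qed
      moreover have "card V > 0" using fin abV(1) card_gt_0_iff by blast
      then have "(2::nat) ^ card V = 2 * 2 ^ (card V - 1)" by (simp add: power_eq_if)
      ultimately have "card ?I = 2 ^ (card V - 1)" by linarith
      moreover have "{arc \<in> arc_choices V h. inj_on arc V} = ?I" using inj_iff by blast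
      ultimately show ?thesis using 2 by simp
    next
      case 3
      then obtain r where r: "K = {r}" by (auto simp: card_1_singleton_iff)
      have rV: "r \<in> V" "h r = r" using r K(1) monocyclicD(8)[OF cyc, of r] by auto
      have "inj_on arc V" if "arc \<in> arc_choices V h" for arc
      proof (rule inj_onI, rule ccontr)
        fix u v assume uv: "u \<in> V" "v \<in> V" "arc u = arc v" "u \<noteq> v"
        then have "K = {u, v}" by (rule arc_choices_collision(3)[OF cyc that])
        then show False using r uv(4) by auto
      qed
      then have "{arc \<in> arc_choices V h. inj_on arc V} = arc_choices V h" by blast
      also have "arc_choices V h = (\<Pi>\<^sub>E v\<in>V. if v \<in> V - {r} then {(v, h v), (h v, v)} else {(r, r)})"
        unfolding arc_choices_def by (rule PiE_cong) (simp add: rV(2))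
      also have "card \<dots> = 2 ^ card (V - {r})"
      proof (rule card_arc_choices[OF fin Diff_subset])
        show "h v \<noteq> v" if v: "v \<in> V - {r}" for v
        proof
          assume "h v = v"
          then have "K = {v}" by (rule monocyclic_fixpoint[OF cyc DiffD1[OF v]])
          then show False using r v by simp
        qed
      qed simp
      finally show ?thesis using 3 rV(1) fin by simp
    qed
  qed
  then have "card (structures V K) = (\<Sum>h\<in>cyclic_maps V K. ?p)"
    unfolding structures_def using fin by (simp add: card_SigmaI finite_cyclic_maps finite_arc_choices)
  then have "real (card (structures V K)) = real (card (cyclic_maps V K)) * (if card K \<ge> 3 then 2 ^ card V else 2 ^ (card V - 1))"
    by simp
  then show ?thesis by (simp only: card_cyclic_maps[OF fin K])
qed

section \<open>Counting trees and cyclic digraphs through their representations\<close>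

definition oriented_trees :: "'a set \<Rightarrow> 'a pair_pre_digraph set" where
  "oriented_trees V = {D. unicycle_digraph D \<and> pverts D = V \<and> undirected_cycles D = {}}"

definition cyclic_unicycles :: "'a set \<Rightarrow> 'a pair_pre_digraph set" where
  "cyclic_unicycles V = {D. unicycle_digraph D \<and> pverts D = V \<and> undirected_cycles D \<noteq> {}}"

definition cyclic_structures :: "'a set \<Rightarrow> ('a set \<times> ('a \<Rightarrow> 'a) \<times> ('a \<Rightarrow> 'a \<times> 'a)) set" where
  "cyclic_structures V = (SIGMA K:{K. K \<subseteq> V \<and> 2 \<le> card K}. structures V K)"

lemma cyclic_structuresD:
  assumes "(K, h, arc) \<in> cyclic_structures V"
  shows "owns V h arc" "monocyclic V K h" "2 \<le> card K" "K \<subseteq> V" "h \<in> V \<rightarrow>\<^sub>E V" "arc \<in> V \<rightarrow>\<^sub>E UNIV"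
proof -
  have K: "K \<subseteq> V" "2 \<le> card K" and s: "(h, arc) \<in> structures V K"
    using assms by (simp_all add: cyclic_structures_def)
  have "K \<noteq> {}" using K(2) by auto
  then show "owns V h arc" "monocyclic V K h" "2 \<le> card K" "K \<subseteq> V" "h \<in> V \<rightarrow>\<^sub>E V" "arc \<in> V \<rightarrow>\<^sub>E UNIV"
    using structuresD[OF s _ K(1)] K by blast+
qed

lemma cyclic_structuresI:
  assumes "owns V h arc" "monocyclic V K h" "2 \<le> card K"
  shows "(K, restrict h V, restrict arc V) \<in> cyclic_structures V"
  using structuresI[OF assms(1,2)] monocyclicD(2)[OF assms(2)] assms(3) by (simp add: cyclic_structures_def)

lemma finite_cyclic_structures:
  assumes "finite V"
  shows "finite (cyclic_structures V)"
  unfolding cyclic_structures_def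
proof (rule finite_SigmaI)
  show "finite {K. K \<subseteq> V \<and> 2 \<le> card K}"
    by (rule finite_subset[of _ "Pow V"]) (use assms in auto)
qed (rule finite_structures[OF assms])

text \<open>Rooting every tree at the same fixed vertex \<open>r\<close> counts each of them
  once.\<close>

lemma card_oriented_trees:
  assumes fin: "finite V" and r: "r \<in> V"
  shows "card (oriented_trees V) = card (structures V {r})"
proof -
  let ?G = "\<lambda>(h, arc). digraph_of V arc"
  have "bij_betw ?G (structures V {r}) (oriented_trees V)"
  proof (rule bij_betw_imageI)
    show "inj_on ?G (structures V {r})"
    proof (rule inj_onI)
      fix s s' assume s: "s \<in> structures V {r}" and s': "s' \<in> structures V {r}" and eq: "?G s = ?G s'"
      obtain h arc h' arc' where hs: "s = (h, arc)" "s' = (h', arc')" by fastforce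
      have D: "owns V h arc" "monocyclic V {r} h" "h \<in> V \<rightarrow>\<^sub>E V" "arc \<in> V \<rightarrow>\<^sub>E UNIV"
        using structuresD[of h arc V "{r}"] s r unfolding hs by simp_all
      have D': "owns V h' arc'" "monocyclic V {r} h'" "h' \<in> V \<rightarrow>\<^sub>E V" "arc' \<in> V \<rightarrow>\<^sub>E UNIV"
        using structuresD[of h' arc' V "{r}"] s' r unfolding hs by simp_all
      have eq': "digraph_of V arc = digraph_of V arc'" using eq by (simp add: hs)
      note u = rooted_tree_unique[OF D'(1) D(1) D'(2) D(2) eq']
      have "h = h'" by (rule PiE_ext[OF D(3) D'(3)]) (rule u(2))
      moreover have "arc = arc'" by (rule PiE_ext[OF D(4) D'(4)]) (rule u(1))
      ultimately show "s = s'" by (simp add: hs)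
    qed
    show "?G ` structures V {r} = oriented_trees V"
    proof
      show "?G ` structures V {r} \<subseteq> oriented_trees V"
      proof (rule image_subsetI)
        fix s assume s: "s \<in> structures V {r}"
        obtain h arc where hs: "s = (h, arc)" by fastforce
        have D: "owns V h arc" "monocyclic V {r} h"
          using structuresD[of h arc V "{r}"] s r unfolding hs by simp_all
        show "?G s \<in> oriented_trees V"
          using unicycle_digraph_of[OF fin D] undirected_cycles_digraph_of[OF fin D]
          by (simp add: oriented_trees_def hs)
      qed
      show "oriented_trees V \<subseteq> ?G ` structures V {r}"
      proof
        fix D assume "D \<in> oriented_trees V"
        then have D: "unicycle_digraph D" "undirected_cycles D = {}" "pverts D = V"
          by (simp_all add: oriented_trees_def)
        obtain h arc where h: "owns V h arc" "monocyclic V {r} h" "D = digraph_of V arc"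
          using rooted_tree_representation[OF D(1,2)] r unfolding D(3) by blast
        have "D = ?G (restrict h V, restrict arc V)" by (simp add: digraph_of_restrict h(3))
        then show "D \<in> ?G ` structures V {r}" using structuresI[OF h(1,2)] by (rule image_eqI)
      qed
    qed
  qed
  then show ?thesis by (rule bij_betw_same_card[symmetric])
qed

lemma cyclic_structures_digraph:
  assumes "finite V" "(K, h, arc) \<in> cyclic_structures V"
  shows "digraph_of V arc \<in> cyclic_unicycles V"
  using cyclic_structuresD[OF assms(2)] unicycle_digraph_of[OF assms(1)] undirected_cycles_digraph_of[OF assms(1)]
  by (simp add: cyclic_unicycles_def)

lemma cyclic_unicycles_representation:
  assumes "finite V" "D \<in> cyclic_unicycles V"
  obtains K h arc where "(K, h, arc) \<in> cyclic_structures V" "D = digraph_of V arc"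
proof -
  have D: "unicycle_digraph D" "undirected_cycles D \<noteq> {}" "pverts D = V"
    using assms(2) by (simp_all add: cyclic_unicycles_def)
  obtain K h arc where h: "card K \<ge> 2" "owns V h arc" "monocyclic V K h" "D = digraph_of V arc"
    using cyclic_representation[OF D(1,2)] unfolding D(3) by blast
  show ?thesis
    by (rule that[OF cyclic_structuresI[OF h(2,3,1)]]) (simp add: digraph_of_restrict h(4))
qed

definition reversal :: "'a set \<Rightarrow> 'a set \<times> ('a \<Rightarrow> 'a) \<times> ('a \<Rightarrow> 'a \<times> 'a) \<Rightarrow> 'a set \<times> ('a \<Rightarrow> 'a) \<times> ('a \<Rightarrow> 'a \<times> 'a)" where
  "reversal V = (\<lambda>(K, h, arc). (K, restrict (reverse_cycle K h) V, restrict (\<lambda>v. arc (pred_on K h v)) V))"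

lemma reversal_structure:
  assumes fin: "finite V" and s: "(K, h, arc) \<in> cyclic_structures V"
  shows "reversal V (K, h, arc) \<in> cyclic_structures V"
    "digraph_of V (snd (snd (reversal V (K, h, arc)))) = digraph_of V arc"
    "reversal V (K, h, arc) \<noteq> (K, h, arc)"
proof -
  note D = cyclic_structuresD[OF s]
  have finK: "finite K" using D(4) fin by (rule finite_subset)
  show "reversal V (K, h, arc) \<in> cyclic_structures V"
    unfolding reversal_def split
    by (rule cyclic_structuresI[OF reverse_cycle_owns[OF D(1,2) finK] reverse_cycle_monocyclic[OF D(2) finK] D(3)])
  show "digraph_of V (snd (snd (reversal V (K, h, arc)))) = digraph_of V arc"
    by (simp add: reversal_def digraph_of_restrict reverse_cycle_digraph_of[OF D(2) finK])
  show "reversal V (K, h, arc) \<noteq> (K, h, arc)"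
  proof
    assume eq: "reversal V (K, h, arc) = (K, h, arc)"
    obtain x where x: "x \<in> K" using monocyclicD(1)[OF D(2)] by blast
    then have hx: "h x \<in> K" by (rule monocyclicD(8)[OF D(2)])
    have V: "x \<in> V" "h x \<in> V" using x hx D(4) by blast+
    have "restrict (\<lambda>v. arc (pred_on K h v)) V = arc" using eq by (simp add: reversal_def)
    then have "arc (h x) = restrict (\<lambda>v. arc (pred_on K h v)) V (h x)" by (rule fun_cong[OF sym])
    then have "arc (h x) = arc x" using V pred_on_props(3)[OF D(2) finK x] by simp
    then have "h x = x" using D(1) V unfolding owns_def by (meson inj_onD)
    then show False using monocyclic_no_fixpoint[OF D(2,3) V(1)] by simp
  qed
qed

text \<open>The digraph determines \<open>K\<close> and all arcs owned off \<open>K\<close>; on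
  \<open>K\<close> the ownership is the same or shifted by one. The map \<open>h\<close> is then
  determined by \<open>arc\<close>.\<close>

lemma same_digraph_structures:
  assumes fin: "finite V" and s: "(K, h, arc) \<in> cyclic_structures V" and s': "(K', h', arc') \<in> cyclic_structures V"
    and eq: "digraph_of V arc' = digraph_of V arc"
  shows "(K', h', arc') = (K, h, arc) \<or> (K', h', arc') = reversal V (K, h, arc)"
proof -
  note D = cyclic_structuresD[OF s] and D' = cyclic_structuresD[OF s']
  have finK: "finite K" using D(4) fin by (rule finite_subset)
  note same = digraph_of_same_cycle[OF fin D(1) D'(1) D(2) D'(2) D(3) D'(3) eq]
  have cyc': "monocyclic V K h'" using D'(2) same(1) by simp
  have off: "arc' v = arc v" if "v \<in> V" "v \<notin> K" for v
    by (rule off_cycle_arcs_unique[OF D(1) D'(1) D(2) cyc' eq_refl[OF same(3)] that])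
  from cycle_arcs_unique_up_to_reversal[OF D(1) D'(1) D(2) cyc' finK eq_refl[OF same(2)]]
  show ?thesis
  proof
    assume on: "\<forall>v\<in>K. arc' v = arc v"
    have arc: "arc' v = arc v" if "v \<in> V" for v using on off that by (cases "v \<in> K") simp_all
    have "arc' = arc" by (rule PiE_ext[OF D'(6) D(6) arc])
    moreover have "h' = h"
      by (rule PiE_ext[OF D'(5) D(5)]) (rule owns_same_map[OF D(1) D'(1) _ _ arc])
    ultimately show ?thesis using same(1) by simp
  next
    assume on: "\<forall>v\<in>K. arc' (h v) = arc v"
    note p = pred_on_props[OF D(2) finK]
    have arc: "arc' v = arc (pred_on K h v)" if "v \<in> V" for v
    proof (cases "v \<in> K")
      case True
      have "arc' (h (pred_on K h v)) = arc (pred_on K h v)" using on p(1)[OF True] by blast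
      then show ?thesis by (simp add: p(2)[OF True])
    next
      case False
      then show ?thesis using off[OF that] by (simp add: pred_on_def)
    qed
    have "arc' = restrict (\<lambda>v. arc (pred_on K h v)) V"
      by (rule PiE_ext[OF D'(6)]) (simp_all add: arc)
    moreover have "h' v = reverse_cycle K h v" if "v \<in> V" for v
      by (rule owns_same_map[OF reverse_cycle_owns[OF D(1,2) finK] D'(1) that that arc[OF that]])
    then have "h' = restrict (reverse_cycle K h) V"
      by (intro PiE_ext[OF D'(5)]) (use monocyclicD(7)[OF reverse_cycle_monocyclic[OF D(2) finK]] in simp_all)
    ultimately show ?thesis using same(1) by (simp add: reversal_def)
  qed
qed

text \<open>Each digraph is the image of exactly two structures, one and its reversal, which differ
  even when \<open>card K = 2\<close>.\<close>

lemma card_cyclic_unicycles: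
  assumes fin: "finite V"
  shows "2 * card (cyclic_unicycles V) = (\<Sum>K | K \<subseteq> V \<and> 2 \<le> card K. card (structures V K))"
    "finite (cyclic_unicycles V)"
proof -
  let ?G = "\<lambda>(K, h, arc). digraph_of V arc"
  let ?S = "cyclic_structures V"
  note finS = finite_cyclic_structures[OF fin]
  have img: "?G ` ?S = cyclic_unicycles V"
  proof
    show "?G ` ?S \<subseteq> cyclic_unicycles V"
    proof (rule image_subsetI)
      fix s assume "s \<in> ?S"
      then show "?G s \<in> cyclic_unicycles V" by (cases s) (simp add: cyclic_structures_digraph[OF fin])
    qed
    show "cyclic_unicycles V \<subseteq> ?G ` ?S"
    proof
      fix D assume "D \<in> cyclic_unicycles V"
      then obtain K h arc where "(K, h, arc) \<in> ?S" "D = digraph_of V arc"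
        by (rule cyclic_unicycles_representation[OF fin])
      then show "D \<in> ?G ` ?S" by (intro image_eqI[of _ _ "(K, h, arc)"]) simp_all
    qed
  qed
  show fin_im: "finite (cyclic_unicycles V)" unfolding img[symmetric] using finS by (rule finite_imageI)
  have fiber: "card {s \<in> ?S. ?G s = D} = 2" if D: "D \<in> cyclic_unicycles V" for D
  proof -
    obtain K h arc where s: "(K, h, arc) \<in> ?S" "D = digraph_of V arc"
      using D by (rule cyclic_unicycles_representation[OF fin])
    note r = reversal_structure[OF fin s(1)]
    have "{s \<in> ?S. ?G s = D} = {(K, h, arc), reversal V (K, h, arc)}"
    proof
      show "{s \<in> ?S. ?G s = D} \<subseteq> {(K, h, arc), reversal V (K, h, arc)}"
      proof
        fix t assume "t \<in> {s \<in> ?S. ?G s = D}"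
        then show "t \<in> {(K, h, arc), reversal V (K, h, arc)}"
          using same_digraph_structures[OF fin s(1)] s(2) by (cases t) simp
      qed
      show "{(K, h, arc), reversal V (K, h, arc)} \<subseteq> {s \<in> ?S. ?G s = D}"
        using s r(1,2) by (simp add: case_prod_beta)
    qed
    then show ?thesis using r(3) by simp
  qed
  have "card ?S = (\<Sum>D\<in>?G ` ?S. card {s \<in> ?S. ?G s = D})"
    using sum.image_gen[OF finS, of "\<lambda>_. 1::nat" ?G] by simp
  also have "\<dots> = (\<Sum>D\<in>cyclic_unicycles V. 2)"
    unfolding img by (rule sum.cong[OF refl fiber])
  finally have "card ?S = 2 * card (cyclic_unicycles V)" by simp
  moreover have "card ?S = (\<Sum>K | K \<subseteq> V \<and> 2 \<le> card K. card (structures V K))"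
  proof -
    have "finite {K. K \<subseteq> V \<and> 2 \<le> card K}"
      by (rule finite_subset[of _ "Pow V"]) (use fin in auto)
    then show ?thesis
      unfolding cyclic_structures_def by (simp add: card_SigmaI finite_structures[OF fin])
  qed
  ultimately show "2 * card (cyclic_unicycles V) = (\<Sum>K | K \<subseteq> V \<and> 2 \<le> card K. card (structures V K))"
    by simp
qed

section \<open>The excess of the number of colorings over one\<close>

definition directed_structures :: "'a set \<Rightarrow> ('a set \<times> ('a \<Rightarrow> 'a) \<times> ('a \<Rightarrow> 'a \<times> 'a)) set" where
  "directed_structures V = {(K, h, arc) \<in> cyclic_structures V. \<forall>v\<in>K. arc v = (v, h v)}"

definition colorings :: "'a pair_pre_digraph \<Rightarrow> real" where
  "colorings D = real (card {c. well_coloring D c})"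

text \<open>Of the two structures of a digraph with a directed cycle, just one rotates along the
  arcs, so \<open>directed_structures\<close> lists these digraphs once each. All others have a
  single coloring and contribute 0.\<close>

lemma sum_coloring_excess:
  assumes fin: "finite V"
  shows "(\<Sum>D\<in>cyclic_unicycles V. colorings D - 1) =
    (\<Sum>(K, h, arc)\<in>directed_structures V. colorings (digraph_of V arc) - 1)"
proof -
  let ?G = "\<lambda>(K, h, arc). digraph_of V arc"
  have mem: "(K, h, arc) \<in> cyclic_structures V" "\<forall>v\<in>K. arc v = (v, h v)"
    if "(K, h, arc) \<in> directed_structures V" for K h arc
    using that by (simp_all add: directed_structures_def)
  have inj: "inj_on ?G (directed_structures V)"
  proof (rule inj_onI)
    fix s s' assume s: "s \<in> directed_structures V" and s': "s' \<in> directed_structures V" and eq: "?G s = ?G s'"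
    obtain K h arc K' h' arc' where t: "s = (K, h, arc)" "s' = (K', h', arc')" by (metis prod_cases3)
    note m = mem[OF s[unfolded t]] and m' = mem[OF s'[unfolded t]]
    note D = cyclic_structuresD[OF m(1)]
    have finK: "finite K" using D(4) fin by (rule finite_subset)
    have "digraph_of V arc' = digraph_of V arc" using eq by (simp add: t)
    from same_digraph_structures[OF fin m(1) m'(1) this] show "s = s'"
    proof
      assume r: "(K', h', arc') = reversal V (K, h, arc)"
      then have K': "K' = K" and arc': "arc' = restrict (\<lambda>v. arc (pred_on K h v)) V"
        by (simp_all add: reversal_def)
      obtain x where x: "x \<in> K" using monocyclicD(1)[OF D(2)] by blast
      then have hx: "h x \<in> K" by (rule monocyclicD(8)[OF D(2)])
      then have "arc' (h x) = arc x"
        using subsetD[OF D(4) hx] by (simp add: arc' pred_on_props(3)[OF D(2) finK x])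
      then have "fst (arc' (h x)) = x" using m(2) x by simp
      moreover have "fst (arc' (h x)) = h x" using m'(2) hx by (simp add: K')
      ultimately show ?thesis using monocyclic_no_fixpoint[OF D(2,3) subsetD[OF D(4) x]] by simp
    qed (simp add: t)
  qed
  have sub: "?G ` directed_structures V \<subseteq> cyclic_unicycles V"
  proof (rule image_subsetI)
    fix s assume "s \<in> directed_structures V"
    then show "?G s \<in> cyclic_unicycles V" by (cases s) (use cyclic_structures_digraph[OF fin mem(1)] in simp)
  qed
  have rest: "colorings D - 1 = 0" if D: "D \<in> cyclic_unicycles V - ?G ` directed_structures V" for D
  proof -
    have DC: "D \<in> cyclic_unicycles V" using D by blast
    then obtain K h arc where s: "(K, h, arc) \<in> cyclic_structures V" "D = digraph_of V arc"
      by (rule cyclic_unicycles_representation[OF fin])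
    note E = cyclic_structuresD[OF s(1)]
    have finK: "finite K" using E(4) fin by (rule finite_subset)
    have nin: "t \<notin> directed_structures V" if "?G t = D" for t
    proof
      assume "t \<in> directed_structures V"
      then have "?G t \<in> ?G ` directed_structures V" by (rule imageI)
      then show False using D that by simp
    qed
    have nf: "\<not> (\<forall>v\<in>K. arc v = (v, h v))"
      using nin[of "(K, h, arc)"] s by (simp add: directed_structures_def)
    \<comment> \<open>If all cycle arcs run against \<open>h\<close>, the reversal is a directed
      structure of the same digraph.\<close>
    have nb: "\<not> (\<forall>v\<in>K. arc v = (h v, v))"
    proof
      assume b: "\<forall>v\<in>K. arc v = (h v, v)"
      note r = reversal_structure[OF fin s(1)]
      define g \<beta> where "g = restrict (reverse_cycle K h) V" and "\<beta> = restrict (\<lambda>v. arc (pred_on K h v)) V"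
      have rev: "reversal V (K, h, arc) = (K, g, \<beta>)" by (simp add: reversal_def g_def \<beta>_def)
      have "\<beta> v = (v, g v)" if v: "v \<in> K" for v
      proof -
        note p = pred_on_props(1,2)[OF E(2) finK v]
        have "\<beta> v = arc (pred_on K h v)" using subsetD[OF E(4) v] by (simp add: \<beta>_def)
        also have "\<dots> = (v, pred_on K h v)" using b p by simp
        also have "pred_on K h v = g v"
          using subsetD[OF E(4) v] v by (simp add: g_def reverse_cycle_def pred_on_def)
        finally show ?thesis .
      qed
      then have "(K, g, \<beta>) \<in> directed_structures V"
        using r(1) unfolding rev by (simp add: directed_structures_def)
      moreover have "?G (K, g, \<beta>) = D" using r(2) s(2) unfolding rev by simp
      ultimately show False using nin by blast
    qed
    show ?thesis
      using card_well_colorings_acyclic[OF fin E(1,2)] nf nb by (simp add: colorings_def s(2))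
  qed
  have "(\<Sum>D\<in>cyclic_unicycles V. colorings D - 1) = (\<Sum>D\<in>?G ` directed_structures V. colorings D - 1)"
    by (rule sum.mono_neutral_right[OF card_cyclic_unicycles(2)[OF fin] sub]) (use rest in blast)
  also have "\<dots> = (\<Sum>s\<in>directed_structures V. colorings (?G s) - 1)"
    by (simp add: sum.reindex[OF inj])
  also have "\<dots> = (\<Sum>(K, h, arc)\<in>directed_structures V. colorings (digraph_of V arc) - 1)"
    by (rule sum.cong[OF refl]) (simp add: case_prod_beta)
  finally show ?thesis .
qed

text \<open>Write \<open>X = K \<union> Y\<close> with \<open>Y\<close> a closed set of downward
  vertices. The sum over \<open>Y\<close> detects \<open>K \<subseteq> Q\<close>, and
  \<open>(-1) ^ card K\<close> is \<open>2 - 1\<close> or \<open>0 - 1\<close> by parity.\<close>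

lemma coloring_excess_signed_sum:
  assumes fin: "finite V" and s: "(K, h, arc) \<in> directed_structures V"
  shows "colorings (digraph_of V arc) - 1 =
    (\<Sum>X | X \<subseteq> V \<and> K \<subseteq> X \<and> h ` X \<subseteq> X \<and> (\<forall>v\<in>X - K. arc v = (h v, v)). (-1) ^ card X)"
proof -
  have cs: "(K, h, arc) \<in> cyclic_structures V" and fwd: "\<forall>v\<in>K. arc v = (v, h v)"
    using s by (simp_all add: directed_structures_def)
  note D = cyclic_structuresD[OF cs]
  have finK: "finite K" using D(4) fin by (rule finite_subset)
  define L where "L = down_vertices V K h arc"
  have LV: "L \<subseteq> V" and KL: "K \<inter> L = {}" by (auto simp: L_def down_vertices_def)
  have Larc: "arc v = (h v, v)" if "v \<in> L" for v using that by (simp add: L_def down_vertices_def)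
  have finL: "finite L" using LV fin by (rule finite_subset)
  obtain Q where Q: "red_set K L h Q" using red_set_exists[OF fin D(1,2)] unfolding L_def by blast
  have sink: "\<exists>u\<in>W. \<forall>u'\<in>W. h u' \<noteq> u" if W: "W \<noteq> {}" "W \<subseteq> L" for W
  proof (rule ccontr)
    assume no: "\<not> (\<exists>u\<in>W. \<forall>u'\<in>W. h u' \<noteq> u)"
    have ch: "\<exists>y\<in>W. (x, y) \<in> arc ` V" if "x \<in> W" for x
    proof -
      obtain y where y: "y \<in> W" "h y = x" using no \<open>x \<in> W\<close> by blast
      have "y \<in> L" using y(1) W(2) by blast
      have "arc y = (x, y)" using Larc[OF \<open>y \<in> L\<close>] y(2) by simp
      moreover have "arc y \<in> arc ` V" by (rule imageI[OF subsetD[OF LV \<open>y \<in> L\<close>]])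
      ultimately show ?thesis using y(1) by metis
    qed
    have "W \<subseteq> V" using W(2) LV by blast
    then have "K \<subseteq> W" by (rule children_cover_cycle(1)[OF fin D(1,2) W(1) _ order_refl ch])
    then show False using W(2) KL monocyclicD(1)[OF D(2)] by blast
  qed
  let ?X = "{X. X \<subseteq> V \<and> K \<subseteq> X \<and> h ` X \<subseteq> X \<and> (\<forall>v\<in>X - K. arc v = (h v, v))}"
  let ?Y = "{Y. Y \<subseteq> L \<and> h ` Y \<subseteq> K \<union> Y}"
  have "(\<Sum>X\<in>?X. (-1) ^ card X) = (\<Sum>Y\<in>?Y. (-1) ^ card K * (-1) ^ card Y :: real)"
  proof (rule sum.reindex_bij_witness[where i = "\<lambda>Y. K \<union> Y" and j = "\<lambda>X. X - K"])
    fix X assume "X \<in> ?X"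
    then have X: "X \<subseteq> V" "K \<subseteq> X" "h ` X \<subseteq> X" "\<forall>v\<in>X - K. arc v = (h v, v)" by simp_all
    show KX: "K \<union> (X - K) = X" using X(2) by blast
    have "X - K \<subseteq> L"
    proof
      fix v assume v: "v \<in> X - K"
      then have "arc v = (h v, v)" using X(4) by simp
      then show "v \<in> L" using v X(1) by (simp add: L_def down_vertices_def subsetD)
    qed
    moreover have "h ` (X - K) \<subseteq> K \<union> (X - K)" unfolding KX using X(3) by (meson Diff_subset image_mono subset_trans)
    ultimately show "X - K \<in> ?Y" by simp
    have "card X = card K + card (X - K)"
      using X(1,2) fin by (metis card_Diff_subset card_mono finite_subset le_add_diff_inverse)
    then show "(-1) ^ card K * (-1) ^ card (X - K) = ((-1) ^ card X :: real)" by (simp add: power_add)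
  next
    fix Y assume "Y \<in> ?Y"
    then have Y: "Y \<subseteq> L" "h ` Y \<subseteq> K \<union> Y" by simp_all
    show eq: "K \<union> Y - K = Y" using Y(1) KL by blast
    have "h ` (K \<union> Y) \<subseteq> K \<union> Y" unfolding image_Un using Y(2) monocyclicD(4)[OF D(2)] by (intro Un_least) auto
    moreover have "\<forall>v\<in>K \<union> Y - K. arc v = (h v, v)" unfolding eq using Larc Y(1) by blast
    moreover have "K \<union> Y \<subseteq> V" using D(4) Y(1) LV by blast
    ultimately show "K \<union> Y \<in> ?X" by simp
  qed
  also have "\<dots> = (-1) ^ card K * (\<Sum>Y\<in>?Y. (-1) ^ card Y)" by (simp only: sum_distrib_left)
  also have "(\<Sum>Y\<in>?Y. (-1) ^ card Y) = (if K \<subseteq> Q then 1 else 0 :: real)"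
    by (rule signed_closed_sets[OF finL KL Q sink])
  finally have sum: "(\<Sum>X\<in>?X. (-1) ^ card X) = (-1) ^ card K * (if K \<subseteq> Q then 1 else 0 :: real)" .
  have "colorings (digraph_of V arc) = real (if K \<subseteq> Q then if even (card K) then 2 else 0 else 1)"
    unfolding colorings_def card_well_colorings_directed[OF fin D(1,2,3) fwd Q[unfolded L_def]] ..
  then show ?thesis unfolding sum by simp
qed

text \<open>Arcs are free off \<open>X\<close>, forward on \<open>K\<close> and downward on the rest
  of \<open>X\<close>. Injectivity is automatic, since it could fail only on a cycle of length 2,
  where the two forced arcs differ.\<close>

definition closed_structures :: "'a set \<Rightarrow> 'a set \<Rightarrow> 'a set \<Rightarrow> (('a \<Rightarrow> 'a) \<times> ('a \<Rightarrow> 'a \<times> 'a)) set" where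
  "closed_structures V X K = (SIGMA h:{h \<in> cyclic_maps V K. h ` X \<subseteq> X}.
     \<Pi>\<^sub>E v\<in>V. if v \<in> V - X then {(v, h v), (h v, v)} else if v \<in> K then {(v, h v)} else {(h v, v)})"

lemma card_closed_structures:
  assumes fin: "finite V" and "K \<subseteq> X" "X \<subseteq> V" and card: "2 \<le> card K"
  shows "real (card (closed_structures V X K)) =
    fact (card K - 1) * rooted_forests (card X) (card K) * rooted_forests (card V) (card X) * 2 ^ (card V - card X)"
proof -
  have Kne: "K \<noteq> {}" using card by auto
  have KV: "K \<subseteq> V" using assms(2,3) by blast
  have "card (\<Pi>\<^sub>E v\<in>V. if v \<in> V - X then {(v, h v), (h v, v)} else if v \<in> K then {(v, h v)} else {(h v, v)})
      = 2 ^ card (V - X)" if h: "h \<in> {h \<in> cyclic_maps V K. h ` X \<subseteq> X}" for h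
  proof (rule card_arc_choices[OF fin Diff_subset])
    have "monocyclic V K h" using h cyclic_maps_iff_monocyclic[OF Kne KV] by blast
    then show "h v \<noteq> v" if "v \<in> V - X" for v
      using monocyclic_no_fixpoint[OF _ card] that by blast
  qed simp
  moreover have "finite (\<Pi>\<^sub>E v\<in>V. if v \<in> V - X then {(v, h v), (h v, v)} else if v \<in> K then {(v, h v)} else {(h v, v)})" for h
    using fin by (intro finite_PiE) simp_all
  moreover have "finite {h \<in> cyclic_maps V K. h ` X \<subseteq> X}" using fin by (simp add: finite_cyclic_maps)
  ultimately have "card (closed_structures V X K) = card {h \<in> cyclic_maps V K. h ` X \<subseteq> X} * 2 ^ card (V - X)"
    unfolding closed_structures_def by (simp add: card_SigmaI)
  moreover have "card (V - X) = card V - card X"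
    using assms(3) fin by (simp add: card_Diff_subset finite_subset)
  ultimately show ?thesis
    using card_cyclic_maps_closed[OF fin assms(2,3) Kne] by simp
qed

lemma closed_directed_structures:
  assumes fin: "finite V" and XV: "X \<subseteq> V"
  shows "{(K, h, arc) \<in> directed_structures V. K \<subseteq> X \<and> h ` X \<subseteq> X \<and> (\<forall>v\<in>X - K. arc v = (h v, v))}
    = (SIGMA K:{K. K \<subseteq> X \<and> 2 \<le> card K}. closed_structures V X K)"
proof -
  have "(K, h, arc) \<in> directed_structures V \<and> K \<subseteq> X \<and> h ` X \<subseteq> X \<and> (\<forall>v\<in>X - K. arc v = (h v, v))
    \<longleftrightarrow> K \<subseteq> X \<and> 2 \<le> card K \<and> (h, arc) \<in> closed_structures V X K" (is "?l \<longleftrightarrow> ?r") for K h arc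
  proof
    assume l: ?l
    then have m: "h \<in> cyclic_maps V K" "arc \<in> arc_choices V h" "2 \<le> card K" "\<forall>v\<in>K. arc v = (v, h v)"
      by (simp_all add: directed_structures_def cyclic_structures_def structures_def)
    have "arc v \<in> (if v \<in> V - X then {(v, h v), (h v, v)} else if v \<in> K then {(v, h v)} else {(h v, v)})"
      if "v \<in> V" for v
      using l m(2,4) that unfolding arc_choices_def PiE_iff by (cases "v \<in> X"; cases "v \<in> K") simp_all
    moreover have "arc \<in> extensional V" using m(2) by (simp add: arc_choices_def PiE_iff)
    ultimately have "arc \<in> (\<Pi>\<^sub>E v\<in>V. if v \<in> V - X then {(v, h v), (h v, v)} else if v \<in> K then {(v, h v)} else {(h v, v)})"
      by (simp only: PiE_iff) simp
    then show ?r using l m(1,3) by (simp add: closed_structures_def)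
  next
    assume r: ?r
    then have h: "h \<in> cyclic_maps V K" "h ` X \<subseteq> X" and K: "K \<subseteq> X" "2 \<le> card K"
      and arc: "arc \<in> extensional V"
        "\<And>v. v \<in> V \<Longrightarrow> arc v \<in> (if v \<in> V - X then {(v, h v), (h v, v)} else if v \<in> K then {(v, h v)} else {(h v, v)})"
      by (simp_all add: closed_structures_def PiE_iff)
    have KV: "K \<subseteq> V" using K XV by blast
    have Kne: "K \<noteq> {}" using K(2) by auto
    have cyc: "monocyclic V K h" using h(1) cyclic_maps_iff_monocyclic[OF Kne KV] by blast
    have fwd: "arc v = (v, h v)" if "v \<in> K" for v
      using arc(2)[of v] subsetD[OF K(1) that] subsetD[OF KV that] that by simp
    have dn: "arc v = (h v, v)" if "v \<in> X - K" for v
      using arc(2)[of v] subsetD[OF XV, of v] that by simp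
    have "arc v \<in> {(v, h v), (h v, v)}" if "v \<in> V" for v
      using arc(2)[OF that] by (cases "v \<in> X"; cases "v \<in> K") (use that in simp_all)
    then have ac: "arc \<in> arc_choices V h"
      using arc(1) by (simp add: arc_choices_def PiE_iff)
    have "inj_on arc V"
    proof (rule inj_onI, rule ccontr)
      fix u v assume uv: "u \<in> V" "v \<in> V" "arc u = arc v" "u \<noteq> v"
      then have "K = {u, v}" by (rule arc_choices_collision(3)[OF cyc ac])
      then have "arc u = (u, h u)" "arc v = (v, h v)" using fwd by simp_all
      then show False using uv(3,4) by simp
    qed
    then show ?l
      using h K KV ac fwd dn by (simp add: directed_structures_def cyclic_structures_def structures_def)
  qed
  then show ?thesis by auto
qed

text \<open>Summing over \<open>X\<close> on the outside leaves, for each \<open>X\<close>, a set of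
  structures with product cardinality; summing over structures first would require the shape of
  every digraph.\<close>

lemma sum_coloring_excess_value:
  assumes fin: "finite V"
  shows "(\<Sum>D\<in>cyclic_unicycles V. colorings D - 1) =
    (\<Sum>X\<in>Pow V. (-1) ^ card X * (\<Sum>K | K \<subseteq> X \<and> 2 \<le> card K.
       fact (card K - 1) * rooted_forests (card X) (card K) * rooted_forests (card V) (card X) * 2 ^ (card V - card X)))"
proof -
  let ?P = "\<lambda>X (K, h, arc). K \<subseteq> X \<and> h ` X \<subseteq> X \<and> (\<forall>v\<in>X - K. arc v = (h v, v))"
  have finD: "finite (directed_structures V)"
    using finite_cyclic_structures[OF fin] by (rule rev_finite_subset) (auto simp: directed_structures_def)
  have "(\<Sum>D\<in>cyclic_unicycles V. colorings D - 1) =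
      (\<Sum>s\<in>directed_structures V. \<Sum>X\<in>Pow V. if ?P X s then (-1) ^ card X else 0)"
    unfolding sum_coloring_excess[OF fin]
  proof (rule sum.cong[OF refl])
    fix s assume s: "s \<in> directed_structures V"
    obtain K h arc where t: "s = (K, h, arc)" by (metis prod_cases3)
    have "{X. X \<subseteq> V \<and> K \<subseteq> X \<and> h ` X \<subseteq> X \<and> (\<forall>v\<in>X - K. arc v = (h v, v))} = {X \<in> Pow V. ?P X s}"
      by (simp add: t)
    then show "(case s of (K, h, arc) \<Rightarrow> colorings (digraph_of V arc) - 1) =
        (\<Sum>X\<in>Pow V. if ?P X s then (-1) ^ card X else 0)"
      using coloring_excess_signed_sum[OF fin s[unfolded t]] fin
      by (simp add: t sum.If_cases Int_def)
  qed
  also have "\<dots> = (\<Sum>X\<in>Pow V. \<Sum>s\<in>directed_structures V. if ?P X s then (-1) ^ card X else 0)"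
    by (rule sum.swap)
  also have "\<dots> = (\<Sum>X\<in>Pow V. (-1) ^ card X * (\<Sum>K | K \<subseteq> X \<and> 2 \<le> card K.
       fact (card K - 1) * rooted_forests (card X) (card K) * rooted_forests (card V) (card X) * 2 ^ (card V - card X)))"
  proof (rule sum.cong[OF refl])
    fix X assume "X \<in> Pow V"
    then have X: "X \<subseteq> V" by simp
    have finX: "finite X" using X fin by (rule finite_subset)
    have finKs: "finite {K. K \<subseteq> X \<and> 2 \<le> card K}"
      by (rule finite_subset[of _ "Pow X"]) (use finX in auto)
    have set: "{s \<in> directed_structures V. ?P X s} = (SIGMA K:{K. K \<subseteq> X \<and> 2 \<le> card K}. closed_structures V X K)"
      unfolding closed_directed_structures[OF fin X, symmetric] by auto
    have "finite (closed_structures V X K)" for K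
      unfolding closed_structures_def using fin
      by (intro finite_SigmaI finite_PiE) (simp_all add: finite_cyclic_maps)
    then have "real (card {s \<in> directed_structures V. ?P X s}) =
        (\<Sum>K | K \<subseteq> X \<and> 2 \<le> card K. real (card (closed_structures V X K)))"
      unfolding set using finKs by (simp add: card_SigmaI)
    also have "\<dots> = (\<Sum>K | K \<subseteq> X \<and> 2 \<le> card K.
       fact (card K - 1) * rooted_forests (card X) (card K) * rooted_forests (card V) (card X) * 2 ^ (card V - card X))"
      by (rule sum.cong[OF refl]) (use card_closed_structures[OF fin _ X] in simp)
    finally have c: "real (card {s \<in> directed_structures V. ?P X s}) = \<dots>" .
    have "(\<Sum>s\<in>directed_structures V. if ?P X s then (-1) ^ card X else 0) =
        (-1) ^ card X * real (card {s \<in> directed_structures V. ?P X s})"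
      using finD by (simp add: sum.If_cases Int_def)
    then show "(\<Sum>s\<in>directed_structures V. if ?P X s then (-1) ^ card X else 0) =
      (-1) ^ card X * (\<Sum>K | K \<subseteq> X \<and> 2 \<le> card K.
       fact (card K - 1) * rooted_forests (card X) (card K) * rooted_forests (card V) (card X) * 2 ^ (card V - card X))"
      unfolding c .
  qed
  finally show ?thesis .
qed

section \<open>The total count on n vertices\<close>

lemma sum_subsets_card_ge_2:
  assumes "finite V"
  shows "(\<Sum>K | K \<subseteq> V \<and> 2 \<le> card K. f (card K)) = (\<Sum>k=2..card V. real (card V choose k) * f k)"
proof -
  have "(\<Sum>K | K \<subseteq> V \<and> 2 \<le> card K. f (card K)) = (\<Sum>K\<in>Pow V. if 2 \<le> card K then f (card K) else 0)"
    using assms by (simp add: sum.If_cases Int_def)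
  also have "\<dots> = (\<Sum>k\<le>card V. real (card V choose k) * (if 2 \<le> k then f k else 0))"
    by (rule sum_Pow_card[OF assms])
  also have "\<dots> = (\<Sum>k=2..card V. real (card V choose k) * f k)"
    by (rule sum.mono_neutral_cong_right) auto
  finally show ?thesis .
qed

text \<open>Every tree has one coloring, and a digraph with a cycle has one plus its excess. The
  three summands are the trees, the cyclic digraphs and the total excess.\<close>

lemma card_colored_unicycles:
  fixes n :: nat
  assumes n: "n > 0"
  shows "real (card (well_colored_unicycles n)) =
    2 ^ (n - 1) * rooted_forests n 1
    + (\<Sum>k=2..n. real (n choose k) * (fact (k - 1) * rooted_forests n k * (if k \<ge> 3 then 2 ^ n else 2 ^ (n - 1)))) / 2
    + (\<Sum>m\<le>n. real (n choose m) * ((-1) ^ m * (\<Sum>k=2..m. real (m choose k) *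
        (fact (k - 1) * rooted_forests m k * rooted_forests n m * 2 ^ (n - m)))))"
proof -
  define V where "V = {1..n}"
  have fin: "finite V" and cV: "card V = n" and oneV: "1 \<in> V" using n by (simp_all add: V_def)
  have finW: "finite {c. well_coloring D c}" if "pverts D = V" for D :: "nat pair_pre_digraph"
  proof (rule finite_subset)
    show "{c. well_coloring D c} \<subseteq> V \<rightarrow>\<^sub>E {Red, Green}"
    proof
      fix c assume "c \<in> {c. well_coloring D c}"
      then have "c \<in> extensional V" using that by (simp add: well_coloring_iff PiE_iff)
      moreover have "c v \<in> {Red, Green}" for v by (cases "c v") simp_all
      ultimately show "c \<in> V \<rightarrow>\<^sub>E {Red, Green}" by (simp add: PiE_iff)
    qed
    show "finite (V \<rightarrow>\<^sub>E {Red, Green})" using fin by (intro finite_PiE) simp_all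
  qed
  have tree: "\<exists>h arc. owns V h arc \<and> monocyclic V {1} h \<and> D = digraph_of V arc" if "D \<in> oriented_trees V" for D
    using that rooted_tree_representation[of D 1] oneV unfolding oriented_trees_def by blast
  have trees1: "colorings D = 1" if D: "D \<in> oriented_trees V" for D
  proof -
    obtain h arc where h: "owns V h arc" "monocyclic V {1} h" "D = digraph_of V arc" using tree[OF D] by blast
    show ?thesis using card_well_colorings_acyclic[OF fin h(1,2)] by (simp add: colorings_def h(3))
  qed
  have trees: "real (card (oriented_trees V)) = 2 ^ (n - 1) * rooted_forests n 1"
    using card_structures[OF fin, of "{1}"] oneV by (simp add: card_oriented_trees[OF fin oneV] cV)
  \<comment> \<open>Infinite sets have \<open>card\<close> 0, so a positive count proves that the
    set of trees is finite.\<close>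
  have "real (card (structures V {1})) > 0"
    unfolding card_oriented_trees[OF fin oneV, symmetric] trees using n by (simp add: rooted_forests_def)
  then have finT: "finite (oriented_trees V)"
    using card_oriented_trees[OF fin oneV] card_gt_0_iff by force
  note finC = card_cyclic_unicycles(2)[OF fin]
  have "well_colored_unicycles n = (SIGMA D:oriented_trees V \<union> cyclic_unicycles V. {c. well_coloring D c})"
    by (auto simp: well_colored_unicycles_def oriented_trees_def cyclic_unicycles_def V_def)
  then have "real (card (well_colored_unicycles n)) =
      (\<Sum>D\<in>oriented_trees V \<union> cyclic_unicycles V. colorings D)"
  proof -
    have "\<forall>D\<in>oriented_trees V \<union> cyclic_unicycles V. finite {c. well_coloring D c}"
    proof
      fix D assume "D \<in> oriented_trees V \<union> cyclic_unicycles V"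
      then have "pverts D = V" unfolding oriented_trees_def cyclic_unicycles_def by blast
      then show "finite {c. well_coloring D c}" by (rule finW)
    qed
    then have "card (SIGMA D:oriented_trees V \<union> cyclic_unicycles V. {c. well_coloring D c}) =
        (\<Sum>D\<in>oriented_trees V \<union> cyclic_unicycles V. card {c. well_coloring D c})"
      by (rule card_SigmaI[OF finite_UnI[OF finT finC]])
    then show ?thesis
      unfolding \<open>well_colored_unicycles n = _\<close> by (simp only: colorings_def of_nat_sum)
  qed
  also have "\<dots> = (\<Sum>D\<in>oriented_trees V. colorings D) + (\<Sum>D\<in>cyclic_unicycles V. colorings D)"
    by (rule sum.union_disjoint[OF finT finC]) (auto simp: oriented_trees_def cyclic_unicycles_def)
  also have "(\<Sum>D\<in>oriented_trees V. colorings D) = 2 ^ (n - 1) * rooted_forests n 1"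
    using trees1 trees by simp
  also have "(\<Sum>D\<in>cyclic_unicycles V. colorings D) =
      real (card (cyclic_unicycles V)) + (\<Sum>D\<in>cyclic_unicycles V. colorings D - 1)"
    by (simp add: sum_subtractf)
  also have "real (card (cyclic_unicycles V)) =
     (\<Sum>k=2..n. real (n choose k) * (fact (k - 1) * rooted_forests n k * (if k \<ge> 3 then 2 ^ n else 2 ^ (n - 1)))) / 2"
  proof -
    have "2 * real (card (cyclic_unicycles V)) = (\<Sum>K | K \<subseteq> V \<and> 2 \<le> card K. real (card (structures V K)))"
      using card_cyclic_unicycles(1)[OF fin] by (metis of_nat_mult of_nat_numeral of_nat_sum)
    also have "\<dots> = (\<Sum>K | K \<subseteq> V \<and> 2 \<le> card K.
        fact (card K - 1) * rooted_forests n (card K) * (if card K \<ge> 3 then 2 ^ n else 2 ^ (n - 1)))"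
    proof (rule sum.cong[OF refl])
      fix K assume K: "K \<in> {K. K \<subseteq> V \<and> 2 \<le> card K}"
      then have "K \<noteq> {}" by auto
      then show "real (card (structures V K)) =
          fact (card K - 1) * rooted_forests n (card K) * (if card K \<ge> 3 then 2 ^ n else 2 ^ (n - 1))"
        using card_structures[OF fin, of K] K cV by simp
    qed
    also have "\<dots> = (\<Sum>k=2..card V. real (card V choose k) *
        (fact (k - 1) * rooted_forests n k * (if k \<ge> 3 then 2 ^ n else 2 ^ (n - 1))))"
      by (rule sum_subsets_card_ge_2[OF fin])
    finally show ?thesis by (simp add: cV)
  qed
  also have "(\<Sum>D\<in>cyclic_unicycles V. colorings D - 1) =
      (\<Sum>m\<le>n. real (n choose m) * ((-1) ^ m * (\<Sum>k=2..m. real (m choose k) *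
        (fact (k - 1) * rooted_forests m k * rooted_forests n m * 2 ^ (n - m)))))"
  proof -
    let ?g = "\<lambda>m. (-1) ^ m * (\<Sum>k=2..m. real (m choose k) *
        (fact (k - 1) * rooted_forests m k * rooted_forests n m * 2 ^ (n - m)))"
    have "(\<Sum>D\<in>cyclic_unicycles V. colorings D - 1) = (\<Sum>X\<in>Pow V. ?g (card X))"
      unfolding sum_coloring_excess_value[OF fin]
    proof (rule sum.cong[OF refl])
      fix X assume "X \<in> Pow V"
      then have "finite X" using fin by (simp add: finite_subset)
      then show "(-1) ^ card X * (\<Sum>K | K \<subseteq> X \<and> 2 \<le> card K.
         fact (card K - 1) * rooted_forests (card X) (card K) * rooted_forests (card V) (card X) * 2 ^ (card V - card X))
         = ?g (card X)"
        unfolding cV by (subst sum_subsets_card_ge_2) simp_all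
    qed
    also have "\<dots> = (\<Sum>m\<le>card V. real (card V choose m) * ?g m)"
      by (rule sum_Pow_card[OF fin])
    finally show ?thesis by (simp only: cV)
  qed
  finally show ?thesis by (simp only: add.assoc)
qed

section \<open>The generating function\<close>

text \<open>On division by \<open>fact n\<close> the factors
  \<open>(m choose k) * fact (k - 1) / fact m\<close> become \<open>1 / (k * fact (m - k))\<close>,
  which gives the right-hand side of \<open>closed_form_nth\<close> literally.\<close>

lemma well_colored_unicycle_egf_nth:
  assumes n: "n > 0"
  shows "well_colored_unicycle_egf $ n =
    2 ^ (n - 1) * rooted_forests n 1 / fact n
    + (\<Sum>k=2..n. (if k = 2 then 1/2 else 1) * 2 ^ n * rooted_forests n k / (real k * fact (n - k))) / 2
    + (\<Sum>m=2..n. \<Sum>k=2..m. (-1) ^ m * 2 ^ (n - m) * rooted_forests n m / fact (n - m)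
         * (rooted_forests m k / (real k * fact (m - k))))"
proof -
  have choose: "real (m choose k) * fact (k - 1) / fact m = 1 / (real k * fact (m - k))"
    if "2 \<le> k" "k \<le> m" for m k
  proof -
    have "(fact k :: real) = real k * fact (k - 1)" using that by (simp add: fact_reduce)
    then show ?thesis using that by (simp add: binomial_fact field_simps)
  qed
  have c: "real (n choose k) * (fact (k - 1) * rooted_forests n k * (if k \<ge> 3 then 2 ^ n else 2 ^ (n - 1))) / fact n
      = (if k = 2 then 1/2 else 1) * 2 ^ n * rooted_forests n k / (real k * fact (n - k))"
    if k: "k \<in> {2..n}" for k
  proof -
    have p: "(if k \<ge> 3 then 2 ^ n else 2 ^ (n - 1)) = (if k = 2 then 1/2 else 1) * (2 ^ n :: real)"
      using k n by (cases n) auto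
    have "real (n choose k) * (fact (k - 1) * rooted_forests n k * x) / fact n =
        real (n choose k) * fact (k - 1) / fact n * (rooted_forests n k * x)" for x
      by simp
    also have "\<dots> x = x * rooted_forests n k / (real k * fact (n - k))" for x
      using choose[of k n] k by simp
    finally show ?thesis unfolding p .
  qed
  have d: "real (n choose m) * ((-1) ^ m * (\<Sum>k=2..m. real (m choose k) *
        (fact (k - 1) * rooted_forests m k * rooted_forests n m * 2 ^ (n - m)))) / fact n =
      (\<Sum>k=2..m. (-1) ^ m * 2 ^ (n - m) * rooted_forests n m / fact (n - m)
         * (rooted_forests m k / (real k * fact (m - k))))" if m: "m \<le> n" for m
  proof -
    have "real (n choose m) * ((-1) ^ m * (\<Sum>k=2..m. real (m choose k) *
        (fact (k - 1) * rooted_forests m k * rooted_forests n m * 2 ^ (n - m)))) / fact n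
      = (\<Sum>k=2..m. real (n choose m) * ((-1) ^ m * (real (m choose k) *
        (fact (k - 1) * rooted_forests m k * rooted_forests n m * 2 ^ (n - m)))) / fact n)"
      by (simp only: sum_distrib_left sum_divide_distrib)
    also have "\<dots> = (\<Sum>k=2..m. (-1) ^ m * 2 ^ (n - m) * rooted_forests n m / fact (n - m)
         * (rooted_forests m k / (real k * fact (m - k))))"
    proof (rule sum.cong[OF refl])
      fix k assume "k \<in> {2..m}"
      then have k: "2 \<le> k" "k \<le> m" by simp_all
      have nm: "real (n choose m) / fact n = 1 / (fact m * fact (n - m))"
        using m by (simp add: binomial_fact)
      have "real (n choose m) * (s * (real (m choose k) * (fact (k - 1) * a * b * t))) / fact n
          = s * t * b / fact (n - m) * (a * (real (m choose k) * fact (k - 1) / fact m))" for s a b t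
      proof -
        have "real (n choose m) * (s * (real (m choose k) * (fact (k - 1) * a * b * t))) / fact n
          = real (n choose m) / fact n * (s * (real (m choose k) * (fact (k - 1) * a * b * t)))"
          by simp
        then show ?thesis unfolding nm by (simp add: mult_ac)
      qed
      then show "real (n choose m) * ((-1) ^ m * (real (m choose k) *
          (fact (k - 1) * rooted_forests m k * rooted_forests n m * 2 ^ (n - m)))) / fact n =
        (-1) ^ m * 2 ^ (n - m) * rooted_forests n m / fact (n - m)
         * (rooted_forests m k / (real k * fact (m - k)))"
        unfolding choose[OF k] by simp
    qed
    finally show ?thesis .
  qed
  have "well_colored_unicycle_egf $ n = real (card (well_colored_unicycles n)) / fact n"
    using n by (simp add: well_colored_unicycle_egf_def)
  also have "\<dots> = 2 ^ (n - 1) * rooted_forests n 1 / fact n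
    + (\<Sum>k=2..n. real (n choose k) * (fact (k - 1) * rooted_forests n k * (if k \<ge> 3 then 2 ^ n else 2 ^ (n - 1))) / fact n) / 2
    + (\<Sum>m\<le>n. real (n choose m) * ((-1) ^ m * (\<Sum>k=2..m. real (m choose k) *
        (fact (k - 1) * rooted_forests m k * rooted_forests n m * 2 ^ (n - m)))) / fact n)"
    unfolding card_colored_unicycles[OF n] by (simp add: add_divide_distrib sum_divide_distrib[symmetric])
  also have "(\<Sum>k=2..n. real (n choose k) * (fact (k - 1) * rooted_forests n k * (if k \<ge> 3 then 2 ^ n else 2 ^ (n - 1))) / fact n)
     = (\<Sum>k=2..n. (if k = 2 then 1/2 else 1) * 2 ^ n * rooted_forests n k / (real k * fact (n - k)))"
    by (rule sum.cong[OF refl]) (rule c)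
  also have "(\<Sum>m\<le>n. real (n choose m) * ((-1) ^ m * (\<Sum>k=2..m. real (m choose k) *
        (fact (k - 1) * rooted_forests m k * rooted_forests n m * 2 ^ (n - m)))) / fact n) =
      (\<Sum>m\<le>n. \<Sum>k=2..m. (-1) ^ m * 2 ^ (n - m) * rooted_forests n m / fact (n - m)
         * (rooted_forests m k / (real k * fact (m - k))))"
    by (rule sum.cong[OF refl]) (simp only: atMost_iff d)
  \<comment> \<open>For \<open>m < 2\<close> the inner sum is empty.\<close>
  also have "\<dots> = (\<Sum>m=2..n. \<Sum>k=2..m. (-1) ^ m * 2 ^ (n - m) * rooted_forests n m / fact (n - m)
         * (rooted_forests m k / (real k * fact (m - k))))"
    by (rule sum.mono_neutral_right) auto
  finally show ?thesis .
qed

lemma fps_expansion_to_order_8: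
  fixes F :: "real fps"
  assumes "F $ 0 = 0"
  shows "F = fps_const (F $ 1) * fps_X + fps_const (F $ 2) * fps_X^2 + fps_const (F $ 3) * fps_X^3
    + fps_const (F $ 4) * fps_X^4 + fps_const (F $ 5) * fps_X^5 + fps_const (F $ 6) * fps_X^6
    + fps_const (F $ 7) * fps_X^7 + fps_X^8 * fps_shift 8 F"
proof (rule fps_ext)
  fix n :: nat
  consider "n = 0" | "n = 1" | "n = 2" | "n = 3" | "n = 4" | "n = 5" | "n = 6" | "n = 7" | "n \<ge> 8"
    by linarith
  then show "F $ n = (fps_const (F $ 1) * fps_X + fps_const (F $ 2) * fps_X^2 + fps_const (F $ 3) * fps_X^3
    + fps_const (F $ 4) * fps_X^4 + fps_const (F $ 5) * fps_X^5 + fps_const (F $ 6) * fps_X^6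
    + fps_const (F $ 7) * fps_X^7 + fps_X^8 * fps_shift 8 F) $ n"
    by cases (simp_all add: assms fps_X_power_mult_nth)
qed

text \<open>The coefficients of orders 4 to 7 are the computed ones of
  \<open>closed_form_values\<close>. The error term of order 8 is a multiple of
  \<open>fps_X^8\<close>, with the shifted series as cofactor.\<close>

theorem theorem4:
  fixes T T_r T_g T_unr :: "real fps"
  assumes "T = (cayley_tree_fps oo (2 * fps_X)) / 2"
    and "T_r = - (cayley_tree_fps oo (- ((cayley_tree_fps oo (2 * fps_X)) / 2)))"
    and "T_g = T - T_r"
    and "T_unr = T - T^2"
  shows "well_colored_unicycle_egf =
           T_unr + 1/2 * fps_log1 (1 / (1 - 2 * T_g)) - T_g - T_g^2 / 2 - T_r * T_g / 2 - T_r * T / 2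
           + 1/2 * fps_log1 (1 / (1 - (2 * T_r * T
               + (T_r * T_g + T_r * T + 2 * T_r * T * T_g + 2 * T_r * T^2) / (1 - 2 * T_g))))
       \<and> well_colored_unicycle_egf =
           T_unr - T + T_r - T^2 / 2 - fps_log1 (1 + T_r) - 1/2 * fps_log1 (1 - 2 * T)
       \<and> (\<exists>R. well_colored_unicycle_egf =
           fps_X + fps_const (4 / fact 2) * fps_X^2 + fps_const (36 / fact 3) * fps_X^3
           + fps_const (638 / fact 4) * fps_X^4 + fps_const (14480 / fact 5) * fps_X^5
           + fps_const (414312 / fact 6) * fps_X^6 + fps_const (14088424 / fact 7) * fps_X^7
           + fps_X^8 * R)"
proof -
  let ?V = well_colored_unicycle_egf
  have T_r: "T_r = - (cayley_tree_fps oo (- T))" unfolding assms(1) by (rule assms(2))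
  have T0: "T $ 0 = 0" using oriented_tree_power_nth[OF assms(1), of 1 0] by simp
  have Tr0: "T_r $ 0 = 0" by (simp add: T_r fps_compose_nth)
  have V0: "?V $ 0 = 0" by (simp add: well_colored_unicycle_egf_def)
  have closed: "?V = T_unr - T + T_r - T^2 / 2 - fps_log1 (1 + T_r) - 1/2 * fps_log1 (1 - 2 * T)"
  proof (rule fps_ext)
    fix n
    show "?V $ n = (T_unr - T + T_r - T^2 / 2 - fps_log1 (1 + T_r) - 1/2 * fps_log1 (1 - 2 * T)) $ n"
    proof (cases "n > 0")
      case True
      then show ?thesis
        unfolding assms(4) closed_form_nth[OF assms(1) T_r True] by (rule well_colored_unicycle_egf_nth)
    next
      case False
      have "(T^2 / 2) $ 0 = 0" unfolding half_fps using T0 by simp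
      then show ?thesis
        using False V0 T0 Tr0 fps_log1_nth[OF Tr0, of 0] fps_log1_nth[of "- (2 * T)" 0]
        by (simp add: assms(4))
    qed
  qed
  have coeff: "?V $ 1 = 1" "?V $ 2 = 4 / fact 2" "?V $ 3 = 36 / fact 3" "?V $ 4 = 638 / fact 4"
    "?V $ 5 = 14480 / fact 5" "?V $ 6 = 414312 / fact 6" "?V $ 7 = 14088424 / fact 7"
    using closed_form_values
    by (simp_all only: well_colored_unicycle_egf_nth zero_less_one zero_less_numeral)
  have "?V = fps_X + fps_const (4 / fact 2) * fps_X^2 + fps_const (36 / fact 3) * fps_X^3
           + fps_const (638 / fact 4) * fps_X^4 + fps_const (14480 / fact 5) * fps_X^5
           + fps_const (414312 / fact 6) * fps_X^6 + fps_const (14088424 / fact 7) * fps_X^7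
           + fps_X^8 * fps_shift 8 ?V"
    using fps_expansion_to_order_8[OF V0] by (simp only: coeff fps_const_1_eq_1 mult_1_left)
  then show ?thesis
    using closed log_series_identity[OF T0 Tr0 assms(3), of T_unr] by (metis (no_types))
qed

end
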